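(* Consider the quantum Ising chain in a transverse field, $H=-J\sum_{i\in\mathbb{Z}}\sigma^x_i\sigma^x_{i+1}-h\sum_{i\in\mathbb{Z}}\sigma^z_i$ with $h>0$, let $X=\sigma^z$ and $\beta=\infty$ (i.e. take the unique ground state $\omega$). If $|J/h|>0$ is small enough, then the classical restriction $\mu^z$ of $\omega$ to $\sigma^z$ is non-null, i.e. $\mu^z(x_\Lambda)>0$ for every finite $\Lambda\subset\mathbb{Z}$ and every $x_\Lambda\in\{-1,+1\}^\Lambda$, but $\mu^z$ is not quasi-local: the configuration $x\in\{-1,+1\}^{\mathbb{Z}}$ with $x_i=-1$ for all $i$ is a bad configuration for $\mu^z$.
   Context: $\sigma^x,\sigma^y,\sigma^z$ are the Pauli matrices, with copies at each site of $\mathbb{Z}$ acting on $\mathcal{H}_i=\mathbb{C}^2$. The classical restriction $\mu^z$ of a state $\omega$ is the probability measure on $\Omega=\{-1,+1\}^{\mathbb{Z}}$ with $\mu^z(x_\Lambda)=\omega(\prod_{i\in\Lambda}Q_i(x_i))$, where $Q(\pm1)$ are the spectral projections of $\sigma^z$ onto eigenvalues $\pm1$. A configuration $x\in\Omega$ is bad for a probability measure $\mu$ on $\Omega$ if there are $\varepsilon>0$ and a site $i$ such that for every finite $\Lambda\ni i$ there exist a finite $\Gamma\supset\Lambda$ and configurations $y,y'\in\Omega$ with $\mu(x_{\Lambda\setminus i}y_{\Gamma\setminus\Lambda})>0$, $\mu(x_{\Lambda\setminus i}y'_{\Gamma\setminus\Lambda})>0$ and $|\mu(x_i\mid x_{\Lambda\setminus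 i}y_{\Gamma\setminus\Lambda})-\mu(x_i\mid x_{\Lambda\setminus i}y'_{\Gamma\setminus\Lambda})|>\varepsilon$. *)

theory Defs
  imports Complex_Main
begin

definition spin_configs :: "(int \<Rightarrow> int) set" where
  "spin_configs = {x. \<forall>i. x i \<in> {-1, 1}}"

text \<open>Finite box [-n,n] and the sigma^z-eigenbasis of the Hilbert space of the box:
  configurations with values +-1 on the box (fixed to 1 outside, a dummy convention).\<close>
definition box :: "nat \<Rightarrow> int set" where
  "box n = {- int n .. int n}"

definition box_configs :: "nat \<Rightarrow> (int \<Rightarrow> int) set" where
  "box_configs n = {s. (\<forall>i \<in> box n. s i \<in> {-1, 1}) \<and> (\<forall>i. i \<notin> box n \<longrightarrow> s i = 1)}"

definition flip :: "int \<Rightarrow> (int \<Rightarrow> int) \<Rightarrow> (int \<Rightarrow> int)" where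
  "flip i s = s(i := - s i)"

text \<open>Finite-volume transverse-field Ising Hamiltonian (free boundary conditions)
  H_n = -J sum_{i=-n}^{n-1} sigma^x_i sigma^x_{i+1} - h sum_{i=-n}^{n} sigma^z_i,
  acting on wave functions psi in the sigma^z basis:
  (sigma^z_i psi)(s) = s_i psi(s), (sigma^x_i sigma^x_{i+1} psi)(s) = psi(flip both spins).\<close>
definition ising_H ::
  "real \<Rightarrow> real \<Rightarrow> nat \<Rightarrow> ((int \<Rightarrow> int) \<Rightarrow> complex) \<Rightarrow> ((int \<Rightarrow> int) \<Rightarrow> complex)" where
  "ising_H J h n psi = (\<lambda>s.
      - complex_of_real J * (\<Sum>i \<in> {- int n ..< int n}. psi (flip i (flip (i + 1) s)))
      - complex_of_real h * (\<Sum>i \<in> box n. of_int (s i)) * psi s)"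

definition normalized :: "nat \<Rightarrow> ((int \<Rightarrow> int) \<Rightarrow> complex) \<Rightarrow> bool" where
  "normalized n psi \<longleftrightarrow> (\<Sum>s \<in> box_configs n. (cmod (psi s))\<^sup>2) = 1"

definition energy :: "real \<Rightarrow> real \<Rightarrow> nat \<Rightarrow> ((int \<Rightarrow> int) \<Rightarrow> complex) \<Rightarrow> real" where
  "energy J h n psi = Re (\<Sum>s \<in> box_configs n. cnj (psi s) * ising_H J h n psi s)"

definition ground_state :: "real \<Rightarrow> real \<Rightarrow> nat \<Rightarrow> ((int \<Rightarrow> int) \<Rightarrow> complex) \<Rightarrow> bool" where
  "ground_state J h n psi \<longleftrightarrow> normalized n psi \<and>
     (\<forall>phi. normalized n phi \<longrightarrow> energy J h n psi \<le> energy J h n phi)"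

definition box_prob ::
  "nat \<Rightarrow> ((int \<Rightarrow> int) \<Rightarrow> complex) \<Rightarrow> int set \<Rightarrow> (int \<Rightarrow> int) \<Rightarrow> real" where
  "box_prob n psi L x = (\<Sum>s \<in> {s \<in> box_configs n. \<forall>i \<in> L. s i = x i}. (cmod (psi s))\<^sup>2)"

text \<open>mu is the classical sigma^z-restriction of the infinite-volume ground state, obtained
  as the thermodynamic limit of finite-volume ground states: mu L x = mu^z(x_L).\<close>
definition is_ground_zrestriction ::
  "real \<Rightarrow> real \<Rightarrow> (int set \<Rightarrow> (int \<Rightarrow> int) \<Rightarrow> real) \<Rightarrow> bool" where
  "is_ground_zrestriction J h mu \<longleftrightarrow>
     (\<forall>L x psis. finite L \<longrightarrow> (\<forall>n. ground_state J h n (psis n)) \<longrightarrow>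
        (\<lambda>n. box_prob n (psis n) L x) \<longlonglongrightarrow> mu L x)"

definition non_null :: "(int set \<Rightarrow> (int \<Rightarrow> int) \<Rightarrow> real) \<Rightarrow> bool" where
  "non_null mu \<longleftrightarrow> (\<forall>L x. finite L \<longrightarrow> x \<in> spin_configs \<longrightarrow> mu L x > 0)"

definition glue :: "int set \<Rightarrow> (int \<Rightarrow> int) \<Rightarrow> (int \<Rightarrow> int) \<Rightarrow> (int \<Rightarrow> int)" where
  "glue L x y = (\<lambda>j. if j \<in> L then x j else y j)"

definition cond_prob :: "(int set \<Rightarrow> (int \<Rightarrow> int) \<Rightarrow> real) \<Rightarrow> int \<Rightarrow> int set \<Rightarrow> (int \<Rightarrow> int) \<Rightarrow> real" where
  "cond_prob mu i G z = mu G z / mu (G - {i}) z"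

definition bad_config :: "(int set \<Rightarrow> (int \<Rightarrow> int) \<Rightarrow> real) \<Rightarrow> (int \<Rightarrow> int) \<Rightarrow> bool" where
  "bad_config mu x \<longleftrightarrow> (\<exists>\<epsilon> > 0. \<exists>i. \<forall>L. finite L \<longrightarrow> i \<in> L \<longrightarrow>
     (\<exists>G y y'. finite G \<and> L \<subseteq> G \<and> y \<in> spin_configs \<and> y' \<in> spin_configs \<and>
        mu (G - {i}) (glue L x y) > 0 \<and> mu (G - {i}) (glue L x y') > 0 \<and>
        \<bar>cond_prob mu i G (glue L x y) - cond_prob mu i G (glue L x y')\<bar> > \<epsilon>))"

end

theory Submission
  imports "HOL-Analysis.Bounded_Continuous_Function" "HOL-Analysis.Function_Topology"
    "HOL-Analysis.Bounded_Linear_Function" "Jordan_Normal_Form.Determinant" Defs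
begin

text \<open>
  In Majorana operators the Hamiltonian is the quadratic form $h \sum_{ij} a_i B_{ij} b_j$ with
  $B = 1 - (J/h)\,\mathrm{shift}$. Let $B = P G$ be the polar decomposition, $P = (B B^T)^{1/2}$. The operators
  $\eta_k = a_k + \sum_j G_{kj} b_j$ satisfy $[H, \eta_k] = -2h \sum_l P_{kl} \eta_l$; since $P$ is positive definite and the
  energy of a ground state cannot be lowered, every $\eta_k$ annihilates it. Wick's formula then gives the
  probability of $x$ on $L$ as $\det\, (1 + G_L D_x)/2$, where $D_x$ is the diagonal matrix of $x$, and for small $J/h$ the
  entries of $G$ converge in the infinite-volume limit because $(B B^T)^{-1/2}$ is a power series in a banded matrix.

  Conditioning on plus spins in a large box outside a finite set $S$ of minus spins, the probability relative to
  the all-plus configuration tends to the principal minor $\det A_S$ of the Cayley transform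
  $A = (1 - G)(1 + G)^{-1}$. As $G$ is orthogonal, $A$ is antisymmetric, so this limit vanishes for odd $S$: the spin at
  the origin is determined by the parity of the remaining spins, however far away they are. That every finite set
  extends to a set $S$ with $\det A_S \neq 0$ follows by exchanging pairs of sites from the fact that $G$ maps no nonzero
  finitely supported vector $v$ to a finitely supported $w$: with $\lambda = J/h$ and generating polynomials,
  $(1 - \lambda/z)\, w(z)^2 = (1 - \lambda z)\, v(z)^2$, and the degrees have different parities.
\<close>

section \<open>Bounded operators on bounded sequences\<close>

text \<open>Operators act on bounded rather than square-summable sequences because there the
  operator norm bounds the l1 norm of every row: a norm bound on P - 1 is diagonal dominance of P,
  and positivity of P needs no spectral theory. The price is that transposition is not an operation
  on this algebra, so the antisymmetry of A is proved in finite boxes and carried to the limit.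

  Two different finite matrices approximate G. The polar factor of a box is orthogonal and describes
  the ground state of that box. The compression of the infinite-volume G to a window describes the
  marginals of the limit measure, but it is not orthogonal; this is why the dependence on parity is
  exact only in the limit of large windows.

  Inverses and square roots are power series with coefficients bounded by 1, so commutation,
  supports, transposition and row convergence need checking only on powers.\<close>

text \<open>Completeness of \<open>bcontfun\<close> is available only over metric domains.\<close>
instantiation int :: metric_space
begin
definition dist_int :: "int \<Rightarrow> int \<Rightarrow> real" where "dist_int x y = real_of_int \<bar>x - y\<bar>"
definition uniformity_int :: "(int \<times> int) filter" where
  "uniformity_int = (INF e\<in>{0<..}. principal {(x, y). dist x y < e})"
instance
proof
  show "open U = (\<forall>x\<in>U. \<forall>\<^sub>F (x', y) in uniformity. x' = x \<longrightarrow> y \<in> U)" for U :: "int set"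
  proof -
    have *: "dist x y < 1 \<Longrightarrow> y = x" for x y :: int unfolding dist_int_def by linarith
    have "eventually (\<lambda>(x', y). x' = x \<longrightarrow> y \<in> U) uniformity" if "x \<in> U" for x :: int
      unfolding uniformity_int_def using that
      by (intro eventually_INF1[of "1::real"]) (auto simp: eventually_principal dest!: *)
    thus ?thesis by (auto intro: open_discrete)
  qed
qed (auto simp: dist_int_def uniformity_int_def)
end

instance bcontfun :: (metric_space, banach) banach ..

type_synonym bseq = "int \<Rightarrow>\<^sub>C real"

text \<open>A copy of the type of bounded operators, so that it can be made a Banach algebra.\<close>
typedef op = "UNIV :: ((bseq, bseq) blinfun) set" by simp

setup_lifting type_definition_op

instantiation op :: real_normed_algebra_1
begin
lift_definition zero_op :: op is 0 .
lift_definition one_op :: op is id_blinfun .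
lift_definition plus_op :: "op \<Rightarrow> op \<Rightarrow> op" is "(+)" .
lift_definition minus_op :: "op \<Rightarrow> op \<Rightarrow> op" is "(-)" .
lift_definition uminus_op :: "op \<Rightarrow> op" is "uminus" .
lift_definition times_op :: "op \<Rightarrow> op \<Rightarrow> op" is blinfun_compose .
lift_definition scaleR_op :: "real \<Rightarrow> op \<Rightarrow> op" is "(*\<^sub>R)" .
lift_definition norm_op :: "op \<Rightarrow> real" is norm .
definition dist_op :: "op \<Rightarrow> op \<Rightarrow> real" where "dist_op x y = norm (x - y)"
definition sgn_op :: "op \<Rightarrow> op" where "sgn_op x = scaleR (inverse (norm x)) x"
definition uniformity_op :: "(op \<times> op) filter" where
  "uniformity_op = (INF e\<in>{0<..}. principal {(x, y). dist x y < e})"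
definition open_op :: "op set \<Rightarrow> bool" where
  "open_op U = (\<forall>x\<in>U. eventually (\<lambda>(x', y). x' = x \<longrightarrow> y \<in> U) uniformity)"
instance
proof
  show "(0::op) \<noteq> 1"
  proof (transfer)
    have "apply_bcontfun (blinfun_apply id_blinfun (const_bcontfun 1)) 0 = (1::real)" for t :: int
      by (simp add: const_bcontfun.rep_eq)
    moreover have "apply_bcontfun (blinfun_apply (0 :: (bseq, bseq) blinfun) (const_bcontfun 1)) 0 = (0::real)"
      by simp
    ultimately show "(0 :: (bseq, bseq) blinfun) \<noteq> id_blinfun" by (metis zero_neq_one)
  qed
  show "norm (1::op) = 1"
  proof transfer
    have "(const_bcontfun 1 :: bseq) \<noteq> 0"
      by (metis (no_types) const_bcontfun.rep_eq zero_bcontfun.rep_eq zero_neq_one)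
    hence "(\<exists>x::bseq. x \<noteq> 0)" by blast
    then obtain x :: bseq where x: "x \<noteq> 0" by blast
    have "norm (id_blinfun :: (bseq, bseq) blinfun) \<le> 1" by (rule norm_blinfun_id_le)
    moreover have "norm x \<le> norm (id_blinfun :: (bseq, bseq) blinfun) * norm x"
      using norm_blinfun[of id_blinfun x] by simp
    ultimately show "norm (id_blinfun :: (bseq, bseq) blinfun) = 1" using x by simp
  qed
next
  fix a b c :: op and r q :: real
  show "a + b + c = a + (b + c)" by transfer (rule add.assoc)
  show "a + b = b + a" by transfer (rule add.commute)
  show "0 + a = a" by transfer (rule add_0_left)
  show "- a + a = 0" by transfer (rule left_minus)
  show "a - b = a + - b" by transfer (rule diff_conv_add_uminus)
  show "r *\<^sub>R (a + b) = r *\<^sub>R a + r *\<^sub>R b" by transfer (rule scaleR_add_right)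
  show "(r + q) *\<^sub>R a = r *\<^sub>R a + q *\<^sub>R a" by transfer (rule scaleR_add_left)
  show "r *\<^sub>R q *\<^sub>R a = (r * q) *\<^sub>R a" by transfer (rule scaleR_scaleR)
  show "1 *\<^sub>R a = a" by transfer (rule scaleR_one)
  show "a * b * c = a * (b * c)" by transfer (rule blinfun_eqI, simp)
  show "(a + b) * c = a * c + b * c" by transfer (rule blinfun_eqI, simp add: blinfun.add_left)
  show "a * (b + c) = a * b + a * c" by transfer (rule blinfun_eqI, simp add: blinfun.add_left blinfun.add_right)
  show "r *\<^sub>R a * b = r *\<^sub>R (a * b)" by transfer (rule blinfun_eqI, simp add: blinfun.scaleR_left)
  show "a * r *\<^sub>R b = r *\<^sub>R (a * b)"
    by transfer (rule blinfun_eqI, simp add: blinfun.scaleR_left blinfun.scaleR_right)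
  show "1 * a = a" by transfer (rule blinfun_eqI, simp)
  show "a * 1 = a" by transfer (rule blinfun_eqI, simp)
  show "dist a b = norm (a - b)" by (rule dist_op_def)
  show "sgn a = inverse (norm a) *\<^sub>R a" by (rule sgn_op_def)
  show "(uniformity :: (op \<times> op) filter) = (INF e\<in>{0<..}. principal {(x, y). dist x y < e})"
    by (rule uniformity_op_def)
  show "open U = (\<forall>x\<in>U. \<forall>\<^sub>F (x', y) in uniformity. x' = x \<longrightarrow> y \<in> U)" for U :: "op set"
    by (rule open_op_def)
  show "(norm a = 0) = (a = 0)" by transfer (rule norm_eq_zero)
  show "norm (a + b) \<le> norm a + norm b" by transfer (rule norm_triangle_ineq)
  show "norm (r *\<^sub>R a) = \<bar>r\<bar> * norm a" by transfer (rule norm_scaleR)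
  show "norm (a * b) \<le> norm a * norm b" by transfer (rule norm_blinfun_compose)
qed
end

lemma op_dist_rep: "dist x y = dist (Rep_op x) (Rep_op y)"
  unfolding dist_op_def dist_norm by transfer rule

instance op :: banach
proof
  fix X :: "nat \<Rightarrow> op" assume "Cauchy X"
  hence "Cauchy (\<lambda>n. Rep_op (X n))" unfolding Cauchy_def op_dist_rep .
  hence "convergent (\<lambda>n. Rep_op (X n))" by (rule Cauchy_convergent)
  then obtain L where "(\<lambda>n. Rep_op (X n)) \<longlonglongrightarrow> L" unfolding convergent_def ..
  hence "X \<longlonglongrightarrow> Abs_op L" unfolding lim_sequentially op_dist_rep by (simp add: Abs_op_inverse)
  thus "convergent X" by (auto simp: convergent_def)
qed

lift_definition app :: "op \<Rightarrow> bseq \<Rightarrow> bseq" is blinfun_apply .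

lemma app_simps [simp]:
  "app (X + Y) v = app X v + app Y v" "app (X - Y) v = app X v - app Y v" "app (- X) v = - app X v"
  "app (X * Y) v = app X (app Y v)" "app (c *\<^sub>R X) v = c *\<^sub>R app X v" "app 1 v = v" "app 0 v = 0"
  "app X (v + w) = app X v + app X w" "app X (v - w) = app X v - app X w" "app X (c *\<^sub>R v) = c *\<^sub>R app X v" "app X 0 = 0"
  by (transfer; simp add: blinfun.bilinear_simps)+

lemma app_sum: "app X (\<Sum>i\<in>F. f i) = (\<Sum>i\<in>F. app X (f i))"
  by transfer (simp add: blinfun.sum_right)

lemma norm_app: "norm (app X v) \<le> norm X * norm v"
  by transfer (rule norm_blinfun)

lemma norm_op_bound: "0 \<le> b \<Longrightarrow> (\<And>v. norm (app X v) \<le> b * norm v) \<Longrightarrow> norm X \<le> b"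
  by transfer (rule norm_blinfun_bound)

lemma op_eqI: "(\<And>v i. app X v i = app Y v i) \<Longrightarrow> X = Y"
  by transfer (auto intro!: blinfun_eqI bcontfun_eqI)

lemma bseq_mem: "(\<And>i. \<bar>f i\<bar> \<le> b) \<Longrightarrow> (f :: int \<Rightarrow> real) \<in> bcontfun"
  by (rule bcontfun_normI[where b=b]) (auto intro: continuous_on_discrete)

lemma bseq_norm_le: "(\<And>i. \<bar>apply_bcontfun v i\<bar> \<le> b) \<Longrightarrow> norm (v :: bseq) \<le> b"
  using norm_bound[of v b] by simp

lemma abs_le_norm: "\<bar>apply_bcontfun v i\<bar> \<le> norm (v :: bseq)"
  using norm_bounded[of v i] by simp

text \<open>Masked composition. Full and compressed shifts, coordinate projections and row
  evaluations are all of this form, so boundedness is checked once.\<close>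

definition comp_fun :: "(int \<Rightarrow> bool) \<Rightarrow> (int \<Rightarrow> int) \<Rightarrow> bseq \<Rightarrow> bseq" where
  "comp_fun m f v = Bcontfun (\<lambda>i. if m i then v (f i) else 0)"

lemma comp_fun_rep: "apply_bcontfun (comp_fun m f v) i = (if m i then v (f i) else 0)"
proof -
  have "\<bar>if m i then apply_bcontfun v (f i) else 0\<bar> \<le> norm v" for i
    using abs_le_norm[of v "f i"] by simp
  hence "(\<lambda>i. if m i then apply_bcontfun v (f i) else 0) \<in> bcontfun" by (rule bseq_mem)
  thus ?thesis by (simp add: comp_fun_def Bcontfun_inverse)
qed

lift_definition comp_op :: "(int \<Rightarrow> bool) \<Rightarrow> (int \<Rightarrow> int) \<Rightarrow> op" is "\<lambda>m f. Blinfun (comp_fun m f)" .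

lemma comp_fun_bl: "bounded_linear (comp_fun m f)" "norm (comp_fun m f v) \<le> norm v"
proof -
  show *: "norm (comp_fun m f v) \<le> norm v" for v
    by (rule bseq_norm_le) (auto simp: comp_fun_rep intro: abs_le_norm)
  show "bounded_linear (comp_fun m f)"
    by (rule bounded_linear_intro[where K=1]) (auto intro!: bcontfun_eqI simp: comp_fun_rep *)
qed

lemma app_comp_op [simp]: "apply_bcontfun (app (comp_op m f) v) i = (if m i then v (f i) else 0)"
  by transfer (simp add: bounded_linear_Blinfun_apply comp_fun_bl comp_fun_rep)

lemma norm_comp_op: "norm (comp_op m f) \<le> 1"
  by (rule norm_op_bound, simp, rule bseq_norm_le) (auto intro: abs_le_norm)


definition basis_seq :: "int \<Rightarrow> bseq" where "basis_seq j = Bcontfun (\<lambda>i. if i = j then 1 else 0)"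

lemma basis_seq_apply [simp]: "apply_bcontfun (basis_seq j) i = (if i = j then 1 else 0)"
proof -
  have "(\<lambda>i. if i = j then 1 else (0::real)) \<in> bcontfun" by (rule bseq_mem[where b=1]) auto
  thus ?thesis by (simp add: basis_seq_def Bcontfun_inverse)
qed

lemma apply_bcontfun_sum: "apply_bcontfun (\<Sum>k\<in>F. f k) i = (\<Sum>k\<in>F. apply_bcontfun (f k :: bseq) i)"
  by (induction F rule: infinite_finite_induct) auto

lemma finite_support_expand:
  assumes "finite F" "\<And>i. i \<notin> F \<Longrightarrow> apply_bcontfun v i = 0"
  shows "v = (\<Sum>k\<in>F. v k *\<^sub>R basis_seq k)"
  using assms by (intro bcontfun_eqI) (auto simp: apply_bcontfun_sum if_distrib sum.delta cong: if_cong)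

text \<open>Entries do not determine an operator on bounded sequences: one that reads off a Banach
  limit has all entries zero. Hence \<open>app_finite_support\<close> is confined to finitely
  supported vectors.\<close>

definition entry :: "op \<Rightarrow> int \<Rightarrow> int \<Rightarrow> real" where "entry X i j = app X (basis_seq j) i"

lemma entry_simps [simp]: "entry (X + Y) i j = entry X i j + entry Y i j" "entry (X - Y) i j = entry X i j - entry Y i j"
  "entry (- X) i j = - entry X i j" "entry (c *\<^sub>R X) i j = c * entry X i j" "entry 1 i j = (if i = j then 1 else 0)"
  by (auto simp: entry_def)

lemma app_finite_support:
  assumes "finite F" "\<And>i. i \<notin> F \<Longrightarrow> apply_bcontfun v i = 0"
  shows "app X v i = (\<Sum>k\<in>F. entry X i k * v k)"
  by (subst finite_support_expand[OF assms]) (auto simp: app_sum apply_bcontfun_sum entry_def mult.commute)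

lemma bounded_linear_app: "bounded_linear (\<lambda>X. apply_bcontfun (app X v) i)"
proof (rule bounded_linear_intro[where K="norm v"])
  show "norm (apply_bcontfun (app X v) i) \<le> norm X * norm v" for X
    using abs_le_norm[of "app X v" i] norm_app[of X v] by simp
qed auto

text \<open>Test \<open>X\<close> on the sign vector of row \<open>i\<close> over \<open>F\<close>,
  whose sup norm is at most 1. This turns the bound on \<open>modulus l F - 1\<close> into the
  diagonal dominance that \<open>quad_lower\<close> asks for.\<close>

lemma sum_abs_entry_le:
  assumes "finite F" shows "(\<Sum>j\<in>F. \<bar>entry X i j\<bar>) \<le> norm X"
proof -
  define v where "v = (\<Sum>j\<in>F. sgn (entry X i j) *\<^sub>R basis_seq j)"
  have v: "apply_bcontfun v k = (if k \<in> F then sgn (entry X i k) else 0)" for k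
    using assms by (auto simp: v_def apply_bcontfun_sum if_distrib sum.delta cong: if_cong)
  have "(\<Sum>j\<in>F. \<bar>entry X i j\<bar>) = app X v i"
    using assms by (subst app_finite_support[of F]) (auto simp: v abs_sgn intro!: sum.cong)
  also have "\<dots> \<le> norm X * norm v" using abs_le_norm[of "app X v" i] norm_app[of X v] by simp
  also have "\<dots> \<le> norm X * 1"
    by (intro mult_left_mono bseq_norm_le) (auto simp: v sgn_real_def)
  finally show ?thesis by simp
qed


section \<open>Power series in an operator\<close>

definition power_sum :: "(nat \<Rightarrow> real) \<Rightarrow> op \<Rightarrow> op" where "power_sum c X = (\<Sum>k. c k *\<^sub>R X ^ k)"

text \<open>The binomial series of (1 + X)^(-1/2) and the geometric series of (1 + t X)^(-1) both
  have coefficients bounded by 1, so q^k is a common majorant.\<close>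

lemma power_sum_term_norm:
  assumes "\<bar>c k\<bar> \<le> 1" "norm X \<le> q"
  shows "norm (c k *\<^sub>R (X :: op) ^ k) \<le> q ^ k"
proof -
  have "norm (X ^ k) \<le> q ^ k" using norm_power_ineq[of X k] power_mono[OF assms(2), of k] by simp
  thus ?thesis using assms(1) mult_mono[of "\<bar>c k\<bar>" 1 "norm (X^k)" "q^k"] by simp
qed

context
  fixes c :: "nat \<Rightarrow> real" and q :: real
  assumes c: "\<And>k. \<bar>c k\<bar> \<le> 1" and q: "q < 1"
begin

lemma power_sum_norm_summable: "norm X \<le> q \<Longrightarrow> summable (\<lambda>k. norm (c k *\<^sub>R (X :: op) ^ k))"
proof (rule summable_comparison_test'[where g="\<lambda>k. q ^ k" and N=0])
  assume X: "norm X \<le> q"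
  hence "0 \<le> q" using norm_ge_zero order_trans by blast
  thus "summable (\<lambda>k. q ^ k)" using q by (intro summable_geometric) auto
  show "norm (norm (c k *\<^sub>R X ^ k)) \<le> q ^ k" for k using power_sum_term_norm[of c k X q] c X by simp
qed

lemma power_sum_sums: "norm X \<le> q \<Longrightarrow> (\<lambda>k. c k *\<^sub>R X ^ k) sums power_sum c X"
  unfolding power_sum_def by (rule summable_sums, rule summable_norm_cancel, rule power_sum_norm_summable)

lemma power_sum_norm: 
  assumes X: "norm X \<le> q" shows "norm (power_sum c X - c 0 *\<^sub>R 1) \<le> q / (1 - q)"
proof -
  have q0: "0 \<le> q" using X norm_ge_zero order_trans by blast
  have s: "(\<lambda>k. c (Suc k) *\<^sub>R X ^ Suc k) sums (power_sum c X - c 0 *\<^sub>R 1)"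
    using power_sum_sums[OF X] by (subst sums_Suc_iff) simp
  have g: "(\<lambda>k. q * q ^ k) sums (q * (1 / (1 - q)))" using q q0 by (intro sums_mult geometric_sums) auto
  have "norm (c (Suc k) *\<^sub>R X ^ Suc k) \<le> q * q ^ k" for k
    using power_sum_term_norm[of c "Suc k" X q] c X by simp
  hence "norm (\<Sum>k. c (Suc k) *\<^sub>R X ^ Suc k) \<le> (\<Sum>k. q * q ^ k)"
    using g by (intro norm_suminf_le) (auto simp: sums_iff)
  thus ?thesis using s g by (simp add: sums_iff)
qed

lemma power_sum_commute:
  assumes X: "norm X \<le> q" and "Y * X = X * Y" shows "Y * power_sum c X = power_sum c X * Y"
proof -
  have "Y * X ^ k = X ^ k * Y" for k
    by (induction k) (auto simp: assms(2) mult.assoc, metis assms(2) mult.assoc)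
  hence "(\<lambda>k. Y * (c k *\<^sub>R X ^ k)) = (\<lambda>k. (c k *\<^sub>R X ^ k) * Y)" by auto
  moreover have "(\<lambda>k. Y * (c k *\<^sub>R X ^ k)) sums (Y * power_sum c X)"
    by (rule bounded_linear.sums[OF bounded_linear_mult_right power_sum_sums[OF X]])
  moreover have "(\<lambda>k. (c k *\<^sub>R X ^ k) * Y) sums (power_sum c X * Y)"
    by (rule bounded_linear.sums[OF bounded_linear_mult_left power_sum_sums[OF X]])
  ultimately show ?thesis using sums_unique2 by metis
qed

end

text \<open>Neumann series; the product telescopes. The inverse on the other side follows with
  \<open>power_sum_commute\<close>.\<close>

lemma power_sum_geometric:
  assumes "\<bar>t\<bar> \<le> 1" "norm X < 1"
  shows "(1 + t *\<^sub>R X) * power_sum (\<lambda>k. (-t) ^ k) X = 1"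
proof -
  let ?c = "\<lambda>k. (-t) ^ k"
  have c: "\<bar>?c k\<bar> \<le> 1" for k using assms(1) by (simp add: power_abs power_le_one)
  note s = power_sum_sums[of ?c "norm X", OF c assms(2) order_refl]
  let ?f = "\<lambda>k. ?c k *\<^sub>R X ^ k"
  have "?f \<longlonglongrightarrow> 0" by (rule summable_LIMSEQ_zero[OF sums_summable[OF s]])
  hence "(\<lambda>k. ?f k - ?f (Suc k)) sums (?f 0 - 0)" by (rule telescope_sums')
  moreover have "(\<lambda>k. (1 + t *\<^sub>R X) * ?f k) sums ((1 + t *\<^sub>R X) * power_sum ?c X)"
    by (rule bounded_linear.sums[OF bounded_linear_mult_right s])
  moreover have "(1 + t *\<^sub>R X) * ?f k = ?f k - ?f (Suc k)" for k by (simp add: algebra_simps)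
  ultimately show ?thesis using sums_unique2 by fastforce
qed

definition inv_sqrt_coeff :: "nat \<Rightarrow> real" where "inv_sqrt_coeff k = (-1/2) gchoose k"

text \<open>Consecutive coefficients have ratio -(k + 1/2)/(k + 1).\<close>

lemma inv_sqrt_coeff_bound: "\<bar>inv_sqrt_coeff k\<bar> \<le> 1"
proof (induction k)
  case (Suc k)
  have "inv_sqrt_coeff (Suc k) = inv_sqrt_coeff k * ((-1/2 - real k) / (real k + 1))"
    using gbinomial_mult_1[of "-1/2 :: real" k] by (simp add: inv_sqrt_coeff_def field_simps)
  hence "\<bar>inv_sqrt_coeff (Suc k)\<bar> = \<bar>inv_sqrt_coeff k\<bar> * \<bar>(-1/2 - real k) / (real k + 1)\<bar>" by (simp only: abs_mult)
  moreover have "\<bar>(-1/2 - real k) / (real k + 1)\<bar> \<le> 1" by (simp add: abs_if field_simps)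
  ultimately show ?case using mult_le_one[OF Suc abs_ge_zero] by metis
qed (simp add: inv_sqrt_coeff_def)

text \<open>In the Cauchy product, Vandermonde's identity sums the coefficients to (-1 choose k) =
  (-1)^k, so the square of the series is the Neumann series of 1 + X.\<close>

lemma inv_sqrt_coeff_square: 
  assumes "norm X < 1" shows "power_sum inv_sqrt_coeff X * power_sum inv_sqrt_coeff X * (1 + X) = 1"
proof -
  have s: "summable (\<lambda>k. norm (inv_sqrt_coeff k *\<^sub>R X ^ k))"
    by (rule power_sum_norm_summable[of inv_sqrt_coeff "norm X"]) (use inv_sqrt_coeff_bound assms in auto)
  have "power_sum inv_sqrt_coeff X * power_sum inv_sqrt_coeff X = (\<Sum>k. \<Sum>i\<le>k. (inv_sqrt_coeff i *\<^sub>R X ^ i) * (inv_sqrt_coeff (k - i) *\<^sub>R X ^ (k - i)))"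
    unfolding power_sum_def by (rule Cauchy_product[OF s s])
  also have "(\<lambda>k. \<Sum>i\<le>k. (inv_sqrt_coeff i *\<^sub>R X ^ i) * (inv_sqrt_coeff (k - i) *\<^sub>R X ^ (k - i))) = (\<lambda>k. (-1) ^ k *\<^sub>R X ^ k)"
  proof
    fix k
    have "(\<Sum>i\<le>k. (inv_sqrt_coeff i *\<^sub>R X ^ i) * (inv_sqrt_coeff (k - i) *\<^sub>R X ^ (k - i))) = (\<Sum>i\<le>k. (inv_sqrt_coeff i * inv_sqrt_coeff (k - i)) *\<^sub>R X ^ k)"
      by (intro sum.cong) (auto simp: power_add[symmetric])
    also have "\<dots> = (\<Sum>i\<le>k. inv_sqrt_coeff i * inv_sqrt_coeff (k - i)) *\<^sub>R X ^ k" by (simp add: scaleR_sum_left)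
    also have "(\<Sum>i\<le>k. inv_sqrt_coeff i * inv_sqrt_coeff (k - i)) = (-1) gchoose k"
      using gbinomial_Vandermonde[of "-1/2 :: real" "-1/2" k] by (simp add: inv_sqrt_coeff_def atMost_atLeast0)
    also have "\<dots> = (-1) ^ k" using gbinomial_minus[of "1::real" k] by (simp add: binomial_gbinomial[symmetric])
    finally show "(\<Sum>i\<le>k. (inv_sqrt_coeff i *\<^sub>R X ^ i) * (inv_sqrt_coeff (k - i) *\<^sub>R X ^ (k - i))) = (-1) ^ k *\<^sub>R X ^ k" .
  qed
  finally have "power_sum inv_sqrt_coeff X * power_sum inv_sqrt_coeff X = power_sum (\<lambda>k. (-1) ^ k) X" by (simp add: power_sum_def)
  moreover have "(1 + 1 *\<^sub>R X) * power_sum (\<lambda>k. (-1) ^ k) X = 1" by (rule power_sum_geometric) (use assms in auto)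
  moreover have "(1 + X) * power_sum (\<lambda>k. (-1) ^ k) X = power_sum (\<lambda>k. (-1) ^ k) X * (1 + X)"
    by (rule power_sum_commute[where q="norm X"]) (use assms in \<open>auto simp: algebra_simps\<close>)
  ultimately show ?thesis by simp
qed


section \<open>Row-wise convergence\<close>

definition proj_op :: "int set \<Rightarrow> op" where "proj_op F = comp_op (\<lambda>i. i \<in> F) (\<lambda>i. i)"
text \<open>The value \<open>v i\<close> is spread to a constant sequence so that row
  \<open>i\<close> of \<open>X\<close>, a functional, becomes the operator
  \<open>row_op i * X\<close> and its norm is an operator norm.\<close>

definition row_op :: "int \<Rightarrow> op" where "row_op i = comp_op (\<lambda>_. True) (\<lambda>_. i)"

lemma app_proj_op [simp]: "apply_bcontfun (app (proj_op F) v) i = (if i \<in> F then v i else 0)"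
  by (simp add: proj_op_def)

lemma app_row_op [simp]: "apply_bcontfun (app (row_op i) v) k = v i"
  by (simp add: row_op_def)

lemma norm_proj_op: "norm (proj_op F) \<le> 1" and norm_row_op: "norm (row_op i) \<le> 1"
  by (auto simp: proj_op_def row_op_def norm_comp_op)

lemma norm_mult_le1: "norm (X::op) \<le> 1 \<Longrightarrow> norm (X * Y) \<le> norm Y"
  using norm_mult_ineq[of X Y] mult_right_mono[of "norm X" 1 "norm Y"] by simp

lemma norm_mult_le2: "norm (Y::op) \<le> 1 \<Longrightarrow> norm (X * Y) \<le> norm X"
  using norm_mult_ineq[of X Y] mult_left_mono[of "norm Y" 1 "norm X"] by simp

lemma norm_rw_mult: "norm (row_op i * X) \<le> norm X"
  by (rule norm_mult_le1[OF norm_row_op])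

lemma row_op_expand:
  assumes "finite F"
  shows "row_op i * (X * (proj_op F * Z)) = (\<Sum>k\<in>F. entry X i k *\<^sub>R (row_op k * Z))"
proof (rule op_eqI)
  fix v j
  have s: "apply_bcontfun (app (sum f F) v) j = (\<Sum>k\<in>F. app (f k) v j)" for f :: "int \<Rightarrow> op"
    by (induction F rule: infinite_finite_induct) auto
  show "apply_bcontfun (app (row_op i * (X * (proj_op F * Z))) v) j = app (\<Sum>k\<in>F. entry X i k *\<^sub>R (row_op k * Z)) v j"
    using assms by (simp add: s app_finite_support[of F "app (proj_op F) (app Z v)"])
qed

text \<open>Convergence of every row in the \<open>\<ell>\<^sup>1\<close> norm. Finite-volume operators converge to infinite-volume
  ones only in this sense, not in operator norm; products are preserved if the limit has rows that are
  approximated by their truncations.\<close>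
definition row_tendsto :: "(nat \<Rightarrow> op) \<Rightarrow> op \<Rightarrow> bool" where
  "row_tendsto X Y \<longleftrightarrow> (\<forall>i. (\<lambda>n. row_op i * X n) \<longlonglongrightarrow> row_op i * Y)"

definition row_tight :: "op \<Rightarrow> bool" where "row_tight X \<longleftrightarrow> row_tendsto (\<lambda>m. X * proj_op (box m)) X"

lemma row_tendsto_entry: "row_tendsto X Y \<Longrightarrow> (\<lambda>n. entry (X n) i j) \<longlonglongrightarrow> entry Y i j"
proof -
  assume "row_tendsto X Y"
  hence "(\<lambda>n. row_op i * X n) \<longlonglongrightarrow> row_op i * Y" by (simp add: row_tendsto_def)
  from bounded_linear.tendsto[OF bounded_linear_app[of "basis_seq j" 0] this] show ?thesis
    by (simp add: entry_def)
qed

lemma row_tendsto_const [simp]: "row_tendsto (\<lambda>n. X) X"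
  by (simp add: row_tendsto_def)

lemma row_tendsto_diff: "row_tendsto X A \<Longrightarrow> row_tendsto Y B \<Longrightarrow> row_tendsto (\<lambda>n. X n - Y n) (A - B)"
  unfolding row_tendsto_def by (auto simp: right_diff_distrib intro: tendsto_diff)

lemma row_tendsto_scaleR: "row_tendsto X A \<Longrightarrow> row_tendsto (\<lambda>n. c *\<^sub>R X n) (c *\<^sub>R A)"
  unfolding row_tendsto_def by (auto intro: tendsto_intros)

lemma finite_box [simp]: "finite (box n)"
  by (simp add: box_def)

lemma row_tendsto_mult:
  \<comment> \<open>Split X_n Y_n - A B into (X_n - A) Y_n and A (Y_n - B). The uniform bound on Y_n
    settles the first. In the second, tightness replaces row \<open>i\<close> of A by a truncation
    up to a small error, and the truncated row meets only finitely many rows of Y_n - B.\<close>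
  assumes X: "row_tendsto X A" and Y: "row_tendsto Y B" and b: "\<And>n. norm (Y n) \<le> b" and A: "row_tight A"
  shows "row_tendsto (\<lambda>n. X n * Y n) (A * B)"
  unfolding row_tendsto_def
proof
  fix i
  have b0: "0 \<le> b" using b[of 0] norm_ge_zero order_trans by blast
  have 1: "(\<lambda>n. row_op i * (X n - A) * Y n) \<longlonglongrightarrow> 0"
  proof (rule Lim_null_comparison)
    have "(\<lambda>n. row_op i * X n - row_op i * A) \<longlonglongrightarrow> 0" using X by (simp add: row_tendsto_def LIM_zero)
    hence "(\<lambda>n. norm (row_op i * (X n - A)) * b) \<longlonglongrightarrow> 0"
      by (intro tendsto_mult_left_zero tendsto_norm_zero) (simp add: right_diff_distrib)
    thus "(\<lambda>n. norm (row_op i * (X n - A)) * b) \<longlonglongrightarrow> 0" .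
    show "\<forall>\<^sub>F n in sequentially. norm (row_op i * (X n - A) * Y n) \<le> norm (row_op i * (X n - A)) * b"
      by (intro always_eventually allI order_trans[OF norm_mult_ineq] mult_left_mono b) auto
  qed
  have 2: "(\<lambda>n. row_op i * A * (Y n - B)) \<longlonglongrightarrow> 0"
  proof (rule tendstoI)
    fix \<epsilon> :: real assume \<epsilon>: "0 < \<epsilon>"
    define c where "c = b + norm B + 1"
    have c: "norm (Y n - B) \<le> c" "c > 0" for n
      using norm_triangle_ineq4[of "Y n" B] b[of n] b0 by (auto simp: c_def intro: add_nonneg_pos)
    have "(\<lambda>m. row_op i * (A * proj_op (box m))) \<longlonglongrightarrow> row_op i * A" using A by (simp add: row_tight_def row_tendsto_def)
    hence "\<forall>\<^sub>F m in sequentially. dist (row_op i * (A * proj_op (box m))) (row_op i * A) < \<epsilon> / (2 * c)"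
      by (rule tendstoD) (use \<epsilon> c in auto)
    then obtain m where "dist (row_op i * (A * proj_op (box m))) (row_op i * A) < \<epsilon> / (2 * c)"
      using eventually_happens' trivial_limit_sequentially by blast
    hence m: "norm (row_op i * A - row_op i * (A * proj_op (box m))) < \<epsilon> / (2 * c)"
      by (simp add: dist_norm norm_minus_commute)
    have "(\<lambda>n. \<Sum>k\<in>box m. entry A i k *\<^sub>R (row_op k * (Y n - B))) \<longlonglongrightarrow> (\<Sum>k\<in>box m. entry A i k *\<^sub>R 0)"
    proof (intro tendsto_sum tendsto_scaleR tendsto_const)
      show "(\<lambda>n. row_op k * (Y n - B)) \<longlonglongrightarrow> 0" for k
        using Y by (simp add: row_tendsto_def LIM_zero right_diff_distrib)
    qed
    hence "(\<lambda>n. row_op i * (A * (proj_op (box m) * (Y n - B)))) \<longlonglongrightarrow> 0" by (simp add: row_op_expand)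
    from tendstoD[OF this, of "\<epsilon>/2"] \<epsilon>
    have "\<forall>\<^sub>F n in sequentially. norm (row_op i * (A * (proj_op (box m) * (Y n - B)))) < \<epsilon>/2" by simp
    thus "\<forall>\<^sub>F n in sequentially. dist (row_op i * A * (Y n - B)) 0 < \<epsilon>"
    proof eventually_elim
      case (elim n)
      define U where "U = (row_op i * A - row_op i * (A * proj_op (box m))) * (Y n - B)"
      define V where "V = row_op i * (A * (proj_op (box m) * (Y n - B)))"
      have "row_op i * A * (Y n - B) = U + V"
        by (simp add: algebra_simps U_def V_def)
      moreover have "norm (U + V) \<le> norm U + norm V" by (rule norm_triangle_ineq)
      moreover have "norm U \<le> \<epsilon> / (2 * c) * c" unfolding U_def
        by (rule order_trans[OF norm_mult_ineq]) (intro mult_mono c, use m \<epsilon> c in auto)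
      moreover have "\<epsilon> / (2 * c) * c = \<epsilon> / 2" using c(2) by simp
      moreover have "norm V < \<epsilon> / 2" using elim by (simp add: V_def)
      ultimately have "norm (row_op i * A * (Y n - B)) < \<epsilon>" by simp
      thus ?case by simp
    qed
  qed
  have "(\<lambda>n. row_op i * (X n - A) * Y n + row_op i * A * (Y n - B) + row_op i * (A * B)) \<longlonglongrightarrow> 0 + 0 + row_op i * (A * B)"
    by (intro tendsto_add 1 2 tendsto_const)
  thus "(\<lambda>n. row_op i * (X n * Y n)) \<longlonglongrightarrow> row_op i * (A * B)" by (simp add: algebra_simps)
qed

text \<open>Tannery's theorem, applied to each row separately.\<close>

lemma row_tendsto_series:
  assumes "\<And>k. row_tendsto (\<lambda>n. f n k) (g k)" "\<And>n k. norm (f n k) \<le> M k" "summable M"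
  shows "row_tendsto (\<lambda>n. \<Sum>k. f n k) (\<Sum>k. g k)"
  unfolding row_tendsto_def
proof
  fix i
  have lim: "(\<lambda>n. row_op i * f n k) \<longlonglongrightarrow> row_op i * g k" for k using assms(1) by (simp add: row_tendsto_def)
  have bd: "norm (row_op i * f n k) \<le> M k" for n k using norm_rw_mult[of i "f n k"] assms(2)[of n k] by linarith
  have T: "(\<lambda>n. \<Sum>k. row_op i * f n k) \<longlonglongrightarrow> (\<Sum>k. row_op i * g k)"
    using tannerys_theorem[of "\<lambda>k n. row_op i * f n k", OF lim _ assms(3)] bd by (simp add: always_eventually)
  have sf: "summable (f n)" for n by (rule summable_comparison_test'[OF assms(3), of 0]) (use assms(2) in auto)
  \<comment> \<open>Without norm convergence of \<open>f n k\<close> the bound passes to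
    \<open>g k\<close> through the coordinates of \<open>app (g k) v\<close>, which are limits of
    those of \<open>app (f n k) v\<close>.\<close>
  have "norm (g k) \<le> M k" for k
  proof (rule norm_op_bound)
    show "0 \<le> M k" by (rule order_trans[OF norm_ge_zero assms(2)[of 0 k]])
    fix v
    show "norm (app (g k) v) \<le> M k * norm v"
    proof (rule bseq_norm_le)
      fix i
      have "(\<lambda>n. app (row_op i * f n k) v 0) \<longlonglongrightarrow> app (row_op i * g k) v 0"
        using assms(1) by (intro bounded_linear.tendsto[OF bounded_linear_app]) (simp add: row_tendsto_def)
      hence "(\<lambda>n. \<bar>app (f n k) v i\<bar>) \<longlonglongrightarrow> \<bar>app (g k) v i\<bar>" by (intro tendsto_rabs) simp
      moreover have "\<bar>app (f n k) v i\<bar> \<le> M k * norm v" for n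
        using abs_le_norm[of "app (f n k) v" i] norm_app[of "f n k" v] mult_right_mono[OF assms(2)[of n k], of "norm v"] by simp
      ultimately show "\<bar>app (g k) v i\<bar> \<le> M k * norm v" by (intro LIMSEQ_le_const2) auto
    qed
  qed
  hence sg: "summable g" by (intro summable_comparison_test'[OF assms(3), of 0]) auto
  show "(\<lambda>n. row_op i * (\<Sum>k. f n k)) \<longlonglongrightarrow> row_op i * (\<Sum>k. g k)"
    using T by (simp add: bounded_linear.suminf[OF bounded_linear_mult_right sf]
        bounded_linear.suminf[OF bounded_linear_mult_right sg])
qed

text \<open>Row \<open>i\<close> has at most one nonzero entry, in column \<open>f i\<close>, so
  truncation leaves it unchanged once the box contains \<open>f i\<close>.\<close>

lemma row_tight_comp_op [simp]: "row_tight (comp_op m f)"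
  unfolding row_tight_def row_tendsto_def
proof
  fix i
  have "\<forall>\<^sub>F n in sequentially. row_op i * (comp_op m f * proj_op (box n)) = row_op i * comp_op m f"
    using eventually_ge_at_top[of "nat \<bar>f i\<bar>"]
    by eventually_elim (auto intro!: op_eqI simp: box_def)
  thus "(\<lambda>n. row_op i * (comp_op m f * proj_op (box n))) \<longlonglongrightarrow> row_op i * comp_op m f" by (rule tendsto_eventually)
qed

lemma comp_op_one: "comp_op (\<lambda>_. True) (\<lambda>i. i) = 1" by (rule op_eqI) simp

lemma row_tight_one [simp]: "row_tight 1" using row_tight_comp_op[of "\<lambda>_. True" "\<lambda>i. i"] by (simp add: comp_op_one)

lemma row_tight_diff: "row_tight X \<Longrightarrow> row_tight Y \<Longrightarrow> row_tight (X - Y)"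
  unfolding row_tight_def using row_tendsto_diff[of "\<lambda>m. X * proj_op (box m)" X] by (simp add: left_diff_distrib)

lemma row_tight_scaleR: "row_tight X \<Longrightarrow> row_tight (c *\<^sub>R X)"
  unfolding row_tight_def using row_tendsto_scaleR[of "\<lambda>m. X * proj_op (box m)" X] by simp

lemma row_tight_mult: "row_tight X \<Longrightarrow> row_tight Y \<Longrightarrow> row_tight (X * Y)"
  using row_tendsto_mult[of "\<lambda>_. X" X "\<lambda>m. Y * proj_op (box m)" Y "norm Y"]
  by (simp add: row_tight_def mult.assoc norm_mult_le2 norm_proj_op)

lemma row_tight_power: "row_tight X \<Longrightarrow> row_tight (X ^ k)"
  by (induction k) (auto intro: row_tight_mult)

lemma row_tendsto_proj: "row_tendsto (\<lambda>n. proj_op (box n)) 1"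
  using row_tight_one by (simp add: row_tight_def)

lemma row_tendsto_power: "row_tendsto X A \<Longrightarrow> (\<And>n. norm (X n) \<le> q) \<Longrightarrow> row_tight A \<Longrightarrow> row_tendsto (\<lambda>n. X n ^ k) (A ^ k)"
proof (induction k)
  case (Suc k)
  have "norm (X n ^ k) \<le> q ^ k" for n
    by (rule order_trans[OF norm_power_ineq power_mono]) (use Suc in auto)
  from row_tendsto_mult[OF Suc.prems(1) Suc.IH[OF Suc.prems] this Suc.prems(3)] show ?case by simp
qed simp

lemma row_tendsto_power_sum:
  assumes c: "\<And>k. \<bar>c k\<bar> \<le> 1" and q: "q < 1" and X: "row_tendsto X A" "\<And>n. norm (X n) \<le> q" "row_tight A"
  shows "row_tendsto (\<lambda>n. power_sum c (X n)) (power_sum c A)"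
  unfolding power_sum_def
proof (rule row_tendsto_series[where M="\<lambda>k. q ^ k"])
  have "0 \<le> q" using X(2)[of 0] norm_ge_zero order_trans by blast
  thus "summable (\<lambda>k. q ^ k)" using q by (intro summable_geometric) auto
  show "norm (c k *\<^sub>R X n ^ k) \<le> q ^ k" for n k by (rule power_sum_term_norm) (auto simp: c X)
  show "row_tendsto (\<lambda>n. c k *\<^sub>R X n ^ k) (c k *\<^sub>R A ^ k)" for k
    by (rule row_tendsto_scaleR[OF row_tendsto_power[OF X]])
qed

lemma row_tight_power_sum:
  assumes c: "\<And>k. \<bar>c k\<bar> \<le> 1" and q: "q < 1" and X: "norm X \<le> q" "row_tight X"
  shows "row_tight (power_sum c X)"
proof -
  have "row_tendsto (\<lambda>n. \<Sum>k. (c k *\<^sub>R X ^ k) * proj_op (box n)) (\<Sum>k. c k *\<^sub>R X ^ k)"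
  proof (rule row_tendsto_series[where M="\<lambda>k. q ^ k"])
    have "0 \<le> q" using X(1) norm_ge_zero order_trans by blast
    thus "summable (\<lambda>k. q ^ k)" using q by (intro summable_geometric) auto
    show "norm (c k *\<^sub>R X ^ k * proj_op (box n)) \<le> q ^ k" for n k
      by (rule order_trans[OF norm_mult_le2[OF norm_proj_op] power_sum_term_norm]) (auto simp: c X)
    show "row_tendsto (\<lambda>n. c k *\<^sub>R X ^ k * proj_op (box n)) (c k *\<^sub>R X ^ k)" for k
      using row_tight_scaleR[OF row_tight_power[OF X(2)]] by (simp add: row_tight_def)
  qed
  moreover have "(\<Sum>k. (c k *\<^sub>R X ^ k) * proj_op (box n)) = power_sum c X * proj_op (box n)" for n
    using bounded_linear.sums[OF bounded_linear_mult_left power_sum_sums[OF c q X(1)]] by (simp add: sums_iff)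
  ultimately show ?thesis by (simp add: row_tight_def power_sum_def)
qed

section \<open>Invariant supports and transposition\<close>

definition preserves_support :: "int set \<Rightarrow> op \<Rightarrow> bool" where
  "preserves_support F X \<longleftrightarrow> (\<forall>v. (\<forall>i. i \<notin> F \<longrightarrow> apply_bcontfun v i = 0) \<longrightarrow> (\<forall>i. i \<notin> F \<longrightarrow> apply_bcontfun (app X v) i = 0))"

text \<open>A relation, because bounded row sums do not give bounded column sums and a transposed
  operator may fail to exist. Invariance of the vectors supported in \<open>F\<close> makes the
  relation compatible with products.\<close>

definition transposes :: "int set \<Rightarrow> op \<Rightarrow> op \<Rightarrow> bool" where
  "transposes F X Y \<longleftrightarrow> preserves_support F X \<and> preserves_support F Y \<and> (\<forall>i\<in>F. \<forall>j\<in>F. entry X i j = entry Y j i)"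

lemma entry_mult:
  assumes "finite F" "preserves_support F Y" "j \<in> F"
  shows "entry (X * Y) i j = (\<Sum>k\<in>F. entry X i k * entry Y k j)"
proof -
  have "apply_bcontfun (app Y (basis_seq j)) i = 0" if "i \<notin> F" for i using assms that by (auto simp: preserves_support_def)
  from app_finite_support[OF assms(1) this] show ?thesis by (simp add: entry_def)
qed

lemma preserves_support_intros:
  "preserves_support F 1" "preserves_support F X \<Longrightarrow> preserves_support F Y \<Longrightarrow> preserves_support F (X + Y)" "preserves_support F X \<Longrightarrow> preserves_support F Y \<Longrightarrow> preserves_support F (X - Y)"
  "preserves_support F X \<Longrightarrow> preserves_support F (c *\<^sub>R X)" "preserves_support F X \<Longrightarrow> preserves_support F Y \<Longrightarrow> preserves_support F (X * Y)"
  by (auto simp: preserves_support_def)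

lemma transposes_intros:
  "transposes F 1 1" "transposes F X X' \<Longrightarrow> transposes F Y Y' \<Longrightarrow> transposes F (X + Y) (X' + Y')"
  "transposes F X X' \<Longrightarrow> transposes F Y Y' \<Longrightarrow> transposes F (X - Y) (X' - Y')" "transposes F X X' \<Longrightarrow> transposes F (c *\<^sub>R X) (c *\<^sub>R X')"
  by (auto simp: transposes_def preserves_support_intros)

lemma transposes_mult: "finite F \<Longrightarrow> transposes F X X' \<Longrightarrow> transposes F Y Y' \<Longrightarrow> transposes F (X * Y) (Y' * X')"
  unfolding transposes_def by (auto simp: preserves_support_intros entry_mult mult.commute)

lemma transposes_power: "finite F \<Longrightarrow> transposes F X X' \<Longrightarrow> transposes F (X ^ k) (X' ^ k)"
proof (induction k)
  case (Suc k)
  thus ?case using transposes_mult[of F X X' "X^k" "X'^k"] by (simp add: power_commutes)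
qed (simp add: transposes_intros)

lemma preserves_support_power_sum:
  assumes "\<And>k. \<bar>c k\<bar> \<le> 1" "q < 1" "norm X \<le> q" "preserves_support F X" shows "preserves_support F (power_sum c X)"
  unfolding preserves_support_def
proof (intro allI impI)
  fix v :: bseq and i assume v: "\<forall>i. i \<notin> F \<longrightarrow> apply_bcontfun v i = 0" and i: "i \<notin> F"
  have "preserves_support F (X ^ k)" for k by (induction k) (auto intro: preserves_support_intros assms)
  hence z: "apply_bcontfun (app (c k *\<^sub>R X ^ k) v) i = 0" for k using v i by (simp add: preserves_support_def)
  have s: "(\<lambda>k. apply_bcontfun (app (c k *\<^sub>R X ^ k) v) i) sums apply_bcontfun (app (power_sum c X) v) i"
    by (rule bounded_linear.sums[OF bounded_linear_app power_sum_sums[of c q X, OF assms(1,2,3)]])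
  show "apply_bcontfun (app (power_sum c X) v) i = 0" using s unfolding z by (simp add: sums_iff)
qed

lemma transposes_power_sum:
  assumes "\<And>k. \<bar>c k\<bar> \<le> 1" "q < 1" "norm X \<le> q" "norm Y \<le> q" "finite F" "transposes F X Y"
  shows "transposes F (power_sum c X) (power_sum c Y)"
proof -
  have "entry (power_sum c X) i j = entry (power_sum c Y) j i" if "i \<in> F" "j \<in> F" for i j
  proof -
    have "(\<lambda>k. entry (c k *\<^sub>R X ^ k) i j) sums entry (power_sum c X) i j" if X: "norm X \<le> q" for X i j
      unfolding entry_def by (rule bounded_linear.sums[OF bounded_linear_app power_sum_sums[OF assms(1,2) X]])
    note this[OF assms(3), of i j] this[OF assms(4), of j i]
    moreover have "entry (X ^ k) i j = entry (Y ^ k) j i" for k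
      using transposes_power[OF assms(5,6), of k] that by (simp add: transposes_def)
    ultimately show ?thesis by (simp add: sums_iff)
  qed
  thus ?thesis using assms preserves_support_power_sum[OF assms(1,2)] by (auto simp: transposes_def)
qed

section \<open>Majorana operators and the Wick formula\<close>

type_synonym wave = "int set \<Rightarrow> complex"

text \<open>A spin configuration is represented by the set of its minus sites.\<close>
definition toggle :: "int \<Rightarrow> int set \<Rightarrow> int set" where "toggle i S = (if i \<in> S then S - {i} else insert i S)"
definition spin :: "int set \<Rightarrow> int \<Rightarrow> int" where "spin S i = (if i \<in> S then -1 else 1)"

lemma toggle_simps [simp]: "toggle i (toggle i S) = S" 
  by (auto simp: toggle_def)
lemma toggle_commute: "toggle i (toggle j S) = toggle j (toggle i S)"
  by (auto simp: toggle_def)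
lemma spin_tog: "spin (toggle i S) j = (if i = j then - spin S j else spin S j)"
  by (auto simp: toggle_def spin_def)
lemma spin_sq [simp]: "spin S i * spin S i = 1" "spin S i * (spin S i * c) = c"
  by (auto simp: spin_def)

text \<open>The sign string over the box sites left of \<open>i\<close>; it makes the commuting spin
  flips of different sites anticommute.\<close>

definition jordan_wigner :: "nat \<Rightarrow> int \<Rightarrow> int set \<Rightarrow> int" where "jordan_wigner n i S = (\<Prod>j\<in>{- int n..<i}. spin S j)"

lemma jordan_wigner_sq [simp]: "jordan_wigner n i S * jordan_wigner n i S = 1" "jordan_wigner n i S * (jordan_wigner n i S * c) = c"
proof -
  show *: "jordan_wigner n i S * jordan_wigner n i S = 1" unfolding jordan_wigner_def by (simp add: prod.distrib[symmetric])
  thus "jordan_wigner n i S * (jordan_wigner n i S * c) = c" by (simp add: mult.assoc[symmetric])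
qed

lemma jordan_wigner_tog:
  assumes "i \<in> box n" shows "jordan_wigner n j (toggle i S) = (if i < j then - jordan_wigner n j S else jordan_wigner n j S)"
proof (cases "i < j")
  case True
  hence "{- int n..<j} = insert i ({- int n..<j} - {i})" using assms by (auto simp: box_def)
  moreover have "(\<Prod>k\<in>{- int n..<j} - {i}. spin (toggle i S) k) = (\<Prod>k\<in>{- int n..<j} - {i}. spin S k)"
    by (rule prod.cong) (auto simp: spin_tog)
  ultimately show ?thesis using True unfolding jordan_wigner_def
    by (metis (no_types, lifting) finite_Diff finite_atLeastLessThan_int insert_Diff_single insert_absorb
      mult_minus_left prod.insert_remove spin_tog)
next
  case False
  thus ?thesis unfolding jordan_wigner_def by (auto simp: spin_tog intro!: prod.cong)
qed

text \<open>\<open>maj_a\<close> is the string times \<open>\<sigma>\<^sup>x\<close>,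
  \<open>maj_b\<close> the string times \<open>\<sigma>\<^sup>z\<sigma>\<^sup>x\<close>, which is i
  times \<open>\<sigma>\<^sup>y\<close>. Leaving the factor i inside makes \<open>maj_b\<close>
  anti-Hermitian with square -1 and keeps all coefficients real; b a at one site is
  \<open>\<sigma>\<^sup>z\<close>.\<close>

definition maj_a :: "nat \<Rightarrow> int \<Rightarrow> wave \<Rightarrow> wave" where
  "maj_a n i f = (\<lambda>S. of_int (jordan_wigner n i S) * f (toggle i S))"
definition maj_b :: "nat \<Rightarrow> int \<Rightarrow> wave \<Rightarrow> wave" where
  "maj_b n i f = (\<lambda>S. of_int (jordan_wigner n i S * spin S i) * f (toggle i S))"

lemma of_int_jordan_wigner_sq [simp]: "of_int (jordan_wigner n i S) * (of_int (jordan_wigner n i S) * (c::complex)) = c"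
  "of_int (spin S i) * (of_int (spin S i) * (c::complex)) = c"
  by (metis jordan_wigner_sq(1) mult.assoc mult.left_neutral of_int_1 of_int_mult)
     (metis spin_sq(1) mult.assoc mult.left_neutral of_int_1 of_int_mult)

lemma of_int_jordan_wigner_sq' [simp]: "of_int (jordan_wigner n i S) * of_int (jordan_wigner n i S) = (1::complex)"
  "of_int (spin S i) * of_int (spin S i) = (1::complex)"
  using of_int_jordan_wigner_sq(1)[of n i S 1] of_int_jordan_wigner_sq(2)[of S i 1] by simp_all

lemma maj_sq:
  assumes "i \<in> box n"
  shows "maj_a n i (maj_a n i f) S = f S" "maj_b n i (maj_b n i f) S = - f S"
    "maj_a n i (maj_b n i f) S = - of_int (spin S i) * f S" "maj_b n i (maj_a n i f) S = of_int (spin S i) * f S"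
  using assms by (auto simp: maj_a_def maj_b_def jordan_wigner_tog spin_tog algebra_simps)

lemma maj_anti:
  assumes "i \<in> box n" "j \<in> box n" "i \<noteq> j"
  shows "maj_a n i (maj_a n j f) S = - maj_a n j (maj_a n i f) S" "maj_b n i (maj_b n j f) S = - maj_b n j (maj_b n i f) S"
    "maj_a n i (maj_b n j f) S = - maj_b n j (maj_a n i f) S"
  using assms by (auto simp: maj_a_def maj_b_def jordan_wigner_tog spin_tog toggle_commute[of i j] algebra_simps)

lemma maj_a_maj_a: "i \<in> box n \<Longrightarrow> j \<in> box n \<Longrightarrow>
    maj_a n i (maj_a n j f) S = (if i = j then 2 else 0) * f S - maj_a n j (maj_a n i f) S"
  using maj_sq(1)[of i n f S] maj_anti(1)[of i n j f S] by auto

lemma maj_b_maj_b: "i \<in> box n \<Longrightarrow> j \<in> box n \<Longrightarrow>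
    maj_b n i (maj_b n j f) S = - (if i = j then 2 else 0) * f S - maj_b n j (maj_b n i f) S"
  using maj_sq(2)[of i n f S] maj_anti(2)[of i n j f S] by auto

lemma maj_b_maj_a: "i \<in> box n \<Longrightarrow> j \<in> box n \<Longrightarrow> maj_b n i (maj_a n j f) S = - maj_a n j (maj_b n i f) S"
  using maj_sq(3,4)[of i n f S] maj_anti(3)[of j n i f S] by (cases "i = j") auto

lemma maj_a_lin: "maj_a n i (\<lambda>S. \<Sum>k\<in>K. c k * f k S) = (\<lambda>S. \<Sum>k\<in>K. c k * maj_a n i (f k) S)"
  "maj_a n i (\<lambda>S. c0 * g S) = (\<lambda>S. c0 * maj_a n i g S)" "maj_a n i (\<lambda>S. g S + h S) = (\<lambda>S. maj_a n i g S + maj_a n i h S)"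
  "maj_a n i (\<lambda>S. g S - h S) = (\<lambda>S. maj_a n i g S - maj_a n i h S)" "maj_a n i (\<lambda>S. - g S) = (\<lambda>S. - maj_a n i g S)"
  "maj_a n i (\<lambda>S. \<Sum>k\<in>K. f k S) = (\<lambda>S. \<Sum>k\<in>K. maj_a n i (f k) S)"
  by (auto simp: maj_a_def algebra_simps sum_distrib_left)

lemma maj_b_lin: "maj_b n i (\<lambda>S. \<Sum>k\<in>K. c k * f k S) = (\<lambda>S. \<Sum>k\<in>K. c k * maj_b n i (f k) S)"
  "maj_b n i (\<lambda>S. c0 * g S) = (\<lambda>S. c0 * maj_b n i g S)" "maj_b n i (\<lambda>S. g S + h S) = (\<lambda>S. maj_b n i g S + maj_b n i h S)"
  "maj_b n i (\<lambda>S. g S - h S) = (\<lambda>S. maj_b n i g S - maj_b n i h S)" "maj_b n i (\<lambda>S. - g S) = (\<lambda>S. - maj_b n i g S)"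
  "maj_b n i (\<lambda>S. \<Sum>k\<in>K. f k S) = (\<lambda>S. \<Sum>k\<in>K. maj_b n i (f k) S)"
  by (auto simp: maj_b_def algebra_simps sum_distrib_left)

definition wave_inner :: "nat \<Rightarrow> wave \<Rightarrow> wave \<Rightarrow> complex" where
  "wave_inner n f g = (\<Sum>S\<in>Pow (box n). cnj (f S) * g S)"

lemma toggle_subset: "i \<in> B \<Longrightarrow> toggle i S \<subseteq> B \<longleftrightarrow> S \<subseteq> B"
  by (auto simp: toggle_def)

lemma wave_inner_tog:
  assumes "i \<in> box n"
  shows "(\<Sum>S\<in>Pow (box n). F (toggle i S) S) = (\<Sum>S\<in>Pow (box n). F S (toggle i S))"
  by (rule sum.reindex_bij_witness[of _ "toggle i" "toggle i"]) (use assms toggle_subset in auto)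

lemma wave_inner_maj_a: "i \<in> box n \<Longrightarrow> wave_inner n f (maj_a n i g) = wave_inner n (maj_a n i f) g"
  unfolding wave_inner_def maj_a_def using wave_inner_tog[of i n "\<lambda>T S. cnj (f S) * (of_int (jordan_wigner n i S) * g T)"]
  by (simp add: jordan_wigner_tog mult_ac)

lemma wave_inner_maj_b: "i \<in> box n \<Longrightarrow> wave_inner n f (maj_b n i g) = - wave_inner n (maj_b n i f) g"
  unfolding wave_inner_def maj_b_def using wave_inner_tog[of i n "\<lambda>T S. cnj (f S) * (of_int (jordan_wigner n i S * spin S i) * g T)"]
  by (simp add: jordan_wigner_tog spin_tog mult_ac sum_negf)

lemma wave_inner_lin: "wave_inner n f (\<lambda>S. c * g S) = c * wave_inner n f g" "wave_inner n f (\<lambda>S. g S + h S) = wave_inner n f g + wave_inner n f h"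
  "wave_inner n f (\<lambda>S. \<Sum>k\<in>K. c' k * f' k S) = (\<Sum>k\<in>K. c' k * wave_inner n f (f' k))"
  unfolding wave_inner_def
  by (auto simp: algebra_simps sum.distrib sum_distrib_left intro: sum.swap)

section \<open>Annihilators and Wick's formula\<close>

definition annih :: "nat \<Rightarrow> (int \<Rightarrow> int \<Rightarrow> real) \<Rightarrow> int \<Rightarrow> wave \<Rightarrow> wave" where
  "annih n G k f = (\<lambda>S. maj_a n k f S + (\<Sum>j\<in>box n. of_real (G k j) * maj_b n j f S))"

text \<open>Since \<open>a\<^sub>j\<^sup>2 = 1\<close>, the diagonal operator \<open>\<alpha> + \<beta> \<sigma>\<^sup>z\<^sub>j\<close> is the product of \<open>a\<^sub>j\<close> and this linear form.\<close>
definition lin_form :: "nat \<Rightarrow> (int \<Rightarrow> real) \<Rightarrow> (int \<Rightarrow> real) \<Rightarrow> int \<Rightarrow> wave \<Rightarrow> wave" where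
  "lin_form n \<alpha> \<beta> j f = (\<lambda>S. of_real (\<alpha> j) * maj_a n j f S - of_real (\<beta> j) * maj_b n j f S)"

text \<open>Half the anticommutator of \<open>annih n G i\<close> with the linear form at
  \<open>j\<close>. The sign of \<beta> turns positive because the b operators square to -1.\<close>

definition wick_kernel :: "(int \<Rightarrow> int \<Rightarrow> real) \<Rightarrow> (int \<Rightarrow> real) \<Rightarrow> (int \<Rightarrow> real) \<Rightarrow> int \<Rightarrow> int \<Rightarrow> real" where
  "wick_kernel G \<alpha> \<beta> i j = (if i = j then \<alpha> j else 0) + \<beta> j * G i j"

lemma annih_maj_a:
  assumes "k \<in> box n" "j \<in> box n" "k \<noteq> j"
  shows "annih n G k (maj_a n j f) S = - maj_a n j (annih n G k f) S"
  using assms by (simp add: annih_def maj_a_lin maj_anti(1)[of k n j] maj_b_maj_a sum_negf)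

lemma annih_lin_form:
  assumes "k \<in> box n" "j \<in> box n"
  shows "annih n G k (lin_form n \<alpha> \<beta> j f) S = 2 * of_real (wick_kernel G \<alpha> \<beta> k j) * f S - lin_form n \<alpha> \<beta> j (annih n G k f) S"
proof -
  have 1: "(\<Sum>i\<in>box n. of_real (G k i) * maj_b n i (maj_a n j f) S) = - (\<Sum>i\<in>box n. of_real (G k i) * maj_a n j (maj_b n i f) S)"
    using assms by (simp add: maj_b_maj_a sum_negf)
  have 2: "(\<Sum>i\<in>box n. of_real (G k i) * maj_b n i (maj_b n j f) S) = - 2 * of_real (G k j) * f S - (\<Sum>i\<in>box n. of_real (G k i) * maj_b n j (maj_b n i f) S)"
  proof -
    have "(\<Sum>i\<in>box n. of_real (G k i) * maj_b n i (maj_b n j f) S)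
       = (\<Sum>i\<in>box n. (if i = j then - 2 * of_real (G k j) * f S else 0) - of_real (G k i) * maj_b n j (maj_b n i f) S)"
      using assms by (intro sum.cong) (auto simp: maj_b_maj_b[of _ n j] algebra_simps)
    also have "\<dots> = - 2 * of_real (G k j) * f S - (\<Sum>i\<in>box n. of_real (G k i) * maj_b n j (maj_b n i f) S)"
      using assms by (simp add: sum_subtractf sum.delta)
    finally show ?thesis .
  qed
  have 3: "maj_a n k (maj_b n j f) S = - maj_b n j (maj_a n k f) S" using maj_b_maj_a[of j n k f S] assms by simp
  have "annih n G k (lin_form n \<alpha> \<beta> j f) S = of_real (\<alpha> j) * maj_a n k (maj_a n j f) S - of_real (\<beta> j) * maj_a n k (maj_b n j f) S
     + (of_real (\<alpha> j) * (\<Sum>i\<in>box n. of_real (G k i) * maj_b n i (maj_a n j f) S) - of_real (\<beta> j) * (\<Sum>i\<in>box n. of_real (G k i) * maj_b n i (maj_b n j f) S))"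
    by (simp add: annih_def lin_form_def maj_a_lin maj_b_lin algebra_simps sum_distrib_left sum_subtractf)
  also have "\<dots> = 2 * of_real (wick_kernel G \<alpha> \<beta> k j) * f S - lin_form n \<alpha> \<beta> j (annih n G k f) S"
    unfolding 1 2 3 maj_a_maj_a[OF assms] by (simp add: annih_def lin_form_def maj_a_lin maj_b_lin wick_kernel_def algebra_simps)
  finally show ?thesis .
qed


lemma foldr_ma_lin: "foldr (maj_a n) I (\<lambda>S. \<Sum>k\<in>K. c k * f k S) = (\<lambda>S. \<Sum>k\<in>K. c k * foldr (maj_a n) I (f k) S)"
  "foldr (maj_a n) I (\<lambda>S. c0 * g S) = (\<lambda>S. c0 * foldr (maj_a n) I g S)"
  by (induction I) (auto simp: maj_a_lin)

lemma lin_form_lin: "lin_form n \<alpha> \<beta> j (\<lambda>S. \<Sum>k\<in>K. c k * f k S) = (\<lambda>S. \<Sum>k\<in>K. c k * lin_form n \<alpha> \<beta> j (f k) S)"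
  by (auto simp: lin_form_def maj_a_lin maj_b_lin sum_distrib_left sum_subtractf algebra_simps)

lemma annih_foldr:
  assumes "k \<in> box n" "k \<notin> set I" "set I \<subseteq> box n"
  shows "annih n G k (foldr (maj_a n) I g) = (\<lambda>S. (-1) ^ length I * foldr (maj_a n) I (annih n G k g) S)"
  using assms(2,3)
proof (induction I)
  case (Cons i I)
  have "annih n G k (foldr (maj_a n) (i # I) g) = (\<lambda>S. - maj_a n i (annih n G k (foldr (maj_a n) I g)) S)"
    using Cons.prems assms(1) by (auto simp: annih_maj_a)
  thus ?case using Cons by (simp add: maj_a_lin)
qed simp

abbreviation drop_nth :: "nat \<Rightarrow> 'a list \<Rightarrow> 'a list" where "drop_nth t K \<equiv> take t K @ drop (Suc t) K"

text \<open>Anticommute \<open>annih\<close> inwards until it reaches \<phi> and vanishes; each form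
  passed leaves a contraction. In \<open>fold\<close> the last list element is outermost, so form
  \<open>t\<close> is met after \<open>length K - 1 - t\<close> others, and the induction runs from
  the right end.\<close>

lemma annih_fold:
  assumes "k \<in> box n" "set K \<subseteq> box n" and z: "\<And>S. annih n G k \<phi> S = 0"
  shows "annih n G k (fold (lin_form n \<alpha> \<beta>) K \<phi>) =
    (\<lambda>S. \<Sum>t<length K. ((-1) ^ (length K - 1 - t) * 2 * of_real (wick_kernel G \<alpha> \<beta> k (K ! t))) * fold (lin_form n \<alpha> \<beta>) (drop_nth t K) \<phi> S)"
  using assms(2)
proof (induction K rule: rev_induct)
  case Nil
  thus ?case using z by auto
next
  case (snoc j K)
  let ?c = "\<lambda>t. (-1) ^ (length K - 1 - t) * 2 * complex_of_real (wick_kernel G \<alpha> \<beta> k (K ! t))"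
  have IH: "annih n G k (fold (lin_form n \<alpha> \<beta>) K \<phi>) = (\<lambda>S. \<Sum>t<length K. ?c t * fold (lin_form n \<alpha> \<beta>) (drop_nth t K) \<phi> S)"
    using snoc by simp
  define D where "D = (\<lambda>t S. (-1) ^ (length (K @ [j]) - 1 - t) * 2 * of_real (wick_kernel G \<alpha> \<beta> k ((K @ [j]) ! t)) * fold (lin_form n \<alpha> \<beta>) (drop_nth t (K @ [j])) \<phi> S)"
  have 1: "annih n G k (fold (lin_form n \<alpha> \<beta>) (K @ [j]) \<phi>) S =
    2 * of_real (wick_kernel G \<alpha> \<beta> k j) * fold (lin_form n \<alpha> \<beta>) K \<phi> S - (\<Sum>t<length K. ?c t * fold (lin_form n \<alpha> \<beta>) (drop_nth t K @ [j]) \<phi> S)" for S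
    using snoc.prems assms(1) by (simp add: annih_lin_form IH lin_form_lin)
  have "?c t * fold (lin_form n \<alpha> \<beta>) (drop_nth t K @ [j]) \<phi> S = - D t S"
    if "t < length K" for t S
  proof -
    have "length (K @ [j]) - 1 - t = Suc (length K - 1 - t)" using that by simp
    hence "(-1) ^ (length (K @ [j]) - 1 - t) = - ((-1) ^ (length K - 1 - t) :: complex)" by simp
    moreover have "drop_nth t (K @ [j]) = drop_nth t K @ [j]" "(K @ [j]) ! t = K ! t" using that by (auto simp: nth_append)
    ultimately show ?thesis unfolding D_def by simp
  qed
  hence 2: "(\<Sum>t<length K. ?c t * fold (lin_form n \<alpha> \<beta>) (drop_nth t K @ [j]) \<phi> S) = - (\<Sum>t<length K. D t S)" for S
    unfolding sum_negf[symmetric] by (intro sum.cong) auto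
  have 3: "D (length K) S = 2 * of_real (wick_kernel G \<alpha> \<beta> k j) * fold (lin_form n \<alpha> \<beta>) K \<phi> S" for S by (simp add: D_def)
  have "annih n G k (fold (lin_form n \<alpha> \<beta>) (K @ [j]) \<phi>) S = (\<Sum>t<length (K @ [j]). D t S)" for S
    unfolding 1 2 by (simp add: 3)
  thus ?case unfolding D_def by (intro ext)
qed

text \<open>The adjoint of the annihilator has the opposite sign in front of the b part, so its two
  parts contribute equally against \<phi>. Under the expectation, \<open>maj_a\<close> may be
  replaced by half of \<open>annih\<close>.\<close>

lemma wave_inner_annih:
  assumes "k \<in> box n" and z: "\<And>S. annih n G k \<phi> S = 0"
  shows "wave_inner n \<phi> (annih n G k X) = 2 * wave_inner n \<phi> (maj_a n k X)"
proof -
  have "0 = wave_inner n (annih n G k \<phi>) X" using z by (simp add: wave_inner_def)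
  also have "\<dots> = wave_inner n (maj_a n k \<phi>) X + (\<Sum>j\<in>box n. of_real (G k j) * wave_inner n (maj_b n j \<phi>) X)"
    unfolding wave_inner_def annih_def
    by (simp add: algebra_simps sum.distrib sum_distrib_left sum_distrib_right) (rule sum.swap)
  finally have "wave_inner n \<phi> (maj_a n k X) = (\<Sum>j\<in>box n. of_real (G k j) * wave_inner n \<phi> (maj_b n j X))"
    using assms(1) by (simp add: wave_inner_maj_a wave_inner_maj_b sum_negf add_eq_0_iff)
  thus ?thesis unfolding annih_def by (simp add: wave_inner_lin)
qed

text \<open>Replace the outermost a by half the annihilator and move it inwards: it anticommutes
  with the other a operators, as \<open>I\<close> is distinct, and its contractions with the forms
  are the Laplace expansion along the first row.\<close>

lemma wick:
  assumes z: "\<And>k S. k \<in> box n \<Longrightarrow> annih n G k \<phi> S = 0"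
    and "distinct I" "set I \<subseteq> box n" "set K \<subseteq> box n" "length I = N" "length K = N"
  shows "wave_inner n \<phi> (foldr (maj_a n) I (fold (lin_form n \<alpha> \<beta>) K \<phi>)) =
    of_real (det (mat N N (\<lambda>(a, b). wick_kernel G \<alpha> \<beta> (I ! a) (K ! b)))) * wave_inner n \<phi> \<phi>"
  using assms(2-)
proof (induction I arbitrary: K N)
  case Nil
  thus ?case by simp
next
  case (Cons i I)
  define M where "M = mat N N (\<lambda>(a, b). wick_kernel G \<alpha> \<beta> ((i # I) ! a) (K ! b))"
  define Y where "Y = (\<lambda>t. wick_kernel G \<alpha> \<beta> i (K ! t))"
  obtain m where N: "N = Suc m" "length I = m" using Cons.prems by auto
  have i: "i \<in> box n" "i \<notin> set I" "set I \<subseteq> box n" "distinct I" using Cons.prems by auto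
  have zero_less_N: "0 < N" using N by simp
  have Mc: "M \<in> carrier_mat N N" by (simp add: M_def)
  have sub: "wave_inner n \<phi> (foldr (maj_a n) I (fold (lin_form n \<alpha> \<beta>) (drop_nth t K) \<phi>)) = of_real (det (mat_delete M 0 t)) * wave_inner n \<phi> \<phi>" if t: "t < N" for t
  proof -
    have "set (drop_nth t K) \<subseteq> set K" by (auto dest: in_set_takeD in_set_dropD)
    hence s: "set (drop_nth t K) \<subseteq> box n" using Cons.prems by auto
    have l: "length (drop_nth t K) = m" using Cons.prems N t by simp
    have "mat m m (\<lambda>(a, b). wick_kernel G \<alpha> \<beta> (I ! a) (drop_nth t K ! b)) = mat_delete M 0 t"
      using N Cons.prems t by (intro eq_matI) (auto simp: mat_delete_def M_def nth_append min_def)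
    thus ?thesis using Cons.IH[OF i(4,3) s N(2) l] by simp
  qed
  have "2 * wave_inner n \<phi> (foldr (maj_a n) (i # I) (fold (lin_form n \<alpha> \<beta>) K \<phi>)) = wave_inner n \<phi> (annih n G i (foldr (maj_a n) I (fold (lin_form n \<alpha> \<beta>) K \<phi>)))"
    using wave_inner_annih[OF i(1) z[OF i(1)]] by simp
  also have "\<dots> = (\<Sum>t<N. ((-1) ^ (N - 1 - t) * 2 * of_real (Y t)) * ((-1) ^ m * wave_inner n \<phi> (foldr (maj_a n) I (fold (lin_form n \<alpha> \<beta>) (drop_nth t K) \<phi>))))"
  proof -
    define c where "c = (\<lambda>t. (-1) ^ (N - 1 - t) * 2 * complex_of_real (Y t))"
    define f where "f = (\<lambda>t. fold (lin_form n \<alpha> \<beta>) (drop_nth t K) \<phi>)"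
    have "annih n G i (fold (lin_form n \<alpha> \<beta>) K \<phi>) = (\<lambda>S. \<Sum>t<N. c t * f t S)"
      using annih_fold[OF i(1) Cons.prems(3) z[OF i(1)]] Cons.prems(5) unfolding c_def f_def Y_def by simp
    hence "wave_inner n \<phi> (annih n G i (foldr (maj_a n) I (fold (lin_form n \<alpha> \<beta>) K \<phi>)))
       = (-1) ^ m * (\<Sum>t<N. c t * wave_inner n \<phi> (foldr (maj_a n) I (f t)))"
      unfolding annih_foldr[OF i(1-3)] N(2) by (simp only: foldr_ma_lin(1) wave_inner_lin(1) wave_inner_lin(3))
    thus ?thesis unfolding c_def f_def by (simp only: sum_distrib_left mult.left_commute)
  qed
  also have "\<dots> = (\<Sum>t<N. 2 * (of_real (M $$ (0,t) * cofactor M 0 t) * wave_inner n \<phi> \<phi>))"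
  proof (rule sum.cong[OF refl])
    fix t assume t: "t \<in> {..<N}"
    \<comment> \<open>The sign comes from the m remaining a operators and the N - 1 - t forms; as m
      = N - 1 it equals (-1)^t, the cofactor sign of row 0.\<close>
    hence "m = (N - 1 - t) + t" using N by auto
    hence "(-1) ^ (N - 1 - t) * (-1) ^ m = ((-1) ^ t :: complex)"
      by (metis (no_types, opaque_lifting) left_minus_one_mult_self power_add)
    hence "((-1) ^ (N - 1 - t) * 2 * of_real (Y t)) * ((-1) ^ m * wave_inner n \<phi> (foldr (maj_a n) I (fold (lin_form n \<alpha> \<beta>) (drop_nth t K) \<phi>)))
      = 2 * ((-1) ^ t * of_real (Y t) * (of_real (det (mat_delete M 0 t)) * wave_inner n \<phi> \<phi>))"
      using sub t by (simp add: mult_ac)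
    also have "\<dots> = 2 * (of_real (M $$ (0,t) * cofactor M 0 t) * wave_inner n \<phi> \<phi>)"
      using t N by (simp add: cofactor_def M_def Y_def mult_ac)
    finally show "((-1) ^ (N - 1 - t) * 2 * of_real (Y t)) * ((-1) ^ m * wave_inner n \<phi> (foldr (maj_a n) I (fold (lin_form n \<alpha> \<beta>) (drop_nth t K) \<phi>)))
      = 2 * (of_real (M $$ (0,t) * cofactor M 0 t) * wave_inner n \<phi> \<phi>)" .
  qed
  also have "\<dots> = 2 * (of_real (det M) * wave_inner n \<phi> \<phi>)"
    unfolding laplace_expansion_row[OF Mc zero_less_N] by (simp only: sum_distrib_left sum_distrib_right of_real_sum)
  finally show ?case by (simp add: M_def)
qed

text \<open>\<open>foldr\<close> and \<open>fold\<close> nest in opposite orders, so each a meets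
  its own form with only a diagonal operator on other sites in between, and that commutes with
  it.\<close>

lemma foldr_fold_principal:
  assumes "distinct xs" "set xs \<subseteq> box n"
  shows "foldr (maj_a n) xs (fold (lin_form n \<alpha> \<beta>) xs \<phi>) = (\<lambda>S. of_real (\<Prod>x\<in>set xs. \<alpha> x + \<beta> x * of_int (spin S x)) * \<phi> S)"
  using assms
proof (induction xs arbitrary: \<phi>)
  case (Cons x xs)
  have *: "(\<Prod>y\<in>set xs. \<alpha> y + \<beta> y * of_int (spin (toggle x S) y)) = (\<Prod>y\<in>set xs. \<alpha> y + \<beta> y * of_int (spin S y))" for S
    by (rule prod.cong) (use Cons.prems in \<open>auto simp: spin_tog\<close>)
  have "foldr (maj_a n) (x # xs) (fold (lin_form n \<alpha> \<beta>) (x # xs) \<phi>)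
     = maj_a n x (\<lambda>S. of_real (\<Prod>x\<in>set xs. \<alpha> x + \<beta> x * of_int (spin S x)) * lin_form n \<alpha> \<beta> x \<phi> S)"
    using Cons by simp
  also have "\<dots> = (\<lambda>S. of_real (\<Prod>x\<in>set xs. \<alpha> x + \<beta> x * of_int (spin S x)) * maj_a n x (lin_form n \<alpha> \<beta> x \<phi>) S)"
    unfolding maj_a_def[of n x "\<lambda>S. _ S * _ S"] * by (auto simp: maj_a_def)
  also have "maj_a n x (lin_form n \<alpha> \<beta> x \<phi>) = (\<lambda>S. of_real (\<alpha> x + \<beta> x * of_int (spin S x)) * \<phi> S)"
    using Cons.prems by (auto simp: lin_form_def maj_a_lin maj_sq algebra_simps)
  finally show ?case using Cons.prems by (auto simp: mult_ac)
qed simp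


section \<open>The Hamiltonian as a quadratic form\<close>

definition hopping :: "real \<Rightarrow> real \<Rightarrow> int \<Rightarrow> int \<Rightarrow> real" where
  "hopping J h i j = (if i = j then h else 0) + (if i = j + 1 then - J else 0)"

definition hamiltonian :: "real \<Rightarrow> real \<Rightarrow> nat \<Rightarrow> wave \<Rightarrow> wave" where
  "hamiltonian J h n f = (\<lambda>S. \<Sum>i\<in>box n. \<Sum>j\<in>box n. of_real (hopping J h i j) * maj_a n i (maj_b n j f) S)"

lemma flip_spin: "flip i (spin S) = spin (toggle i S)"
  by (auto simp: flip_def spin_def toggle_def)

lemma jordan_wigner_Suc: "j \<in> box n \<Longrightarrow> jordan_wigner n (j + 1) S = jordan_wigner n j S * spin S j"
proof -
  assume "j \<in> box n"
  hence "{- int n..<j + 1} = insert j {- int n..<j}" by (auto simp: box_def)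
  thus ?thesis by (simp add: jordan_wigner_def)
qed

text \<open>In a b at the neighbouring sites j + 1 and j the strings cancel up to the spin at j,
  which the \<sigma> factors of b absorb, leaving the plain double flip. The open chain has no bond
  closing the ring, which would carry a full string.\<close>

lemma ising_H_hamiltonian: "ising_H J h n psi (spin S) = hamiltonian J h n (\<lambda>S. psi (spin S)) S"
proof -
  let ?f = "\<lambda>S. psi (spin S)"
  define X where "X = (\<lambda>i j. maj_a n i (maj_b n j ?f) S)"
  have hop: "X (j + 1) j = psi (flip j (flip (j + 1) (spin S)))" if "j \<in> box n" "j + 1 \<in> box n" for j
    unfolding X_def maj_a_def maj_b_def using that
    by (simp add: jordan_wigner_tog spin_tog jordan_wigner_Suc flip_spin mult_ac flip: of_int_mult)
  have dia: "X j j = - of_int (spin S j) * psi (spin S)" if "j \<in> box n" for j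
    unfolding X_def using maj_sq(3)[OF that, of ?f S] by simp
  have "hamiltonian J h n ?f S = (\<Sum>j\<in>box n. \<Sum>i\<in>box n. of_real (hopping J h i j) * X i j)"
    unfolding hamiltonian_def X_def by (rule sum.swap)
  also have "\<dots> = (\<Sum>j\<in>box n. of_real h * X j j + (if j + 1 \<in> box n then - of_real J * X (j + 1) j else 0))"
  proof (rule sum.cong[OF refl])
    fix j assume j: "j \<in> box n"
    have "(\<Sum>i\<in>box n. of_real (hopping J h i j) * X i j)
      = (\<Sum>i\<in>box n. (if i = j then of_real h * X i j else 0) + (if i = j + 1 then - of_real J * X i j else 0))"
      by (rule sum.cong) (auto simp: hopping_def)
    also have "\<dots> = of_real h * X j j + (if j + 1 \<in> box n then - of_real J * X (j + 1) j else 0)"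
      using j by (simp only: sum.distrib sum.delta finite_box) simp
    finally show "(\<Sum>i\<in>box n. of_real (hopping J h i j) * X i j) = \<dots>" .
  qed
  also have "\<dots> = (\<Sum>j\<in>box n. of_real h * X j j) + (\<Sum>j\<in>box n. if j + 1 \<in> box n then - of_real J * X (j + 1) j else 0)"
    by (rule sum.distrib)
  also have "(\<Sum>j\<in>box n. if j + 1 \<in> box n then - of_real J * X (j + 1) j else 0)
     = (\<Sum>j\<in>{- int n..<int n}. - of_real J * X (j + 1) j)"
    by (rule sum.mono_neutral_cong_right) (auto simp: box_def)
  also have "\<dots> = (\<Sum>j\<in>{- int n..<int n}. - of_real J * psi (flip j (flip (j + 1) (spin S))))"
    by (rule sum.cong[OF refl], subst hop) (auto simp: box_def)
  also have "(\<Sum>j\<in>box n. of_real h * X j j) = (\<Sum>j\<in>box n. - of_real h * of_int (spin S j) * psi (spin S))"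
    by (rule sum.cong) (auto simp: dia)
  also have "\<dots> + (\<Sum>j\<in>{- int n..<int n}. - of_real J * psi (flip j (flip (j + 1) (spin S)))) = ising_H J h n psi (spin S)"
    by (simp add: ising_H_def sum_negf sum_distrib_left sum_distrib_right flip: sum_distrib_left sum_distrib_right)
  finally show ?thesis by simp
qed

lemma hamiltonian_lin: "hamiltonian J h n (\<lambda>S. f S + g S) = (\<lambda>S. hamiltonian J h n f S + hamiltonian J h n g S)"
  "hamiltonian J h n (\<lambda>S. c * f S) = (\<lambda>S. c * hamiltonian J h n f S)"
  "hamiltonian J h n (\<lambda>S. \<Sum>k\<in>K. c' k * f' k S) = (\<lambda>S. \<Sum>k\<in>K. c' k * hamiltonian J h n (f' k) S)"
proof -
  show 1: "hamiltonian J h n (\<lambda>S. f S + g S) = (\<lambda>S. hamiltonian J h n f S + hamiltonian J h n g S)" for f g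
    by (simp add: hamiltonian_def maj_a_lin maj_b_lin algebra_simps sum.distrib)
  show 2: "hamiltonian J h n (\<lambda>S. c * f S) = (\<lambda>S. c * hamiltonian J h n f S)" for c f
    by (simp add: hamiltonian_def maj_a_lin maj_b_lin sum_distrib_left mult_ac)
  have 0: "hamiltonian J h n (\<lambda>S. 0) = (\<lambda>S. 0)" using 2[of 0 "\<lambda>S. 0"] by simp
  show "hamiltonian J h n (\<lambda>S. \<Sum>k\<in>K. c' k * f' k S) = (\<lambda>S. \<Sum>k\<in>K. c' k * hamiltonian J h n (f' k) S)"
    by (induction K rule: infinite_finite_induct) (auto simp: 0 1 2)
qed

lemma wave_inner_left_lin: "wave_inner n (\<lambda>S. f S + g S) k = wave_inner n f k + wave_inner n g k" "wave_inner n (\<lambda>S. of_real r * f S) k = of_real r * wave_inner n f k"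
  by (auto simp: wave_inner_def algebra_simps sum.distrib sum_distrib_left)

lemma wave_inner_sum_left: "wave_inner n (\<lambda>S. \<Sum>k\<in>K. f k S) g = (\<Sum>k\<in>K. wave_inner n (f k) g)"
  and wave_inner_sum_right: "wave_inner n g (\<lambda>S. \<Sum>k\<in>K. f k S) = (\<Sum>k\<in>K. wave_inner n g (f k))"
  unfolding wave_inner_def by (auto simp: sum_distrib_left sum_distrib_right intro: sum.swap)

lemma hamiltonian_hermitian: "wave_inner n f (hamiltonian J h n g) = wave_inner n (hamiltonian J h n f) g"
  unfolding hamiltonian_def wave_inner_sum_left wave_inner_sum_right wave_inner_lin wave_inner_left_lin
  by (intro sum.cong refl arg_cong2[where f="(*)"])
    (simp add: wave_inner_maj_a wave_inner_maj_b, simp add: wave_inner_def maj_b_maj_a sum_negf)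

lemma hamiltonian_maj_a:
  assumes k: "k \<in> box n"
  shows "hamiltonian J h n (maj_a n k f) S = maj_a n k (hamiltonian J h n f) S - 2 * (\<Sum>j\<in>box n. of_real (hopping J h k j) * maj_b n j f S)"
proof -
  have t: "maj_a n i (maj_b n j (maj_a n k f)) S = maj_a n k (maj_a n i (maj_b n j f)) S - (if i = k then 2 * maj_b n j f S else 0)"
    if "i \<in> box n" "j \<in> box n" for i j
  proof -
    have "maj_b n j (maj_a n k f) = (\<lambda>S. - maj_a n k (maj_b n j f) S)" using maj_b_maj_a that k by blast
    thus ?thesis using maj_a_maj_a[OF that(1) k, of "maj_b n j f" S] by (simp add: maj_a_lin)
  qed
  have "hamiltonian J h n (maj_a n k f) S = (\<Sum>i\<in>box n. \<Sum>j\<in>box n. of_real (hopping J h i j) * maj_a n k (maj_a n i (maj_b n j f)) S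
      - (if i = k then 2 * (of_real (hopping J h i j) * maj_b n j f S) else 0))"
    unfolding hamiltonian_def by (intro sum.cong refl) (auto simp: t algebra_simps)
  also have "\<dots> = (\<Sum>i\<in>box n. (\<Sum>j\<in>box n. of_real (hopping J h i j) * maj_a n k (maj_a n i (maj_b n j f)) S)
      - (if i = k then 2 * (\<Sum>j\<in>box n. of_real (hopping J h i j) * maj_b n j f S) else 0))"
    by (intro sum.cong refl) (auto simp: sum_subtractf sum_distrib_left)
  also have "\<dots> = maj_a n k (hamiltonian J h n f) S - 2 * (\<Sum>j\<in>box n. of_real (hopping J h k j) * maj_b n j f S)"
    unfolding hamiltonian_def maj_a_lin using k by (simp only: sum_subtractf sum.delta finite_box if_True)
  finally show ?thesis .
qed

lemma hamiltonian_maj_b: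
  assumes k: "k \<in> box n"
  shows "hamiltonian J h n (maj_b n k f) S = maj_b n k (hamiltonian J h n f) S - 2 * (\<Sum>i\<in>box n. of_real (hopping J h i k) * maj_a n i f S)"
proof -
  have t: "maj_a n i (maj_b n j (maj_b n k f)) S = maj_b n k (maj_a n i (maj_b n j f)) S - (if j = k then 2 * maj_a n i f S else 0)"
    if "i \<in> box n" "j \<in> box n" for i j
  proof -
    have "maj_b n j (maj_b n k f) = (\<lambda>S. - (if j = k then 2 else 0) * f S - maj_b n k (maj_b n j f) S)" using maj_b_maj_b[OF that(2) k] by blast
    hence "maj_a n i (maj_b n j (maj_b n k f)) S = - (if j = k then 2 else 0) * maj_a n i f S - maj_a n i (maj_b n k (maj_b n j f)) S"
      by (simp add: maj_a_lin)
    thus ?thesis using maj_b_maj_a[OF k that(1), of "maj_b n j f" S] by simp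
  qed
  have "hamiltonian J h n (maj_b n k f) S = (\<Sum>i\<in>box n. \<Sum>j\<in>box n. of_real (hopping J h i j) * maj_b n k (maj_a n i (maj_b n j f)) S
      - (if j = k then 2 * (of_real (hopping J h i j) * maj_a n i f S) else 0))"
    unfolding hamiltonian_def by (intro sum.cong refl) (auto simp: t algebra_simps)
  also have "\<dots> = (\<Sum>i\<in>box n. (\<Sum>j\<in>box n. of_real (hopping J h i j) * maj_b n k (maj_a n i (maj_b n j f)) S)
      - 2 * (of_real (hopping J h i k) * maj_a n i f S))"
    using k by (simp only: sum_subtractf sum.delta finite_box if_True)
  also have "\<dots> = maj_b n k (hamiltonian J h n f) S - 2 * (\<Sum>i\<in>box n. of_real (hopping J h i k) * maj_a n i f S)"
    unfolding hamiltonian_def maj_b_lin by (simp only: sum_subtractf sum_distrib_left)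
  finally show ?thesis .
qed

text \<open>Commuting H with a gives b through B, and with b gives a through the transpose of B. The
  hypotheses B = P G and G B^T = P make both parts match P applied to the annihilators.\<close>

lemma hamiltonian_annih:
  assumes k: "k \<in> box n"
    and PG: "\<And>k j. k \<in> box n \<Longrightarrow> j \<in> box n \<Longrightarrow> (\<Sum>l\<in>box n. P k l * G l j) = hopping J h k j"
    and GB: "\<And>k i. k \<in> box n \<Longrightarrow> i \<in> box n \<Longrightarrow> (\<Sum>j\<in>box n. G k j * hopping J h i j) = P k i"
  shows "hamiltonian J h n (annih n G k f) S = annih n G k (hamiltonian J h n f) S - 2 * (\<Sum>l\<in>box n. of_real (P k l) * annih n G l f S)"
proof -
  have 1: "(\<Sum>j\<in>box n. of_real (G k j) * (\<Sum>i\<in>box n. of_real (hopping J h i j) * maj_a n i f S))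
     = (\<Sum>i\<in>box n. of_real (P k i) * maj_a n i f S)" (is "?L = _")
  proof -
    have "?L = (\<Sum>i\<in>box n. \<Sum>j\<in>box n. of_real (G k j * hopping J h i j) * maj_a n i f S)"
      by (simp add: sum_distrib_left mult_ac) (rule sum.swap)
    also have "\<dots> = (\<Sum>i\<in>box n. of_real (\<Sum>j\<in>box n. G k j * hopping J h i j) * maj_a n i f S)"
      by (simp only: sum_distrib_right of_real_sum)
    finally show ?thesis using GB[OF k] by simp
  qed
  have 2: "(\<Sum>l\<in>box n. of_real (P k l) * (\<Sum>j\<in>box n. of_real (G l j) * maj_b n j f S))
     = (\<Sum>j\<in>box n. of_real (hopping J h k j) * maj_b n j f S)" (is "?L = _")
  proof -
    have "?L = (\<Sum>j\<in>box n. \<Sum>l\<in>box n. of_real (P k l * G l j) * maj_b n j f S)"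
      by (simp add: sum_distrib_left mult_ac) (rule sum.swap)
    also have "\<dots> = (\<Sum>j\<in>box n. of_real (\<Sum>l\<in>box n. P k l * G l j) * maj_b n j f S)"
      by (simp only: sum_distrib_right of_real_sum)
    finally show ?thesis using PG[OF k] by simp
  qed
  have "hamiltonian J h n (annih n G k f) S = hamiltonian J h n (maj_a n k f) S + (\<Sum>j\<in>box n. of_real (G k j) * hamiltonian J h n (maj_b n j f) S)"
    unfolding annih_def by (simp only: hamiltonian_lin)
  also have "\<dots> = annih n G k (hamiltonian J h n f) S - 2 * ((\<Sum>j\<in>box n. of_real (hopping J h k j) * maj_b n j f S)
     + (\<Sum>j\<in>box n. of_real (G k j) * (\<Sum>i\<in>box n. of_real (hopping J h i j) * maj_a n i f S)))"
    using k by (simp add: hamiltonian_maj_a hamiltonian_maj_b annih_def right_diff_distrib sum_subtractf sum_distrib_left mult_ac)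
  also have "(\<Sum>j\<in>box n. of_real (hopping J h k j) * maj_b n j f S)
     + (\<Sum>j\<in>box n. of_real (G k j) * (\<Sum>i\<in>box n. of_real (hopping J h i j) * maj_a n i f S))
     = (\<Sum>l\<in>box n. of_real (P k l) * annih n G l f S)"
    unfolding 1 2[symmetric] annih_def by (simp add: distrib_left sum.distrib)
  finally show ?thesis .
qed

text \<open>Write P = p + D. By 2xy <= x^2 + y^2 and the symmetry of D, the D part is at most the
  absolute row sums weighted by |f k|^2, hence at most half of the p part.\<close>

lemma quad_lower:
  fixes P :: "int \<Rightarrow> int \<Rightarrow> real" and f :: "int \<Rightarrow> complex"
  assumes "finite F" and sym: "\<And>k l. k \<in> F \<Longrightarrow> l \<in> F \<Longrightarrow> P k l = P l k"
    and row: "\<And>k. k \<in> F \<Longrightarrow> (\<Sum>l\<in>F. \<bar>P k l - (if k = l then p else 0)\<bar>) \<le> p / 2"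
  shows "(\<Sum>k\<in>F. \<Sum>l\<in>F. P k l * Re (cnj (f k) * f l)) \<ge> p / 2 * (\<Sum>k\<in>F. (cmod (f k))\<^sup>2)"
proof -
  define D where "D = (\<lambda>k l. P k l - (if k = l then p else 0))"
  have Dsym: "D k l = D l k" if "k \<in> F" "l \<in> F" for k l using sym that by (simp add: D_def)
  have tm: "D k l * Re (cnj (f k) * f l) \<ge> - (\<bar>D k l\<bar> * ((cmod (f k))\<^sup>2 + (cmod (f l))\<^sup>2) / 2)" for k l
  proof -
    have "\<bar>Re (cnj (f k) * f l)\<bar> \<le> cmod (f k) * cmod (f l)" using abs_Re_le_cmod[of "cnj (f k) * f l"] by (simp add: norm_mult)
    also have "\<dots> \<le> ((cmod (f k))\<^sup>2 + (cmod (f l))\<^sup>2) / 2" using sum_squares_bound[of "cmod (f k)" "cmod (f l)"] by simp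
    finally have "\<bar>D k l * Re (cnj (f k) * f l)\<bar> \<le> \<bar>D k l\<bar> * (((cmod (f k))\<^sup>2 + (cmod (f l))\<^sup>2) / 2)"
      unfolding abs_mult by (intro mult_left_mono) auto
    thus ?thesis by simp
  qed
  define R where "R = (\<lambda>k l. Re (cnj (f k) * f l))"
  have R: "R k k = (cmod (f k))\<^sup>2" for k
    unfolding R_def by (metis Re_complex_of_real complex_norm_square mult.commute)
  have "P k l * R k l = (if k = l then p * (cmod (f k))\<^sup>2 else 0) + D k l * R k l" for k l
    by (auto simp: D_def R algebra_simps)
  hence "(\<Sum>k\<in>F. \<Sum>l\<in>F. P k l * Re (cnj (f k) * f l))
     = (\<Sum>k\<in>F. \<Sum>l\<in>F. (if k = l then p * (cmod (f k))\<^sup>2 else 0) + D k l * Re (cnj (f k) * f l))"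
    unfolding R_def by (intro sum.cong refl)
  also have "\<dots> = p * (\<Sum>k\<in>F. (cmod (f k))\<^sup>2) + (\<Sum>k\<in>F. \<Sum>l\<in>F. D k l * Re (cnj (f k) * f l))"
    using assms(1) by (simp add: sum.distrib sum_distrib_left)
  finally have 1: "(\<Sum>k\<in>F. \<Sum>l\<in>F. P k l * Re (cnj (f k) * f l)) = \<dots>" .
  have "(\<Sum>k\<in>F. \<Sum>l\<in>F. D k l * Re (cnj (f k) * f l)) \<ge> (\<Sum>k\<in>F. \<Sum>l\<in>F. - (\<bar>D k l\<bar> * ((cmod (f k))\<^sup>2 + (cmod (f l))\<^sup>2) / 2))"
    by (intro sum_mono tm)
  also have "(\<Sum>k\<in>F. \<Sum>l\<in>F. - (\<bar>D k l\<bar> * ((cmod (f k))\<^sup>2 + (cmod (f l))\<^sup>2) / 2))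
     = - ((\<Sum>k\<in>F. \<Sum>l\<in>F. \<bar>D k l\<bar> * (cmod (f k))\<^sup>2) + (\<Sum>k\<in>F. \<Sum>l\<in>F. \<bar>D k l\<bar> * (cmod (f l))\<^sup>2)) / 2"
  proof -
    have "- (d * (a + b) / 2) = (-1/2) * (d * a) + (-1/2) * (d * b)" for a b d :: real by (simp add: algebra_simps)
    thus ?thesis by (simp only: sum.distrib sum_distrib_left[symmetric]) simp
  qed
  also have "(\<Sum>k\<in>F. \<Sum>l\<in>F. \<bar>D k l\<bar> * (cmod (f l))\<^sup>2) = (\<Sum>k\<in>F. \<Sum>l\<in>F. \<bar>D k l\<bar> * (cmod (f k))\<^sup>2)"
    by (subst sum.swap) (intro sum.cong refl, simp add: Dsym)
  finally have 2: "(\<Sum>k\<in>F. \<Sum>l\<in>F. D k l * Re (cnj (f k) * f l)) \<ge> - (\<Sum>k\<in>F. \<Sum>l\<in>F. \<bar>D k l\<bar> * (cmod (f k))\<^sup>2)" by simp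
  have "(\<Sum>k\<in>F. \<Sum>l\<in>F. \<bar>D k l\<bar> * (cmod (f k))\<^sup>2) = (\<Sum>k\<in>F. (\<Sum>l\<in>F. \<bar>D k l\<bar>) * (cmod (f k))\<^sup>2)"
    by (simp add: sum_distrib_right)
  also have "\<dots> \<le> (\<Sum>k\<in>F. p / 2 * (cmod (f k))\<^sup>2)"
    using row by (intro sum_mono mult_right_mono) (auto simp: D_def)
  also have "\<dots> = p / 2 * (\<Sum>k\<in>F. (cmod (f k))\<^sup>2)" by (simp only: sum_distrib_left)
  finally show ?thesis using 1 2 by linarith
qed


section \<open>Annihilation of ground states\<close>

lemma wave_inner_self: "wave_inner n f f = of_real (\<Sum>S\<in>Pow (box n). (cmod (f S))\<^sup>2)"
  unfolding wave_inner_def of_real_sum complex_norm_square by (simp add: mult.commute)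

text \<open>P is never diagonalised. The variational bound for each vector \<open>\<Phi> k\<close>
  gives sum_l P_kl Re<\<Phi>_k, \<Phi>_l> <= 0. Summed over k this is a quadratic form which
  \<open>quad_lower\<close> bounds below at every configuration, so all \<open>\<Phi> k\<close>
  vanish.\<close>

lemma annih_vanishes:
  fixes P G :: "int \<Rightarrow> int \<Rightarrow> real"
  assumes eig: "\<And>S. hamiltonian J h n \<phi> S = of_real E * \<phi> S"
    and low: "\<And>f. Re (wave_inner n f (hamiltonian J h n f)) \<ge> E * Re (wave_inner n f f)"
    and PG: "\<And>k j. k \<in> box n \<Longrightarrow> j \<in> box n \<Longrightarrow> (\<Sum>l\<in>box n. P k l * G l j) = hopping J h k j"
    and GB: "\<And>k i. k \<in> box n \<Longrightarrow> i \<in> box n \<Longrightarrow> (\<Sum>j\<in>box n. G k j * hopping J h i j) = P k i"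
    and sym: "\<And>k l. k \<in> box n \<Longrightarrow> l \<in> box n \<Longrightarrow> P k l = P l k"
    and row: "\<And>k. k \<in> box n \<Longrightarrow> (\<Sum>l\<in>box n. \<bar>P k l - (if k = l then p else 0)\<bar>) \<le> p / 2" and p: "p > 0"
    and k: "k \<in> box n" and S: "S \<subseteq> box n"
  shows "annih n G k \<phi> S = 0"
proof -
  define \<Phi> where "\<Phi> = (\<lambda>k. annih n G k \<phi>)"
  have H: "hamiltonian J h n (\<Phi> k) = (\<lambda>S. of_real E * \<Phi> k S + (\<Sum>l\<in>box n. of_real (- 2 * P k l) * \<Phi> l S))" if "k \<in> box n" for k
  proof
    fix S
    have "hamiltonian J h n \<phi> = (\<lambda>S. of_real E * \<phi> S)" using eig by blast
    hence "annih n G k (hamiltonian J h n \<phi>) S = of_real E * \<Phi> k S"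
      by (simp add: annih_def \<Phi>_def maj_a_lin maj_b_lin distrib_left sum_distrib_left mult_ac)
    thus "hamiltonian J h n (\<Phi> k) S = of_real E * \<Phi> k S + (\<Sum>l\<in>box n. of_real (- 2 * P k l) * \<Phi> l S)"
      using hamiltonian_annih[OF that PG GB, of \<phi> S] by (simp add: \<Phi>_def sum_distrib_left sum_negf mult_ac)
  qed
  have "(\<Sum>l\<in>box n. P k l * Re (wave_inner n (\<Phi> k) (\<Phi> l))) \<le> 0" if k: "k \<in> box n" for k
  proof -
    have "wave_inner n (\<Phi> k) (hamiltonian J h n (\<Phi> k)) = of_real E * wave_inner n (\<Phi> k) (\<Phi> k) + (\<Sum>l\<in>box n. of_real (- 2 * P k l) * wave_inner n (\<Phi> k) (\<Phi> l))"
      unfolding H[OF k] by (simp only: wave_inner_lin)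
    hence "Re (wave_inner n (\<Phi> k) (hamiltonian J h n (\<Phi> k))) = E * Re (wave_inner n (\<Phi> k) (\<Phi> k)) + (\<Sum>l\<in>box n. - 2 * P k l * Re (wave_inner n (\<Phi> k) (\<Phi> l)))"
      by (simp add: Re_sum)
    with low[of "\<Phi> k"] have "0 \<le> (\<Sum>l\<in>box n. - 2 * P k l * Re (wave_inner n (\<Phi> k) (\<Phi> l)))" by simp
    also have "\<dots> = - 2 * (\<Sum>l\<in>box n. P k l * Re (wave_inner n (\<Phi> k) (\<Phi> l)))" by (simp add: sum_distrib_left mult_ac)
    finally show ?thesis by simp
  qed
  hence "(\<Sum>k\<in>box n. \<Sum>l\<in>box n. P k l * Re (wave_inner n (\<Phi> k) (\<Phi> l))) \<le> 0" by (rule sum_nonpos)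
  also have "(\<Sum>k\<in>box n. \<Sum>l\<in>box n. P k l * Re (wave_inner n (\<Phi> k) (\<Phi> l)))
     = (\<Sum>k\<in>box n. \<Sum>S\<in>Pow (box n). \<Sum>l\<in>box n. P k l * Re (cnj (\<Phi> k S) * \<Phi> l S))"
    unfolding wave_inner_def Re_sum sum_distrib_left by (intro sum.cong refl sum.swap)
  also have "\<dots> = (\<Sum>S\<in>Pow (box n). \<Sum>k\<in>box n. \<Sum>l\<in>box n. P k l * Re (cnj (\<Phi> k S) * \<Phi> l S))"
    by (rule sum.swap)
  finally have up: "\<dots> \<le> 0" .
  have "(\<Sum>S\<in>Pow (box n). p / 2 * (\<Sum>k\<in>box n. (cmod (\<Phi> k S))\<^sup>2))
    \<le> (\<Sum>S\<in>Pow (box n). \<Sum>k\<in>box n. \<Sum>l\<in>box n. P k l * Re (cnj (\<Phi> k S) * \<Phi> l S))"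
    by (intro sum_mono quad_lower[of "box n" P p "\<lambda>k. \<Phi> k _"] sym row) auto
  with up have "(\<Sum>S\<in>Pow (box n). p / 2 * (\<Sum>k\<in>box n. (cmod (\<Phi> k S))\<^sup>2)) \<le> 0" by linarith
  moreover have nn: "0 \<le> p / 2 * (\<Sum>k\<in>box n. (cmod (\<Phi> k S))\<^sup>2)" for S using p by (intro mult_nonneg_nonneg sum_nonneg) auto
  ultimately have "(\<Sum>S\<in>Pow (box n). p / 2 * (\<Sum>k\<in>box n. (cmod (\<Phi> k S))\<^sup>2)) = 0"
    by (intro antisym sum_nonneg) auto
  hence "p / 2 * (\<Sum>k\<in>box n. (cmod (\<Phi> k S))\<^sup>2) = 0"
    using S nn by (subst (asm) sum_nonneg_eq_0_iff) auto
  hence "(\<Sum>k\<in>box n. (cmod (\<Phi> k S))\<^sup>2) = 0" using p by simp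
  hence "(cmod (\<Phi> k S))\<^sup>2 = 0" using k by (subst (asm) sum_nonneg_eq_0_iff) auto
  thus ?thesis by (simp add: \<Phi>_def)
qed

section \<open>The variational principle on subsets of the box\<close>

lemma bij_spin: "bij_betw spin (Pow (box n)) (box_configs n)"
proof (rule bij_betw_byWitness[where f'="\<lambda>s. {i. s i = -1}"])
  show "\<forall>S\<in>Pow (box n). {i. spin S i = -1} = S" by (auto simp: spin_def split: if_splits)
  show "\<forall>s\<in>box_configs n. spin {i. s i = -1} = s" 
  proof
    fix s assume s: "s \<in> box_configs n"
    have "s i = -1 \<or> s i = 1" for i using s by (cases "i \<in> box n") (auto simp: box_configs_def)
    thus "spin {i. s i = -1} = s" unfolding spin_def fun_eq_iff mem_Collect_eq by metis
  qed
  show "spin ` Pow (box n) \<subseteq> box_configs n" by (auto simp: spin_def box_configs_def split: if_splits)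
  show "(\<lambda>s. {i. s i = -1}) ` box_configs n \<subseteq> Pow (box n)"
    by (auto simp: box_configs_def)
qed

lemma sum_box_configs: "(\<Sum>s\<in>box_configs n. F s) = (\<Sum>S\<in>Pow (box n). F (spin S))"
  by (rule sum.reindex_bij_betw[OF bij_spin, symmetric])

lemma normalized_inner: "normalized n psi \<longleftrightarrow> Re (wave_inner n (\<lambda>S. psi (spin S)) (\<lambda>S. psi (spin S))) = 1"
  by (simp add: normalized_def wave_inner_self sum_box_configs)

lemma energy_inner: "energy J h n psi = Re (wave_inner n (\<lambda>S. psi (spin S)) (hamiltonian J h n (\<lambda>S. psi (spin S))))"
  by (simp add: energy_def wave_inner_def sum_box_configs ising_H_hamiltonian)

lemma wave_spin: "(\<lambda>S. f {i. spin S i = -1}) = f" 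
  by (auto simp: spin_def intro!: arg_cong[where f=f])

lemma ground_low:
  assumes g: "ground_state J h n psi"
  shows "Re (wave_inner n f (hamiltonian J h n f)) \<ge> energy J h n psi * Re (wave_inner n f f)"
proof -
  have low: "Re (wave_inner n f (hamiltonian J h n f)) \<ge> energy J h n psi" if "Re (wave_inner n f f) = 1" for f
  proof -
    let ?p = "\<lambda>s. f {i. s i = -1}"
    have "normalized n ?p" using that unfolding normalized_inner wave_spin .
    hence "energy J h n psi \<le> energy J h n ?p" using g by (simp add: ground_state_def)
    thus ?thesis unfolding energy_inner[of J h n ?p] wave_spin .
  qed
  define N where "N = Re (wave_inner n f f)"
  have N0: "N \<ge> 0" unfolding N_def wave_inner_self by (auto intro: sum_nonneg)
  show ?thesis
  proof (cases "N = 0")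
    case True
    hence z: "f S = 0" if "S \<subseteq> box n" for S
      using that unfolding N_def wave_inner_self Re_complex_of_real by (subst (asm) sum_nonneg_eq_0_iff) auto
    have "wave_inner n f g = 0" for g unfolding wave_inner_def by (rule sum.neutral) (use z in auto)
    thus ?thesis by simp
  next
    case False
    define r where "r = 1 / sqrt N"
    have r2: "r * r * N = 1" using False N0 by (simp add: r_def)
    define g where "g = (\<lambda>S. of_real r * f S)"
    have "wave_inner n g g = of_real (r * r) * wave_inner n f f" unfolding g_def by (simp add: wave_inner_lin wave_inner_left_lin)
    hence 1: "Re (wave_inner n g g) = 1" using r2 by (simp add: N_def)
    have "wave_inner n g (hamiltonian J h n g) = of_real (r * r) * wave_inner n f (hamiltonian J h n f)" unfolding g_def by (simp add: hamiltonian_lin wave_inner_lin wave_inner_left_lin)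
    hence "Re (wave_inner n g (hamiltonian J h n g)) = r * r * Re (wave_inner n f (hamiltonian J h n f))" by simp
    with low[OF 1] have "energy J h n psi \<le> r * r * Re (wave_inner n f (hamiltonian J h n f))" by simp
    hence "energy J h n psi * N \<le> r * r * Re (wave_inner n f (hamiltonian J h n f)) * N" using N0 by (rule mult_right_mono)
    also have "\<dots> = Re (wave_inner n f (hamiltonian J h n f)) * (r * r * N)" by simp
    finally show ?thesis using r2 by (simp add: N_def)
  qed
qed

text \<open>First variation in the direction of the residual u = (H - E) \<phi>: the linear term is
  2 t N with N the squared norm of u, so N must be 0.\<close>

lemma ground_eigen:
  assumes g: "ground_state J h n psi" and S: "S \<subseteq> box n"
  shows "hamiltonian J h n (\<lambda>S. psi (spin S)) S = of_real (energy J h n psi) * psi (spin S)"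
proof -
  define \<phi> where "\<phi> = (\<lambda>S. psi (spin S))"
  define E where "E = energy J h n psi"
  define u where "u = (\<lambda>S. hamiltonian J h n \<phi> S + of_real (- E) * \<phi> S)"
  define N where "N = Re (wave_inner n u u)"
  define q where "q = Re (wave_inner n u (hamiltonian J h n u)) - E * N"
  have N: "N = (\<Sum>S\<in>Pow (box n). (cmod (u S))\<^sup>2)" unfolding N_def wave_inner_self by simp
  have n1: "Re (wave_inner n \<phi> \<phi>) = 1" using g unfolding ground_state_def normalized_inner \<phi>_def by simp
  have E: "Re (wave_inner n \<phi> (hamiltonian J h n \<phi>)) = E" by (simp add: E_def energy_inner \<phi>_def)
  have t: "0 \<le> 2 * t * N + t * t * q" for t
  proof -
    define f where "f = (\<lambda>S. \<phi> S + of_real t * u S)"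
    have herm: "wave_inner n \<phi> (hamiltonian J h n u) = wave_inner n (hamiltonian J h n \<phi>) u" by (rule hamiltonian_hermitian)
    have cj: "Re (wave_inner n a b) = Re (wave_inner n b a)" for a b
      unfolding wave_inner_def Re_sum by (intro sum.cong refl) (simp add: mult_ac)
    have a: "Re (wave_inner n f (hamiltonian J h n f)) = E + 2 * t * Re (wave_inner n u (hamiltonian J h n \<phi>)) + t * t * Re (wave_inner n u (hamiltonian J h n u))"
      unfolding f_def using herm cj[of "hamiltonian J h n \<phi>" u] E by (simp add: hamiltonian_lin wave_inner_lin wave_inner_left_lin algebra_simps)
    have b: "Re (wave_inner n f f) = 1 + 2 * t * Re (wave_inner n u \<phi>) + t * t * N"
      unfolding f_def using cj[of \<phi> u] n1 by (simp add: wave_inner_lin wave_inner_left_lin algebra_simps N_def)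
    have "wave_inner n u u = wave_inner n u (hamiltonian J h n \<phi>) + of_real (- E) * wave_inner n u \<phi>"
      by (subst (2) u_def) (simp only: wave_inner_lin)
    hence c: "N = Re (wave_inner n u (hamiltonian J h n \<phi>)) - E * Re (wave_inner n u \<phi>)" by (simp add: N_def)
    have "E * Re (wave_inner n f f) \<le> Re (wave_inner n f (hamiltonian J h n f))" using ground_low[OF g, of f] by (simp add: E_def)
    hence "E * (1 + 2 * t * Re (wave_inner n u \<phi>) + t * t * N) \<le> E + 2 * t * Re (wave_inner n u (hamiltonian J h n \<phi>)) + t * t * Re (wave_inner n u (hamiltonian J h n u))"
      unfolding a b .
    moreover have "2 * t * N = 2 * t * Re (wave_inner n u (hamiltonian J h n \<phi>)) - 2 * t * (E * Re (wave_inner n u \<phi>))"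
      by (subst c) (simp add: algebra_simps)
    ultimately show ?thesis unfolding q_def by (simp add: algebra_simps)
  qed
  have "N \<le> 0"
  proof (rule ccontr)
    assume "\<not> N \<le> 0"
    hence N: "N > 0" by simp
    \<comment> \<open>Chosen so that s q < N; at t = -s the linear term then outweighs the quadratic
      one.\<close>
    define s where "s = N / (\<bar>q\<bar> + 1)"
    have s: "s > 0" using N by (simp add: s_def)
    have "s * q \<le> s * \<bar>q\<bar>" using s by (intro mult_left_mono) auto
    also have "\<dots> < s * (\<bar>q\<bar> + 1)" using s by simp
    also have "\<dots> = N" by (simp add: s_def)
    finally have "s * q < N" .
    hence "s * (s * q) < s * N" using s by simp
    moreover have "0 < s * N" using s N by simp
    ultimately show False using t[of "- s"] by (simp add: algebra_simps)
  qed
  hence "(\<Sum>S\<in>Pow (box n). (cmod (u S))\<^sup>2) = 0" unfolding N by (intro antisym sum_nonneg) auto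
  hence "u S = 0" using S by (subst (asm) sum_nonneg_eq_0_iff) auto
  thus ?thesis by (simp add: u_def \<phi>_def E_def)
qed

lemma box_prob_det:
  fixes P G :: "int \<Rightarrow> int \<Rightarrow> real"
  assumes g: "ground_state J h n psi"
    and PG: "\<And>k j. k \<in> box n \<Longrightarrow> j \<in> box n \<Longrightarrow> (\<Sum>l\<in>box n. P k l * G l j) = hopping J h k j"
    and GB: "\<And>k i. k \<in> box n \<Longrightarrow> i \<in> box n \<Longrightarrow> (\<Sum>j\<in>box n. G k j * hopping J h i j) = P k i"
    and sym: "\<And>k l. k \<in> box n \<Longrightarrow> l \<in> box n \<Longrightarrow> P k l = P l k"
    and row: "\<And>k. k \<in> box n \<Longrightarrow> (\<Sum>l\<in>box n. \<bar>P k l - (if k = l then p else 0)\<bar>) \<le> p / 2" and p: "p > 0"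
    and xs: "distinct xs" "set xs \<subseteq> box n" and x: "\<And>i. i \<in> set xs \<Longrightarrow> x i \<in> {-1, 1}"
  shows "box_prob n psi (set xs) x =
    det (mat (length xs) (length xs) (\<lambda>(a, b). ((if a = b then 1 else 0) + G (xs ! a) (xs ! b) * of_int (x (xs ! b))) / 2))"
proof -
  \<comment> \<open>\<open>ground_state\<close> constrains \<open>psi\<close> only on box
    configurations, while \<open>wick\<close> needs the annihilators to vanish at every set. The
    cutoff changes neither the norm nor the probabilities.\<close>
  define \<phi> where "\<phi> = (\<lambda>S. if S \<subseteq> box n then psi (spin S) else 0)"
  have tz: "maj_a n i \<phi> S = (if S \<subseteq> box n then maj_a n i (\<lambda>S. psi (spin S)) S else 0)"
     "maj_b n i \<phi> S = (if S \<subseteq> box n then maj_b n i (\<lambda>S. psi (spin S)) S else 0)" if "i \<in> box n" for i S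
    using that by (auto simp: maj_a_def maj_b_def \<phi>_def toggle_subset)
  have tz2: "maj_a n i (maj_b n j \<phi>) S = (if S \<subseteq> box n then maj_a n i (maj_b n j (\<lambda>S. psi (spin S))) S else 0)"
    if "i \<in> box n" "j \<in> box n" for i j S
    using that unfolding maj_a_def by (auto simp: tz toggle_subset)
  have eig: "hamiltonian J h n \<phi> S = of_real (energy J h n psi) * \<phi> S" for S
  proof (cases "S \<subseteq> box n")
    case True
    hence "hamiltonian J h n \<phi> S = hamiltonian J h n (\<lambda>S. psi (spin S)) S" unfolding hamiltonian_def by (intro sum.cong refl) (simp add: tz2)
    thus ?thesis using ground_eigen[OF g True] True by (simp add: \<phi>_def)
  next
    case False
    hence "hamiltonian J h n \<phi> S = 0" unfolding hamiltonian_def by (simp add: tz2)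
    thus ?thesis using False by (simp add: \<phi>_def)
  qed
  have z: "annih n G k \<phi> S = 0" if k: "k \<in> box n" for k S
  proof (cases "S \<subseteq> box n")
    case True
    show ?thesis by (rule annih_vanishes[OF eig ground_low[OF g] PG GB sym row p k True])
  next
    case False
    thus ?thesis using k by (simp add: annih_def tz)
  qed
  \<comment> \<open>With these weights \<alpha> + \<beta> \<open>\<sigma>\<^sup>z\<close> is the
    spectral projection onto the value \<open>x i\<close>; the product over the sites is the
    indicator of the event.\<close>
  define \<alpha> :: "int \<Rightarrow> real" where "\<alpha> = (\<lambda>_. 1/2)"
  define \<beta> :: "int \<Rightarrow> real" where "\<beta> = (\<lambda>i. of_int (x i) / 2)"
  have n1: "wave_inner n \<phi> \<phi> = 1"
  proof -
    have "(\<Sum>S\<in>Pow (box n). (cmod (\<phi> S))\<^sup>2) = (\<Sum>S\<in>Pow (box n). (cmod (psi (spin S)))\<^sup>2)"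
      by (rule sum.cong) (auto simp: \<phi>_def)
    thus ?thesis using g by (simp add: wave_inner_self ground_state_def normalized_def sum_box_configs)
  qed
  have "mat (length xs) (length xs) (\<lambda>(a, b). wick_kernel G \<alpha> \<beta> (xs ! a) (xs ! b)) =
     mat (length xs) (length xs) (\<lambda>(a, b). ((if a = b then 1 else 0) + G (xs ! a) (xs ! b) * of_int (x (xs ! b))) / 2)"
    using xs(1) by (intro eq_matI) (auto simp: wick_kernel_def \<alpha>_def \<beta>_def nth_eq_iff_index_eq add_divide_distrib)
  hence W: "wave_inner n \<phi> (foldr (maj_a n) xs (fold (lin_form n \<alpha> \<beta>) xs \<phi>)) = of_real (det (mat (length xs) (length xs)
      (\<lambda>(a, b). ((if a = b then 1 else 0) + G (xs ! a) (xs ! b) * of_int (x (xs ! b))) / 2)))"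
    using wick[OF z xs xs(2) refl refl, of \<alpha> \<beta>] n1 by simp
  have pr: "(\<Prod>i\<in>set xs. \<alpha> i + \<beta> i * of_int (spin S i)) = (if \<forall>i\<in>set xs. spin S i = x i then 1 else 0)" for S
  proof (cases "\<forall>i\<in>set xs. spin S i = x i")
    case True
    have "\<alpha> i + \<beta> i * of_int (spin S i) = 1" if "i \<in> set xs" for i
      using x[OF that] True that by (auto simp: \<alpha>_def \<beta>_def)
    thus ?thesis using True by simp
  next
    case False
    then obtain i where i: "i \<in> set xs" "spin S i \<noteq> x i" by blast
    hence "\<alpha> i + \<beta> i * of_int (spin S i) = 0" using x[OF i(1)] by (auto simp: \<alpha>_def \<beta>_def spin_def split: if_splits)
    thus ?thesis using False i(1) by (auto simp: prod_zero_iff)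
  qed
  have "wave_inner n \<phi> (foldr (maj_a n) xs (fold (lin_form n \<alpha> \<beta>) xs \<phi>)) =
     (\<Sum>S\<in>Pow (box n). of_real (if \<forall>i\<in>set xs. spin S i = x i then (cmod (psi (spin S)))\<^sup>2 else 0))"
    unfolding foldr_fold_principal[OF xs] wave_inner_def pr
    by (rule sum.cong) (auto simp: \<phi>_def complex_norm_square mult.commute simp del: of_real_power)
  also have "\<dots> = of_real (\<Sum>S\<in>Pow (box n). if \<forall>i\<in>set xs. spin S i = x i then (cmod (psi (spin S)))\<^sup>2 else 0)"
    by (simp only: of_real_sum)
  also have "(\<Sum>S\<in>Pow (box n). if \<forall>i\<in>set xs. spin S i = x i then (cmod (psi (spin S)))\<^sup>2 else 0)
     = (\<Sum>s\<in>box_configs n. if \<forall>i\<in>set xs. s i = x i then (cmod (psi s))\<^sup>2 else 0)"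
    unfolding sum_box_configs ..
  also have "\<dots> = box_prob n psi (set xs) x" unfolding box_prob_def
    by (rule sum.inter_filter[symmetric]) (use bij_betw_finite[OF bij_spin] in auto)
  finally show ?thesis unfolding W of_real_eq_iff by (rule HOL.sym)
qed

section \<open>The polar factor of the hopping matrix\<close>

text \<open>\<open>up F\<close> and \<open>down F\<close> are the shifts compressed to \<open>F\<close>; outside \<open>F\<close> the operators \<open>hop l F\<close>, \<open>hop_t l F\<close>,
  \<open>polar l F\<close> act as the identity.\<close>
definition shift :: "int \<Rightarrow> op" where "shift k = comp_op (\<lambda>_. True) (\<lambda>i. i - k)"
definition up :: "int set \<Rightarrow> op" where "up F = comp_op (\<lambda>i. i \<in> F \<and> i - 1 \<in> F) (\<lambda>i. i - 1)"
definition down :: "int set \<Rightarrow> op" where "down F = comp_op (\<lambda>i. i \<in> F \<and> i + 1 \<in> F) (\<lambda>i. i + 1)"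
definition hop :: "real \<Rightarrow> int set \<Rightarrow> op" where "hop l F = 1 - l *\<^sub>R up F"
definition hop_t :: "real \<Rightarrow> int set \<Rightarrow> op" where "hop_t l F = 1 - l *\<^sub>R down F"
text \<open>With l = J/h, \<open>1 + hop_defect\<close> is B B^T of the overview;
  \<open>polar\<close> is G, \<open>polar_t\<close> its transpose and \<open>modulus\<close> is
  P.\<close>

definition hop_defect :: "real \<Rightarrow> int set \<Rightarrow> op" where "hop_defect l F = hop l F * hop_t l F - 1"
definition inv_sqrt :: "real \<Rightarrow> int set \<Rightarrow> op" where "inv_sqrt l F = power_sum inv_sqrt_coeff (hop_defect l F)"
definition polar :: "real \<Rightarrow> int set \<Rightarrow> op" where "polar l F = inv_sqrt l F * hop l F"
definition polar_t :: "real \<Rightarrow> int set \<Rightarrow> op" where "polar_t l F = hop_t l F * inv_sqrt l F"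
text \<open>The square root of B B^T, written as B B^T times its inverse square root so that one
  binomial series serves both.\<close>

definition modulus :: "real \<Rightarrow> int set \<Rightarrow> op" where "modulus l F = (1 + hop_defect l F) * inv_sqrt l F"

lemma norm_up: "norm (up F) \<le> 1" and norm_down: "norm (down F) \<le> 1"
  by (auto simp: up_def down_def norm_comp_op)

text \<open>For \<open>G = 1 + X\<close> this is \<open>(1 - G) (1 + G)\<^bsup>-1\<^esup>\<close>.\<close>
definition cayley :: "op \<Rightarrow> op" where "cayley X = - X * ((1/2) *\<^sub>R power_sum (\<lambda>k. (-(1/2)) ^ k) X)"

section \<open>The Cayley transform\<close>

lemma half_pow_bound: "\<bar>(-(1/2)) ^ k\<bar> \<le> (1::real)"
  by (simp add: power_abs power_le_one)

lemma cayley_inverse: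
  assumes "norm X < 1"
  defines "C \<equiv> (1/2) *\<^sub>R power_sum (\<lambda>k. (-(1/2)) ^ k) X"
  shows "(2 + X) * C = 1" "C * (2 + X) = 1" "C * X = X * C"
proof -
  have "(1 + (1/2) *\<^sub>R X) * power_sum (\<lambda>k. (-(1/2)) ^ k) X = 1" by (rule power_sum_geometric) (use assms in auto)
  moreover have "2 + X = 2 *\<^sub>R (1 + (1/2) *\<^sub>R X)" by (simp add: scaleR_add_right scaleR_2)
  ultimately show 1: "(2 + X) * C = 1" by (simp add: C_def)
  show c: "C * X = X * C" unfolding C_def
    using power_sum_commute[of "\<lambda>k. (-(1/2)) ^ k" "norm X" X X, OF half_pow_bound assms(1)] by simp
  show "C * (2 + X) = 1" using 1 c by (simp add: distrib_left distrib_right mult_2 mult_2_right)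
qed

lemma cayley_eq:
  assumes "norm X < 1" shows "(2 + X) * cayley X = - X" "cayley X * (2 + X) = - X"
proof -
  define C where "C = (1/2) *\<^sub>R power_sum (\<lambda>k. (-(1/2)) ^ k) X"
  note C = cayley_inverse[OF assms, folded C_def]
  have cayley: "cayley X = - X * C" by (simp add: cayley_def C_def)
  show "cayley X * (2 + X) = - X" using C(2) by (simp add: cayley mult.assoc)
  have "(2 + X) * cayley X = - ((2 + X) * C * X)" using C(3) by (simp add: cayley mult.assoc)
  thus "(2 + X) * cayley X = - X" using C(1) by simp
qed

lemma row_tendsto_cayley:
  assumes "row_tendsto X A" "\<And>n. norm (X n) \<le> q" "q < 1" "row_tight A"
  shows "row_tendsto (\<lambda>n. cayley (X n)) (cayley A)"
proof -
  let ?c = "\<lambda>k::nat. (-(1/2)) ^ k :: real"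
  have "norm (power_sum ?c (X n)) \<le> 1 + q / (1 - q)" for n
  proof -
    have "norm (power_sum ?c (X n) - ?c 0 *\<^sub>R 1) \<le> q / (1 - q)" by (rule power_sum_norm[OF half_pow_bound assms(3,2)])
    thus ?thesis using norm_triangle_sub[of "power_sum ?c (X n)" "1"] by simp
  qed
  moreover have "row_tendsto (\<lambda>n. power_sum ?c (X n)) (power_sum ?c A)" by (rule row_tendsto_power_sum[OF half_pow_bound assms(3,1,2,4)])
  ultimately have "row_tendsto (\<lambda>n. X n * power_sum ?c (X n)) (A * power_sum ?c A)" using row_tendsto_mult assms(1,4) by blast
  from row_tendsto_scaleR[OF this, of "-1/2"] show ?thesis by (simp add: cayley_def)
qed

lemma preserves_support_cayley: 
  assumes "norm X < 1" "preserves_support F X" shows "preserves_support F (cayley X)"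
proof -
  have "preserves_support F (power_sum (\<lambda>k. (-(1/2)) ^ k) X)" by (rule preserves_support_power_sum[OF half_pow_bound assms(1) order_refl assms(2)])
  from preserves_support_intros(4)[OF preserves_support_intros(5)[OF assms(2) this], of "-1/2"] show ?thesis by (simp add: cayley_def)
qed

lemma transposes_cayley:
  assumes "norm X \<le> q" "norm Y \<le> q" "q < 1" "finite F" "transposes F X Y" shows "transposes F (cayley X) (cayley Y)"
proof -
  let ?c = "\<lambda>k::nat. (-(1/2)) ^ k :: real"
  have "transposes F (power_sum ?c X) (power_sum ?c Y)" by (rule transposes_power_sum[OF half_pow_bound assms(3,1,2,4,5)])
  from transposes_intros(4)[OF transposes_mult[OF assms(4,5) this], of "-1/2"]
  have "transposes F (cayley X) ((-1/2) *\<^sub>R (power_sum ?c Y * Y))" by (simp add: cayley_def)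
  moreover have "power_sum ?c Y * Y = Y * power_sum ?c Y"
    by (rule power_sum_commute[OF half_pow_bound assms(3,2), symmetric]) simp
  ultimately show ?thesis by (simp add: cayley_def)
qed

text \<open>(1 - G)/(1 + G) changes sign when G is replaced by its inverse. The sum of the two
  transforms is multiplied by 2 + Y and 2 + X, both invertible, to clear denominators without
  commuting anything.\<close>

lemma cayley_antisym:
  assumes "norm X < 1" "norm Y < 1" "(1 + Y) * (1 + X) = 1"
  shows "cayley Y = - cayley X"
proof -
  obtain C where C: "(2 + X) * C = 1" using cayley_inverse(1)[OF assms(1)] by blast
  obtain D where D: "D * (2 + Y) = 1" using cayley_inverse(2)[OF assms(2)] by blast
  define Z where "Z = cayley X + cayley Y"
  have "(2 + Y) * Z * (2 + X) = (2 + Y) * (cayley X * (2 + X)) + (2 + Y) * cayley Y * (2 + X)"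
    by (simp add: Z_def distrib_left distrib_right mult.assoc)
  also have "\<dots> = - 2 * ((1 + Y) * (1 + X)) + 2"
    unfolding cayley_eq[OF assms(1)] cayley_eq[OF assms(2)] by (simp add: algebra_simps mult_2 mult_2_right)
  finally have "(2 + Y) * Z * (2 + X) = 0" using assms(3) by simp
  hence "D * ((2 + Y) * Z * (2 + X)) * C = 0" by simp
  moreover have "D * ((2 + Y) * Z * (2 + X)) * C = (D * (2 + Y)) * Z * ((2 + X) * C)" by (simp only: mult.assoc)
  ultimately have "Z = 0" using C D by simp
  thus ?thesis by (simp add: Z_def add_eq_0_iff)
qed

context
  fixes l :: real
  assumes l: "\<bar>l\<bar> \<le> 1/100"
begin

section \<open>Norm estimates and polar identities\<close>

lemma norm_hop_diff_one: "norm (hop l F - 1) \<le> 1/100" "norm (hop_t l F - 1) \<le> 1/100"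
  using mult_mono[OF l norm_up[of F]] mult_mono[OF l norm_down[of F]] by (auto simp: hop_def hop_t_def)

lemma norm_hop: "norm (hop l F) \<le> 101/100" "norm (hop_t l F) \<le> 101/100"
  using norm_triangle_sub[of "hop l F" 1] norm_triangle_sub[of "hop_t l F" 1] norm_hop_diff_one[of F] by auto

text \<open>Source of the constants that follow: from |l| <= 1/100 and the rounded bounds in between
  one gets 0.0201 for \<open>hop_defect\<close>, 0.03/0.97 for \<open>inv_sqrt - 1\<close>, 0.0504
  for \<open>polar - 1\<close> and 0.0712 for \<open>modulus - 1\<close>.\<close>

lemma norm_perturb:
  assumes "norm (X - 1) \<le> a" "norm (Y - 1) \<le> b" 
  shows "norm (X * Y - (1::op)) \<le> a * (1 + b) + b"
proof -
  have "X * Y - 1 = (X - 1) * Y + (Y - 1)" by (simp add: algebra_simps)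
  hence "norm (X * Y - 1) \<le> norm ((X - 1) * Y) + norm (Y - 1)" by (metis norm_triangle_ineq)
  moreover have "norm ((X - 1) * Y) \<le> a * (1 + b)"
    by (rule order_trans[OF norm_mult_ineq]) (intro mult_mono assms, use norm_triangle_sub[of Y 1] assms in auto,
      use norm_ge_zero order_trans assms(1) in blast)
  ultimately show ?thesis using assms(2) by linarith
qed

lemma norm_hop_defect: "norm (hop_defect l F) \<le> 3/100"
  using norm_perturb[OF norm_hop_diff_one[of F]] by (simp add: hop_defect_def)

lemma norm_inv_sqrt_diff_one: "norm (inv_sqrt l F - 1) \<le> 4/100"
  using power_sum_norm[of inv_sqrt_coeff "3/100" "hop_defect l F", OF inv_sqrt_coeff_bound _ norm_hop_defect] by (simp add: inv_sqrt_def inv_sqrt_coeff_def)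

lemma norm_polar_diff_one: "norm (polar l F - 1) \<le> 6/100" "norm (polar_t l F - 1) \<le> 6/100"
  using norm_perturb[OF norm_inv_sqrt_diff_one[of F] norm_hop_diff_one(1)[of F]] norm_perturb[OF norm_hop_diff_one(2)[of F] norm_inv_sqrt_diff_one[of F]]
  by (auto simp: polar_def polar_t_def)

text \<open>1/2 is the relative margin demanded by \<open>quad_lower\<close>.\<close>

lemma norm_modulus_diff_one: "norm (modulus l F - 1) \<le> 1/2"
  using norm_perturb[of "1 + hop_defect l F" "3/100", OF _ norm_inv_sqrt_diff_one[of F]] norm_hop_defect[of F] by (simp add: modulus_def)

lemma inv_sqrt_square_inverse: "inv_sqrt l F * inv_sqrt l F * (1 + hop_defect l F) = 1"
  unfolding inv_sqrt_def by (rule inv_sqrt_coeff_square) (use norm_hop_defect[of F] in linarith)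

lemma inv_sqrt_commute: "Y * hop_defect l F = hop_defect l F * Y \<Longrightarrow> Y * inv_sqrt l F = inv_sqrt l F * Y"
  unfolding inv_sqrt_def by (rule power_sum_commute[of inv_sqrt_coeff "3/100"]) (use norm_hop_defect inv_sqrt_coeff_bound in auto)

lemma inv_sqrt_commute_defect: "hop_defect l F * inv_sqrt l F = inv_sqrt l F * hop_defect l F" "(1 + hop_defect l F) * inv_sqrt l F = inv_sqrt l F * (1 + hop_defect l F)"
  using inv_sqrt_commute[of "hop_defect l F"] by (auto simp: algebra_simps)

lemma hop_mult_hop_t: "hop l F * hop_t l F = 1 + hop_defect l F"
  by (simp add: hop_defect_def)

lemma modulus_mult_polar: "modulus l F * polar l F = hop l F"
proof -
  have "(1 + hop_defect l F) * inv_sqrt l F * inv_sqrt l F = inv_sqrt l F * inv_sqrt l F * (1 + hop_defect l F)"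
    unfolding inv_sqrt_commute_defect(2) mult.assoc ..
  thus ?thesis unfolding modulus_def polar_def using inv_sqrt_square_inverse[of F] by (metis mult.assoc mult_1)
qed

lemma polar_mult_hop_t: "polar l F * hop_t l F = modulus l F"
  by (simp add: polar_def modulus_def mult.assoc hop_mult_hop_t inv_sqrt_commute_defect(2))

lemma polar_mult_polar_t: "polar l F * polar_t l F = 1"
proof -
  have "polar l F * polar_t l F = inv_sqrt l F * ((hop l F * hop_t l F) * inv_sqrt l F)" by (simp add: polar_def polar_t_def mult.assoc)
  also have "\<dots> = 1" unfolding hop_mult_hop_t inv_sqrt_commute_defect(2) using inv_sqrt_square_inverse[of F] by (simp add: mult.assoc)
  finally show ?thesis .
qed

text \<open>A one-sided inverse is not enough in infinite dimensions; here \<open>polar\<close> is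
  close to 1, hence invertible, and its right inverse is the inverse.\<close>

lemma polar_t_mult_polar: "polar_t l F * polar l F = 1"
proof -
  define X where "X = polar l F - 1"
  let ?g = "power_sum (\<lambda>k. (-1) ^ k) X"
  have X: "norm X < 1" using norm_polar_diff_one(1)[of F] by (simp add: X_def)
  have "(1 + 1 *\<^sub>R X) * ?g = 1" by (rule power_sum_geometric) (use X in auto)
  moreover have "X * ?g = ?g * X" by (rule power_sum_commute[OF _ X]) auto
  ultimately have inv: "?g * polar l F = 1" by (simp add: X_def algebra_simps)
  have "polar_t l F = ?g * polar l F * polar_t l F" using inv by simp
  also have "\<dots> = ?g" using polar_mult_polar_t[of F] by (simp add: mult.assoc)
  finally show ?thesis using inv by simp
qed

section \<open>Transposes in finite volume\<close>

lemma transposes_shift: "transposes F (up F) (down F)" "transposes F (down F) (up F)"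
  by (auto simp: transposes_def preserves_support_def up_def down_def entry_def)

lemma transposes_polar_ops:
  assumes "finite F"
  shows "transposes F (hop l F) (hop_t l F)" "transposes F (hop_t l F) (hop l F)" "transposes F (hop_defect l F) (hop_defect l F)" "transposes F (inv_sqrt l F) (inv_sqrt l F)"
    "transposes F (polar l F) (polar_t l F)" "transposes F (modulus l F) (modulus l F)"
proof -
  show 1: "transposes F (hop l F) (hop_t l F)" "transposes F (hop_t l F) (hop l F)" unfolding hop_def hop_t_def by (intro transposes_intros transposes_shift)+
  show 2: "transposes F (hop_defect l F) (hop_defect l F)" unfolding hop_defect_def by (intro transposes_intros transposes_mult assms 1)
  show 3: "transposes F (inv_sqrt l F) (inv_sqrt l F)" unfolding inv_sqrt_def
    by (rule transposes_power_sum[of inv_sqrt_coeff "3/100"]) (use norm_hop_defect inv_sqrt_coeff_bound 2 assms in auto)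
  show "transposes F (polar l F) (polar_t l F)" unfolding polar_def polar_t_def by (intro transposes_mult assms 1 3)
  have "transposes F ((1 + hop_defect l F) * inv_sqrt l F) (inv_sqrt l F * (1 + hop_defect l F))" by (intro transposes_mult transposes_intros assms 2 3)
  thus "transposes F (modulus l F) (modulus l F)" by (simp add: modulus_def inv_sqrt_commute_defect)
qed

text \<open>In a finite set transposition turns G into its inverse and commutes with the Cayley
  transform, whose sign flips under inversion.\<close>

lemma cayley_polar_antisym_finite:
  assumes "finite F" "i \<in> F" "j \<in> F"
  shows "entry (cayley (polar l F - 1)) i j = - entry (cayley (polar l F - 1)) j i"
proof -
  have "transposes F (cayley (polar l F - 1)) (cayley (polar_t l F - 1))"
    by (rule transposes_cayley[OF norm_polar_diff_one]) (use assms in \<open>auto intro: transposes_intros transposes_polar_ops\<close>)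
  hence "entry (cayley (polar l F - 1)) i j = entry (cayley (polar_t l F - 1)) j i" using assms unfolding transposes_def by blast
  moreover have "cayley (polar_t l F - 1) = - cayley (polar l F - 1)"
    by (rule cayley_antisym) (use norm_polar_diff_one[of F] polar_t_mult_polar[of F] in auto)
  ultimately show ?thesis by simp
qed

section \<open>Infinite-volume limits\<close>

lemma row_tendsto_shift: "row_tendsto (\<lambda>n. up (box n)) (up UNIV)" "row_tendsto (\<lambda>n. down (box n)) (down UNIV)"
  unfolding row_tendsto_def
proof safe
  fix i
  \<comment> \<open>Each row is eventually exact, once the box contains the site and its
    neighbour.\<close>
  have "\<forall>\<^sub>F n in sequentially. row_op i * up (box n) = row_op i * up UNIV"
    using eventually_ge_at_top[of "nat (\<bar>i\<bar> + 1)"] by eventually_elim (auto intro!: op_eqI simp: box_def up_def)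
  thus "(\<lambda>n. row_op i * up (box n)) \<longlonglongrightarrow> row_op i * up UNIV" by (rule tendsto_eventually)
  have "\<forall>\<^sub>F n in sequentially. row_op i * down (box n) = row_op i * down UNIV"
    using eventually_ge_at_top[of "nat (\<bar>i\<bar> + 1)"] by eventually_elim (auto intro!: op_eqI simp: box_def down_def)
  thus "(\<lambda>n. row_op i * down (box n)) \<longlonglongrightarrow> row_op i * down UNIV" by (rule tendsto_eventually)
qed

lemma row_tight_polar_ops: "row_tight (hop l F)" "row_tight (hop_t l F)" "row_tight (hop_defect l F)" "row_tight (inv_sqrt l F)" "row_tight (polar l F)"
proof -
  show 1: "row_tight (hop l F)" "row_tight (hop_t l F)" unfolding hop_def hop_t_def up_def down_def by (intro row_tight_diff row_tight_scaleR row_tight_one row_tight_comp_op)+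
  show 2: "row_tight (hop_defect l F)" unfolding hop_defect_def by (intro row_tight_diff row_tight_mult row_tight_one 1)
  show 3: "row_tight (inv_sqrt l F)" unfolding inv_sqrt_def by (rule row_tight_power_sum[of inv_sqrt_coeff "3/100"]) (use norm_hop_defect inv_sqrt_coeff_bound 2 in auto)
  show "row_tight (polar l F)" unfolding polar_def by (intro row_tight_mult 1 3)
qed

lemma row_tendsto_polar: "row_tendsto (\<lambda>n. polar l (box n)) (polar l UNIV)"
proof -
  have 1: "row_tendsto (\<lambda>n. hop l (box n)) (hop l UNIV)" "row_tendsto (\<lambda>n. hop_t l (box n)) (hop_t l UNIV)"
    unfolding hop_def hop_t_def by (intro row_tendsto_diff row_tendsto_scaleR row_tendsto_shift row_tendsto_const)+
  have 2: "row_tendsto (\<lambda>n. hop_defect l (box n)) (hop_defect l UNIV)"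
    unfolding hop_defect_def by (intro row_tendsto_diff row_tendsto_const row_tendsto_mult[OF 1 norm_hop(2)] row_tight_polar_ops)
  have 3: "row_tendsto (\<lambda>n. inv_sqrt l (box n)) (inv_sqrt l UNIV)"
    unfolding inv_sqrt_def by (rule row_tendsto_power_sum[OF inv_sqrt_coeff_bound _ 2 norm_hop_defect]) (auto intro: row_tight_polar_ops)
  show ?thesis unfolding polar_def by (intro row_tendsto_mult[OF 3 1(1) norm_hop(1)] row_tight_polar_ops)
qed

abbreviation "polar_inf \<equiv> polar l UNIV"
abbreviation "cayley_inf \<equiv> cayley (polar_inf - 1)"

text \<open>\<open>transposes\<close> is exploited only on finite sets, so this is the entrywise
  limit of the statement for boxes.\<close>

lemma cayley_inf_antisym: "entry cayley_inf i j = - entry cayley_inf j i"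
proof (rule LIMSEQ_unique)
  have c: "row_tendsto (\<lambda>n. cayley (polar l (box n) - 1)) cayley_inf"
    by (rule row_tendsto_cayley[OF row_tendsto_diff[OF row_tendsto_polar row_tendsto_const] norm_polar_diff_one(1)]) (auto intro: row_tight_polar_ops row_tight_diff)
  show "(\<lambda>n. entry (cayley (polar l (box n) - 1)) i j) \<longlonglongrightarrow> entry cayley_inf i j" by (rule row_tendsto_entry[OF c])
  have "(\<lambda>n. - entry (cayley (polar l (box n) - 1)) j i) \<longlonglongrightarrow> - entry cayley_inf j i" by (intro tendsto_minus row_tendsto_entry[OF c])
  moreover have "\<forall>\<^sub>F n in sequentially. entry (cayley (polar l (box n) - 1)) i j = - entry (cayley (polar l (box n) - 1)) j i"
    using eventually_ge_at_top[of "nat (max \<bar>i\<bar> \<bar>j\<bar>)"]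
    by eventually_elim (rule cayley_polar_antisym_finite, auto simp: box_def)
  ultimately show "(\<lambda>n. entry (cayley (polar l (box n) - 1)) i j) \<longlonglongrightarrow> - entry cayley_inf j i"
    by (simp add: tendsto_cong)
qed

text \<open>The compression of the infinite-volume G - 1, as needed for marginals of the limit
  measure. It differs from \<open>polar l (box M) - 1\<close>: orthogonality of G is lost, and its
  Cayley transform is antisymmetric only in the limit of large M.\<close>

definition trunc :: "nat \<Rightarrow> op" where "trunc M = proj_op (box M) * (polar_inf - 1) * proj_op (box M)"

lemma norm_trunc: "norm (trunc M) \<le> 6/100"
proof -
  have "norm (proj_op (box M) * (polar_inf - 1) * proj_op (box M)) \<le> norm (polar_inf - 1)"
    by (rule order_trans[OF norm_mult_le2[OF norm_proj_op] norm_mult_le1[OF norm_proj_op]])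
  thus ?thesis using norm_polar_diff_one(1)[of UNIV] by (simp add: trunc_def)
qed

lemma preserves_support_trunc: "preserves_support (box M) (trunc M)"
  by (auto simp: preserves_support_def trunc_def)

lemma entry_trunc: 
  assumes "i \<in> box M" "j \<in> box M" shows "entry (trunc M) i j = entry polar_inf i j - (if i = j then 1 else 0)"
proof -
  have "app (proj_op (box M)) (basis_seq j) = basis_seq j" using assms by (intro bcontfun_eqI) auto
  thus ?thesis using assms by (auto simp: entry_def trunc_def)
qed

lemma cayley_trunc_lim: "(\<lambda>M. entry (cayley (trunc M)) i j) \<longlonglongrightarrow> entry cayley_inf i j"
proof (rule row_tendsto_entry, rule row_tendsto_cayley[OF _ norm_trunc])
  have L: "row_tight (polar_inf - 1)" by (intro row_tight_diff row_tight_one row_tight_polar_ops)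
  have "row_tendsto (\<lambda>M. (proj_op (box M)) * ((polar_inf - 1) * proj_op (box M))) (1 * (polar_inf - 1))"
    by (rule row_tendsto_mult[OF row_tendsto_proj _ norm_mult_le2[OF norm_proj_op] row_tight_one]) (use L in \<open>simp add: row_tight_def\<close>)
  thus "row_tendsto trunc (polar_inf - 1)" by (simp add: trunc_def[abs_def] mult.assoc)
  show "row_tight (polar_inf - 1)" by (rule L)
qed auto

end

section \<open>Nonsingular principal minors\<close>

lemma app_shift [simp]: "apply_bcontfun (app (shift k) v) i = v (i - k)"
  by (simp add: shift_def)

lemma shift_mult: "shift j * shift k = shift (j + k)"
  by (rule op_eqI) (simp add: algebra_simps)

lemma up_UNIV: "up UNIV = shift 1" and down_UNIV: "down UNIV = shift (-1)"
  by (auto intro!: op_eqI simp: up_def down_def)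

lemma commute_sum:
  fixes X :: "'a::ring"
  assumes "\<And>j. X * f j = f j * X" shows "X * (\<Sum>j\<in>F. f j) = (\<Sum>j\<in>F. f j) * X"
  by (simp add: sum_distrib_left sum_distrib_right assms)

text \<open>Leading coefficient and degree bound for the square of a Laurent polynomial.\<close>

lemma conv_top:
  fixes v :: "int \<Rightarrow> real"
  assumes "finite F" "p \<in> F" "\<And>j. j > p \<Longrightarrow> v j = 0"
  shows "(\<Sum>j\<in>F. v j * v (2 * p - j)) = v p * v p" "i > 2 * p \<Longrightarrow> (\<Sum>j\<in>F. v j * v (i - j)) = 0"
proof -
  have "(\<Sum>j\<in>F. v j * v (2 * p - j)) = (\<Sum>j\<in>F. if j = p then v p * v p else 0)"
  proof (rule sum.cong[OF refl])
    fix j show "v j * v (2 * p - j) = (if j = p then v p * v p else 0)"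
      using assms(3)[of j] assms(3)[of "2 * p - j"] by (cases "j = p"; cases "j > p") auto
  qed
  thus "(\<Sum>j\<in>F. v j * v (2 * p - j)) = v p * v p" using assms by simp
  assume i: "i > 2 * p"
  show "(\<Sum>j\<in>F. v j * v (i - j)) = 0"
  proof (rule sum.neutral, rule ballI)
    fix j show "v j * v (i - j) = 0" using assms(3)[of j] assms(3)[of "i - j"] i by (cases "j > p") auto
  qed
qed

context
  fixes l :: real
  assumes l: "\<bar>l\<bar> \<le> 1/100"
begin

text \<open>Translation invariance, which a box breaks at its ends; this is why the polynomial
  argument is made on the whole line.\<close>

lemma shift_commutes:
  shows "shift k * hop l UNIV = hop l UNIV * shift k" "shift k * hop_t l UNIV = hop_t l UNIV * shift k"
    "shift k * inv_sqrt l UNIV = inv_sqrt l UNIV * shift k" "shift k * polar l UNIV = polar l UNIV * shift k"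
proof -
  show 1: "shift k * hop l UNIV = hop l UNIV * shift k" "shift k * hop_t l UNIV = hop_t l UNIV * shift k" for k
    by (auto simp: hop_def hop_t_def up_UNIV down_UNIV algebra_simps shift_mult)
  have "shift k * hop_defect l UNIV = hop_defect l UNIV * shift k" for k
    unfolding hop_defect_def by (simp add: left_diff_distrib right_diff_distrib) (metis 1 mult.assoc)
  thus 2: "shift k * inv_sqrt l UNIV = inv_sqrt l UNIV * shift k" for k by (rule inv_sqrt_commute[OF l])
  show "shift k * polar l UNIV = polar l UNIV * shift k" unfolding polar_def by (metis 1 2 mult.assoc)
qed

text \<open>Here B, its transpose and R = (B B^T)^(-1/2) all commute, so B^T G^2 = R^2 (B B^T) B =
  B. Squaring removes the square root from the symbol of G.\<close>

lemma hop_t_polar_polar: "hop_t l UNIV * (polar l UNIV * polar l UNIV) = hop l UNIV"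
proof -
  let ?B = "hop l UNIV" and ?C = "hop_t l UNIV" and ?R = "inv_sqrt l UNIV"
  have RB: "?B * ?R = ?R * ?B" "?C * ?R = ?R * ?C"
    unfolding hop_def hop_t_def up_UNIV down_UNIV by (auto simp: left_diff_distrib right_diff_distrib shift_commutes)
  have CB: "?C * ?B = ?B * ?C"
    by (simp add: hop_def hop_t_def up_UNIV down_UNIV algebra_simps shift_mult)
  have "?C * (polar l UNIV * polar l UNIV) = ?C * ?R * (?B * ?R) * ?B" by (simp add: polar_def mult.assoc)
  also have "\<dots> = (?R * ?C) * (?R * ?B) * ?B" by (simp only: RB)
  also have "\<dots> = ?R * (?C * ?R) * ?B * ?B" by (simp only: mult.assoc)
  also have "\<dots> = ?R * (?R * ?C) * ?B * ?B" by (simp only: RB(2))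
  also have "\<dots> = ?R * ?R * (?C * ?B) * ?B" by (simp only: mult.assoc)
  also have "\<dots> = ?R * ?R * (1 + hop_defect l UNIV) * ?B" unfolding CB hop_mult_hop_t[OF l] ..
  finally show ?thesis using inv_sqrt_square_inverse[OF l] by simp
qed

text \<open>The self-convolutions of v and w = G v are related by G^2 alone, hence by the polynomial
  identity \<open>key\<close>, in which top degrees can be compared.\<close>

lemma finite_support_polar:
  assumes l0: "l \<noteq> 0" and fv: "finite {i. apply_bcontfun v i \<noteq> 0}" and fw: "finite {i. apply_bcontfun (app (polar l UNIV) v) i \<noteq> 0}"
  shows "v = 0"
proof (rule ccontr)
  assume "v \<noteq> 0"
  let ?G = "polar l UNIV"
  define w where "w = app ?G v"
  define F where "F = {i. apply_bcontfun v i \<noteq> 0}"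
  define H where "H = {i. apply_bcontfun w i \<noteq> 0}"
  have fin: "finite F" "finite H" using fv fw by (auto simp: F_def H_def w_def)
  have F0: "F \<noteq> {}" using \<open>v \<noteq> 0\<close> by (auto simp: F_def intro!: bcontfun_eqI)
  \<comment> \<open>The Laurent polynomials of \<open>v\<close> and \<open>w\<close> as operators:
    they create these vectors from \<open>basis_seq 0\<close> and act by convolution. They commute
    with each other and with G.\<close>
  define V where "V = (\<Sum>j\<in>F. apply_bcontfun v j *\<^sub>R shift j)"
  define W where "W = (\<Sum>j\<in>H. apply_bcontfun w j *\<^sub>R shift j)"
  have app_sum': "apply_bcontfun (app (\<Sum>j\<in>S. f j) u) i = (\<Sum>j\<in>S. app (f j) u i)" for f :: "int \<Rightarrow> op" and S u i
    by (induction S rule: infinite_finite_induct) auto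
  have ve: "v = app V (basis_seq 0)" using fin
    by (intro bcontfun_eqI) (auto simp: V_def app_sum' F_def if_distrib cong: if_cong)
  have we: "w = app W (basis_seq 0)" using fin
    by (intro bcontfun_eqI) (auto simp: W_def app_sum' H_def if_distrib cong: if_cong)
  have c1: "X * V = V * X" if "\<And>j. X * shift j = shift j * X" for X unfolding V_def by (rule commute_sum) (simp add: that)
  have c2: "X * W = W * X" if "\<And>j. X * shift j = shift j * X" for X unfolding W_def by (rule commute_sum) (simp add: that)
  have sV: "V * shift j = shift j * V" for j by (rule c1[symmetric]) (simp add: shift_mult add.commute)
  have VW: "V * W = W * V" by (rule c2[OF sV])
  have GV: "?G * V = V * ?G" and GW: "?G * W = W * ?G" by (rule c1 c2, simp add: shift_commutes)+
  \<comment> \<open>\<open>app W w\<close> is w convolved with itself; each factor w contributes one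
    G, and commuting collects them into G^2 acting on v convolved with itself.\<close>
  have "app W w = app (W * ?G * V) (basis_seq 0)" by (simp add: w_def ve[symmetric])
  also have "W * ?G * V = V * ?G * W" by (metis GV GW VW mult.assoc)
  also have "app (V * ?G * W) (basis_seq 0) = app (V * ?G * ?G * V) (basis_seq 0)" by (simp add: we[symmetric] ve[symmetric]) (simp add: w_def)
  also have "V * ?G * ?G * V = ?G * ?G * V * V" by (metis GV mult.assoc)
  also have "app (?G * ?G * V * V) (basis_seq 0) = app (?G * ?G) (app V v)" by (simp add: ve[symmetric])
  finally have "app (hop_t l UNIV) (app W w) = app (hop_t l UNIV * (?G * ?G)) (app V v)" by simp
  hence key: "app (hop_t l UNIV) (app W w) = app (hop l UNIV) (app V v)" unfolding hop_t_polar_polar .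
  define cv where "cv = (\<lambda>i. \<Sum>j\<in>F. v j * v (i - j))"
  define cw where "cw = (\<lambda>i. \<Sum>j\<in>H. w j * w (i - j))"
  have key': "cw i - l * cw (i + 1) = cv i - l * cv (i - 1)" for i
    using arg_cong[OF key, of "\<lambda>u. apply_bcontfun u i"]
    by (simp add: hop_t_def hop_def up_UNIV down_UNIV V_def W_def app_sum' cv_def cw_def)
  define p where "p = Max F"
  have nF: "j \<notin> F" if "j > p" for j using Max_ge[OF fin(1), of j] that unfolding p_def by linarith
  have pF: "p \<in> F" unfolding p_def by (rule Max_in[OF fin(1) F0])
  have p0: "v j = 0" if "j > p" for j using nF[OF that] unfolding F_def by simp
  note p = pF p0
  have vp: "v p \<noteq> 0" using p by (simp add: F_def)
  have cvp: "cv (2 * p) = v p * v p" "i > 2 * p \<Longrightarrow> cv i = 0" for i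
    unfolding cv_def using conv_top(1)[of F p "apply_bcontfun v", OF fin(1) p] conv_top(2)[of F p "apply_bcontfun v" i, OF fin(1) p] by auto
  show False
  proof (cases "H = {}")
    case True
    hence "cw i = 0" for i by (simp add: cw_def)
    thus False using key'[of "2 * p + 1"] cvp(1) cvp(2)[of "2 * p + 1"] vp l0 by simp
  next
    case False
    define q where "q = Max H"
    have nH: "j \<notin> H" if "j > q" for j using Max_ge[OF fin(2), of j] that unfolding q_def by linarith
    have qH: "q \<in> H" unfolding q_def by (rule Max_in[OF fin(2) False])
    have q0: "w j = 0" if "j > q" for j using nH[OF that] unfolding H_def by simp
    note q = qH q0
    have wq: "w q \<noteq> 0" using q by (simp add: H_def)
    have cwq: "cw (2 * q) = w q * w q" "i > 2 * q \<Longrightarrow> cw i = 0" for i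
      unfolding cw_def using conv_top(1)[of H q "apply_bcontfun w", OF fin(2) q] conv_top(2)[of H q "apply_bcontfun w" i, OF fin(2) q] by auto
    \<comment> \<open>The left side of \<open>key'\<close> ends at index 2q, the right side at 2p +
      1. If q <= p, index 2p + 1 leaves only -l (v p)^2; otherwise index 2q leaves only (w
      q)^2.\<close>
    show False
    proof (cases "q \<le> p")
      case True
      thus False using key'[of "2 * p + 1"] cvp(1) cvp(2)[of "2 * p + 1"] cwq(2)[of "2 * p + 1"] cwq(2)[of "2 * p + 1 + 1"] vp l0 by simp
    next
      case False
      thus False using key'[of "2 * q"] cvp(2)[of "2 * q"] cvp(2)[of "2 * q - 1"] cwq(1) cwq(2)[of "2 * q + 1"] wq by simp
    qed
  qed
qed

text \<open>For u = v + A v the Cayley relation reads G u = v - A v. Both are finitely supported, so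
  u = 0, then v - A v = 0, and their sum 2v is 0.\<close>

lemma finite_support_cayley:
  assumes l0: "l \<noteq> 0" and U: "finite U" and Fb: "finite Fb"
    and z: "\<And>i. i \<notin> Fb \<Longrightarrow> (\<Sum>j\<in>U. entry (cayley (polar l UNIV - 1)) i j * x j) = 0" and j: "j \<in> U"
  shows "x j = 0"
proof -
  let ?X = "polar l UNIV - 1"
  let ?A = "cayley ?X"
  have nX: "norm ?X < 1" using norm_polar_diff_one(1)[OF l, of UNIV] by linarith
  define v where "v = (\<Sum>k\<in>U. x k *\<^sub>R basis_seq k)"
  have v: "apply_bcontfun v k = (if k \<in> U then x k else 0)" for k
    using U by (auto simp: v_def apply_bcontfun_sum if_distrib sum.delta cong: if_cong)
  have Av: "apply_bcontfun (app ?A v) i = (\<Sum>j\<in>U. entry ?A i j * x j)" for i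
    using U by (subst app_finite_support[of U]) (auto simp: v)
  define u where "u = v + app ?A v"
  have s: "apply_bcontfun v i = 0 \<and> apply_bcontfun (app ?A v) i = 0" if "i \<notin> U \<union> Fb" for i
    using that z by (simp add: v Av)
  have "app ((2 + ?X) * ?A) v = app (- ?X) v" by (simp only: cayley_eq(1)[OF nX])
  hence "2 *\<^sub>R app ?A v + app ?X (app ?A v) = - app ?X v" by (simp add: distrib_right scaleR_2 mult_2)
  hence Gu: "app (polar l UNIV) u = v - app ?A v" by (simp add: u_def scaleR_2 algebra_simps)
  have "apply_bcontfun u i = 0" "apply_bcontfun (app (polar l UNIV) u) i = 0" if "i \<notin> U \<union> Fb" for i
    using s[OF that] unfolding Gu by (simp_all add: u_def)
  hence "{i. apply_bcontfun u i \<noteq> 0} \<subseteq> U \<union> Fb" "{i. apply_bcontfun (app (polar l UNIV) u) i \<noteq> 0} \<subseteq> U \<union> Fb" by blast+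
  hence "u = 0" using finite_support_polar[OF l0, of u] U Fb by (meson finite_UnI finite_subset)
  hence "v + app ?A v = 0" "v - app ?A v = 0" using Gu by (auto simp: u_def)
  hence "v + v = 0" by (metis add.right_neutral diff_add_cancel eq_iff_diff_eq_0)
  hence "v = 0" by (metis scaleR_2 scaleR_eq_0_iff zero_neq_numeral)
  thus ?thesis using v[of j] j by simp
qed

end

section \<open>Principal minors of antisymmetric matrices\<close>

definition nonsingular_on :: "(int \<Rightarrow> int \<Rightarrow> real) \<Rightarrow> int set \<Rightarrow> bool" where
  "nonsingular_on A B \<longleftrightarrow> (\<forall>x. (\<forall>i\<in>B. (\<Sum>j\<in>B. A i j * x j) = 0) \<longrightarrow> (\<forall>j\<in>B. x j = 0))"

definition minor_mat :: "(int \<Rightarrow> int \<Rightarrow> real) \<Rightarrow> int list \<Rightarrow> real mat" where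
  "minor_mat A xs = mat (length xs) (length xs) (\<lambda>(a, b). A (xs ! a) (xs ! b))"

lemma minor_mat_carrier [simp]: "minor_mat A xs \<in> carrier_mat (length xs) (length xs)"
  by (simp add: minor_mat_def)

lemma sum_set_nth: "distinct xs \<Longrightarrow> (\<Sum>j\<in>set xs. f j) = (\<Sum>b<length xs. f (xs ! b))"
  by (rule sum.reindex_bij_betw[symmetric], rule bij_betw_nth) auto

lemma minor_mat_mult_vec:
  assumes "distinct xs" "a < length xs"
  shows "(minor_mat A xs *\<^sub>v vec (length xs) (\<lambda>b. x (xs ! b))) $ a = (\<Sum>j\<in>set xs. A (xs ! a) j * x j)"
  using assms by (simp add: minor_mat_def scalar_prod_def sum_set_nth atLeast0LessThan)

lemma vec_as_fun:
  assumes "distinct xs" "v \<in> carrier_vec (length xs)"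
  obtains x where "v = vec (length xs) (\<lambda>b. x (xs ! b :: int))"
proof
  show "v = vec (length xs) (\<lambda>b. (\<lambda>i. v $ (the_inv_into {..<length xs} ((!) xs) i)) (xs ! b))"
    using assms by (intro eq_vecI) (auto simp: the_inv_into_f_f inj_on_nth)
qed

text \<open>The kernel form refers to no order of the sites and suits sets that grow; the
  determinant form is what the probability formula supplies.\<close>

lemma nonsingular_on_det:
  assumes "distinct xs" shows "nonsingular_on A (set xs) \<longleftrightarrow> det (minor_mat A xs) \<noteq> 0"
proof
  assume n: "nonsingular_on A (set xs)"
  show "det (minor_mat A xs) \<noteq> 0"
  proof
    assume "det (minor_mat A xs) = 0"
    then obtain v where v: "v \<in> carrier_vec (length xs)" "v \<noteq> 0\<^sub>v (length xs)" "minor_mat A xs *\<^sub>v v = 0\<^sub>v (length xs)"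
      using det_0_iff_vec_prod_zero_field[OF minor_mat_carrier] by blast
    obtain x where x: "v = vec (length xs) (\<lambda>b. x (xs ! b))" using vec_as_fun[OF assms v(1)] by blast
    have "(\<Sum>j\<in>set xs. A i j * x j) = 0" if i: "i \<in> set xs" for i
    proof -
      obtain a where a: "a < length xs" "xs ! a = i" using i by (auto simp: in_set_conv_nth)
      show ?thesis using minor_mat_mult_vec[OF assms a(1), of A x] v(3) a by (simp add: x)
    qed
    hence "\<forall>j\<in>set xs. x j = 0" using n unfolding nonsingular_on_def by blast
    hence "v = 0\<^sub>v (length xs)" unfolding x by (intro eq_vecI) auto
    thus False using v(2) by simp
  qed
next
  assume d: "det (minor_mat A xs) \<noteq> 0"
  show "nonsingular_on A (set xs)" unfolding nonsingular_on_def
  proof (intro allI impI ballI)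
    fix x j assume x: "\<forall>i\<in>set xs. (\<Sum>j\<in>set xs. A i j * x j) = 0" and j: "j \<in> set xs"
    let ?v = "vec (length xs) (\<lambda>b. x (xs ! b))"
    have "minor_mat A xs *\<^sub>v ?v = 0\<^sub>v (length xs)"
    proof (rule eq_vecI)
      fix a assume "a < dim_vec (0\<^sub>v (length xs) :: real vec)"
      hence a: "a < length xs" by simp
      show "(minor_mat A xs *\<^sub>v ?v) $ a = 0\<^sub>v (length xs) $ a"
        unfolding minor_mat_mult_vec[OF assms a] using x a by simp
    qed (simp add: minor_mat_def)
    hence "?v = 0\<^sub>v (length xs)" using d det_0_iff_vec_prod_zero_field[OF minor_mat_carrier, of A xs] vec_carrier by blast
    moreover obtain b where b: "b < length xs" "xs ! b = j" using j by (auto simp: in_set_conv_nth)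
    ultimately show "x j = 0" by (metis index_vec index_zero_vec(1))
  qed
qed

lemma nonsingular_on_solve:
  assumes "finite B" "nonsingular_on A B" shows "\<exists>y. \<forall>i\<in>B. (\<Sum>j\<in>B. A i j * y j) = c i"
proof -
  obtain xs where xs: "distinct xs" "set xs = B" using finite_distinct_list[OF assms(1)] by blast
  let ?n = "length xs"
  have "det (minor_mat A xs) \<noteq> 0" using nonsingular_on_det[OF xs(1)] xs(2) assms(2) by simp
  then obtain C where C: "C \<in> carrier_mat ?n ?n" "minor_mat A xs * C = 1\<^sub>m ?n"
    using det_non_zero_imp_unit[OF minor_mat_carrier, of A xs "()"] unfolding Units_def ring_mat_def by auto
  define w where "w = vec ?n (\<lambda>a. c (xs ! a))"
  have cw: "C *\<^sub>v w \<in> carrier_vec ?n" using C by (simp add: w_def)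
  obtain y where y: "C *\<^sub>v w = vec ?n (\<lambda>b. y (xs ! b))" using vec_as_fun[OF xs(1) cw] by blast
  have "minor_mat A xs *\<^sub>v (C *\<^sub>v w) = (minor_mat A xs * C) *\<^sub>v w"
    by (rule assoc_mult_mat_vec[symmetric, OF minor_mat_carrier C(1)]) (simp add: w_def)
  hence e: "minor_mat A xs *\<^sub>v vec ?n (\<lambda>b. y (xs ! b)) = w" unfolding y C(2) by (simp add: w_def)
  show ?thesis
  proof (rule exI[of _ y], rule ballI)
    fix i assume "i \<in> B"
    then obtain a where a: "a < ?n" "xs ! a = i" using xs(2) by (auto simp: in_set_conv_nth)
    show "(\<Sum>j\<in>B. A i j * y j) = c i" using minor_mat_mult_vec[OF xs(1) a(1), of A y] a xs(2) unfolding e by (simp add: w_def)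
  qed
qed

text \<open>Two sites are added at once because odd principal minors vanish: on
  \<open>insert t B\<close> the vector \<open>x\<close> is a kernel vector, and a site
  \<open>s\<close> whose row does not annihilate it restores nonsingularity.\<close>

lemma nonsingular_on_exchange:
  assumes anti: "\<And>i j. A i j = - A j i" and B: "finite B" "nonsingular_on A B" and st: "t \<notin> B" "s \<notin> insert t B"
    and x: "x t = 1" "\<And>i. i \<in> B \<Longrightarrow> (\<Sum>j\<in>insert t B. A i j * x j) = 0" "(\<Sum>j\<in>insert t B. A s j * x j) \<noteq> 0"
  shows "nonsingular_on A (insert s (insert t B))"
  unfolding nonsingular_on_def
proof (intro allI impI)
  fix z assume z: "\<forall>i\<in>insert s (insert t B). (\<Sum>j\<in>insert s (insert t B). A i j * z j) = 0"
  let ?U = "insert t B"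
  define ax where "ax = (\<lambda>i. \<Sum>j\<in>?U. A i j * x j)"
  have fU: "finite ?U" using B by simp
  have Azz: "A i i = 0" for i using anti[of i i] by simp
  \<comment> \<open>By antisymmetry x^T A x = 0. The rows in \<open>B\<close> annihilate x and
    \<open>x t = 1\<close>, so this quadratic form is just \<open>ax t\<close>.\<close>
  have axt: "ax t = 0"
  proof -
    have "(\<Sum>i\<in>?U. x i * ax i) = (\<Sum>i\<in>?U. \<Sum>j\<in>?U. x i * A i j * x j)" by (simp add: ax_def sum_distrib_left mult_ac)
    also have "\<dots> = (\<Sum>j\<in>?U. \<Sum>i\<in>?U. x i * A i j * x j)" by (rule sum.swap)
    also have "\<dots> = (\<Sum>j\<in>?U. \<Sum>i\<in>?U. - (x j * A j i * x i))"
      by (intro sum.cong refl) (subst anti, simp add: mult_ac)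
    also have "\<dots> = - (\<Sum>i\<in>?U. x i * ax i)" by (simp add: ax_def sum_distrib_left sum_negf mult_ac)
    finally have "(\<Sum>i\<in>?U. x i * ax i) = 0" by simp
    moreover have "(\<Sum>i\<in>?U. x i * ax i) = ax t" using B st x by (simp add: ax_def)
    ultimately show ?thesis by simp
  qed
  have axB: "ax i = 0" if "i \<in> B" for i using x(2) that by (simp add: ax_def)
  \<comment> \<open>Pair the equations for z on \<open>insert t B\<close> with x: antisymmetry moves
    A onto x, and only the term at \<open>s\<close> survives.\<close>
  have "0 = (\<Sum>i\<in>?U. x i * (\<Sum>j\<in>insert s ?U. A i j * z j))"
  proof (rule sum.neutral[symmetric], rule ballI)
    fix i assume "i \<in> ?U"
    hence "(\<Sum>j\<in>insert s ?U. A i j * z j) = 0" using z by blast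
    thus "x i * (\<Sum>j\<in>insert s ?U. A i j * z j) = 0" by (simp only: mult_zero_right)
  qed
  also have "\<dots> = (\<Sum>j\<in>insert s ?U. \<Sum>i\<in>?U. x i * (A i j * z j))"
    unfolding sum_distrib_left by (rule sum.swap)
  also have "\<dots> = (\<Sum>j\<in>insert s ?U. - (ax j * z j))"
  proof (rule sum.cong[OF refl])
    fix j
    have "(\<Sum>i\<in>?U. x i * (A i j * z j)) = (\<Sum>i\<in>?U. - (A j i * x i * z j))" by (intro sum.cong refl) (subst anti, simp)
    thus "(\<Sum>i\<in>?U. x i * (A i j * z j)) = - (ax j * z j)" by (simp only: ax_def sum_negf sum_distrib_right)
  qed
  also have "\<dots> = - (ax s * z s)" using fU st axt axB by simp
  finally have zs: "z s = 0" using x(3) by (simp add: ax_def)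
  have zB: "(\<Sum>j\<in>B. A i j * z j) = - (A i t * z t)" if "i \<in> insert s ?U" for i
    using bspec[OF z that] B st zs by (simp add: add_eq_0_iff)
  have xB: "(\<Sum>j\<in>B. A i j * x j) = ax i - A i t" for i using B st x(1) by (simp add: ax_def)
  \<comment> \<open>On \<open>B\<close> both z and \<open>z t\<close> times x solve the same system,
    whose matrix is nonsingular.\<close>
  have zx: "z j = z t * x j" if "j \<in> B" for j
  proof -
    have ker: "(\<Sum>j\<in>B. A i j * (z j - z t * x j)) = 0" if i: "i \<in> B" for i
    proof -
      have "(\<Sum>j\<in>B. A i j * (z j - z t * x j)) = (\<Sum>j\<in>B. A i j * z j) - z t * (\<Sum>j\<in>B. A i j * x j)"
        by (simp add: right_diff_distrib sum_subtractf sum_distrib_left mult_ac)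
      thus ?thesis using zB[of i] xB[of i] axB[OF i] i by simp
    qed
    have "\<forall>j\<in>B. z j - z t * x j = 0"
      by (rule B(2)[unfolded nonsingular_on_def, THEN spec, of "\<lambda>j. z j - z t * x j", THEN mp]) (rule ballI, rule ker)
    hence "z j - z t * x j = 0" using that by (rule bspec)
    thus ?thesis by simp
  qed
  have "(\<Sum>j\<in>B. A s j * z j) = z t * (\<Sum>j\<in>B. A s j * x j)"
    by (simp add: zx sum_distrib_left mult_ac)
  hence "z t * (\<Sum>j\<in>B. A s j * x j) = - (A s t * z t)" using zB[of s] by simp
  moreover have "ax s = (\<Sum>j\<in>B. A s j * x j) + A s t" using xB[of s] by simp
  ultimately have "z t * ax s = 0" by (simp only: distrib_left) simp
  hence zt: "z t = 0" using x(3) by (simp add: ax_def)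
  show "\<forall>j\<in>insert s ?U. z j = 0" using zs zt zx by auto
qed

text \<open>Each exchange moves one further site of \<open>T\<close> into \<open>B\<close>; its
  partner must stay off \<open>Fb\<close>, and \<open>inj\<close> provides one. k counts the
  exchanges, so card T of them suffice.\<close>

lemma nonsingular_on_extend:
  assumes anti: "\<And>i j. A i j = - A j i"
    and inj: "\<And>U x Fb j. finite U \<Longrightarrow> finite Fb \<Longrightarrow> (\<And>i. i \<notin> Fb \<Longrightarrow> (\<Sum>j\<in>U. A i j * x j) = 0) \<Longrightarrow> j \<in> U \<Longrightarrow> x j = 0"
    and T: "finite T" and Fb: "finite Fb" "T \<inter> Fb = {}"
  shows "\<exists>B. finite B \<and> T \<subseteq> B \<and> B \<inter> Fb = {} \<and> nonsingular_on A B"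
proof -
  have step: "\<exists>B. finite B \<and> card (T - B) \<le> card T - k \<and> B \<inter> Fb = {} \<and> nonsingular_on A B" for k
  proof (induction k)
    case 0
    show ?case by (rule exI[of _ "{}"]) (simp add: nonsingular_on_def)
  next
    case (Suc k)
    then obtain B where B: "finite B" "card (T - B) \<le> card T - k" "B \<inter> Fb = {}" "nonsingular_on A B" by blast
    show ?case
    proof (cases "T \<subseteq> B")
      case True
      hence "card (T - B) = 0" by (simp add: Diff_eq_empty_iff[THEN iffD2])
      thus ?thesis using B(1,3,4) by (intro exI[of _ B] conjI) (assumption | linarith)+
    next
      case False
      then obtain t where t: "t \<in> T" "t \<notin> B" by blast
      \<comment> \<open>y cancels column \<open>t\<close> on \<open>B\<close>, so y extended by 1 at
        \<open>t\<close> is annihilated by all rows in \<open>B\<close>.\<close>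
      obtain y where y0: "\<forall>i\<in>B. (\<Sum>j\<in>B. A i j * y j) = - A i t"
        using nonsingular_on_solve[OF B(1,4), of "\<lambda>i. - A i t"] ..
      have y: "(\<Sum>j\<in>B. A i j * y j) = - A i t" if "i \<in> B" for i using y0 that by (rule bspec)
      define x where "x = y(t := 1)"
      have xU: "(\<Sum>j\<in>insert t B. A i j * x j) = A i t + (\<Sum>j\<in>B. A i j * y j)" for i
      proof -
        have "(\<Sum>j\<in>B. A i j * x j) = (\<Sum>j\<in>B. A i j * y j)" by (rule sum.cong) (use t in \<open>auto simp: x_def\<close>)
        thus ?thesis using B(1) t by (simp add: x_def)
      qed
      \<comment> \<open>Otherwise the image of x would be supported in the finite set
        \<open>Fb \<union> {t}\<close>. The site found is outside \<open>B\<close> too, since rows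
        in \<open>B\<close> annihilate x.\<close>
      have "\<exists>i. i \<notin> Fb \<union> {t} \<and> (\<Sum>j\<in>insert t B. A i j * x j) \<noteq> 0"
      proof (rule ccontr)
        assume "\<not> ?thesis"
        hence "x t = 0" using inj[of "insert t B" "Fb \<union> {t}" x t] B(1) Fb(1) by blast
        thus False by (simp add: x_def)
      qed
      then obtain s where s: "s \<notin> Fb" "s \<noteq> t" "(\<Sum>j\<in>insert t B. A s j * x j) \<noteq> 0" by blast
      have sB: "s \<notin> B" using s(3) xU[of s] y by auto
      have "nonsingular_on A (insert s (insert t B))"
        by (rule nonsingular_on_exchange[OF anti B(1,4) t(2), of s x]) (use s sB xU y in \<open>auto simp: x_def\<close>)
      moreover have "card (T - insert s (insert t B)) \<le> card T - Suc k"
      proof -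
        have "T - insert s (insert t B) \<subset> T - B" using t by blast
        hence "card (T - insert s (insert t B)) < card (T - B)" using T by (intro psubset_card_mono) auto
        thus ?thesis using B(2) by linarith
      qed
      moreover have "insert s (insert t B) \<inter> Fb = {}" using B(3) s(1) t(1) Fb(2) by blast
      ultimately show ?thesis using B(1) by (intro exI[of _ "insert s (insert t B)"]) auto
    qed
  qed
  from step[of "card T"] obtain B where B: "finite B" "card (T - B) = 0" "B \<inter> Fb = {}" "nonsingular_on A B" by auto
  hence "T \<subseteq> B" using T by auto
  thus ?thesis using B by blast
qed

lemma det_antisym_odd:
  assumes anti: "\<And>i j. A i j = - A j i" and "odd (length xs)" shows "det (minor_mat A xs) = 0"
proof -
  have "transpose_mat (minor_mat A xs) = (-1) \<cdot>\<^sub>m minor_mat A xs"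
    by (intro eq_matI) (auto simp: minor_mat_def intro: anti)
  hence "det (minor_mat A xs) = det ((-1) \<cdot>\<^sub>m minor_mat A xs)" using det_transpose[OF minor_mat_carrier, of A xs] by simp
  also have "\<dots> = (-1) ^ length xs * det (minor_mat A xs)" by (simp add: minor_mat_def)
  finally show ?thesis using assms(2) by simp
qed

lemma det_tendsto:
  assumes "\<And>a b. a < k \<Longrightarrow> b < k \<Longrightarrow> ((\<lambda>n. f n a b) \<longlongrightarrow> (f0 a b :: real)) F"
  shows "((\<lambda>n. det (mat k k (\<lambda>(a, b). f n a b))) \<longlongrightarrow> det (mat k k (\<lambda>(a, b). f0 a b))) F"
proof -
  have d: "det (mat k k (\<lambda>(a, b). g a b)) = (\<Sum>p\<in>{p. p permutes {0..<k}}. signof p * (\<Prod>i = 0..<k. g i (p i)))" for g :: "nat \<Rightarrow> nat \<Rightarrow> real"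
  proof -
    have "det (mat k k (\<lambda>(a, b). g a b)) = (\<Sum>p\<in>{p. p permutes {0..<k}}. signof p * (\<Prod>i = 0..<k. mat k k (\<lambda>(a, b). g a b) $$ (i, p i)))"
      by (rule det_def') simp
    also have "\<dots> = (\<Sum>p\<in>{p. p permutes {0..<k}}. signof p * (\<Prod>i = 0..<k. g i (p i)))"
      by (intro sum.cong refl arg_cong2[where f="(*)"] prod.cong) (auto dest: permutes_in_image)
    finally show ?thesis .
  qed
  show ?thesis unfolding d
    by (intro tendsto_sum tendsto_mult tendsto_const tendsto_prod assms) (auto dest: permutes_in_image)
qed

section \<open>Finite-volume ground states\<close>

lemma flip_box_configs: "s \<in> box_configs n \<Longrightarrow> i \<in> box n \<Longrightarrow> flip i s \<in> box_configs n"
  by (auto simp: box_configs_def flip_def)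

lemma finite_box_configs: "finite (box_configs n)"
  using bij_betw_finite[OF bij_spin, of n] by simp

text \<open>Gives content to \<open>is_ground_zrestriction\<close>, which quantifies over sequences
  of ground states, and lets the limit inherit positivity, monotonicity and additivity from
  \<open>box_prob\<close>.\<close>

lemma ground_state_exists: "\<exists>psi. ground_state J h n psi"
proof -
  \<comment> \<open>Wave functions have infinitely many arguments, so compactness comes from
    Tychonoff. Setting values off \<open>box_configs n\<close> to 0 changes neither norm nor energy,
    as the flips preserve box configurations; normalisation puts the other values in the unit
    disc.\<close>
  define K where "K = {psi :: (int \<Rightarrow> int) \<Rightarrow> complex. \<forall>s. psi s \<in> (if s \<in> box_configs n then cball 0 1 else {0})}"
  have "compactin (product_topology (\<lambda>_. euclidean) UNIV) (Pi\<^sub>E UNIV (\<lambda>s. if s \<in> box_configs n then cball 0 1 else {0::complex}))"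
    by (subst compactin_PiE) (auto simp: compactin_euclidean_iff)
  moreover have "Pi\<^sub>E UNIV (\<lambda>s. if s \<in> box_configs n then cball 0 1 else {0::complex}) = K"
    unfolding K_def PiE_UNIV_domain Pi_def by simp
  ultimately have "compact K" by (simp add: euclidean_product_topology compactin_euclidean_iff)
  have coord: "continuous_on UNIV (\<lambda>psi. psi s)" for s :: "int \<Rightarrow> int"
    by (rule continuous_on_product_coordinates)
  have "continuous_on UNIV (\<lambda>psi :: (int \<Rightarrow> int) \<Rightarrow> complex. \<Sum>s\<in>box_configs n. (cmod (psi s))\<^sup>2)"
    by (intro continuous_intros coord)
  hence "closed ((\<lambda>psi :: (int \<Rightarrow> int) \<Rightarrow> complex. \<Sum>s\<in>box_configs n. (cmod (psi s))\<^sup>2) -` {1})"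
    by (rule closed_vimage[rotated]) simp
  hence "compact (K \<inter> {psi. normalized n psi})"
    unfolding normalized_def vimage_def using compact_Int_closed[OF \<open>compact K\<close>] by simp
  moreover have "K \<inter> {psi. normalized n psi} \<noteq> {}"
  proof -
    let ?p = "\<lambda>s. if s = (\<lambda>_. 1) then 1 else 0 :: complex"
    have m: "(\<lambda>_. 1) \<in> box_configs n" by (auto simp: box_configs_def)
    have "(\<Sum>s\<in>box_configs n. (cmod (?p s))\<^sup>2) = (\<Sum>s\<in>box_configs n. if s = (\<lambda>_. 1) then 1 else 0)"
      by (intro sum.cong) auto
    hence "normalized n ?p" using m finite_box_configs[of n] by (simp add: normalized_def)
    hence "?p \<in> K \<inter> {psi. normalized n psi}"
      using m by (auto simp: K_def)
    thus ?thesis by blast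
  qed
  moreover have "continuous_on UNIV (energy J h n)"
    unfolding energy_def ising_H_def by (intro continuous_intros coord)
  hence "continuous_on (K \<inter> {psi. normalized n psi}) (energy J h n)" by (rule continuous_on_subset) simp
  ultimately obtain psi where psi: "psi \<in> K" "normalized n psi"
    "\<And>phi. phi \<in> K \<Longrightarrow> normalized n phi \<Longrightarrow> energy J h n psi \<le> energy J h n phi"
    using continuous_attains_inf[of "K \<inter> {psi. normalized n psi}" "energy J h n"] by auto
  have "energy J h n psi \<le> energy J h n phi" if phi: "normalized n phi" for phi
  proof -
    define phi' where "phi' = (\<lambda>s. if s \<in> box_configs n then phi s else 0)"
    have "normalized n phi'" using phi unfolding normalized_def by (simp add: phi'_def)
    moreover have "phi' \<in> K"
    proof -
      have "(cmod (phi s))\<^sup>2 \<le> 1" if s: "s \<in> box_configs n" for s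
        using member_le_sum[OF s, of "\<lambda>s. (cmod (phi s))\<^sup>2"] finite_box_configs[of n] phi by (simp add: normalized_def)
      hence "cmod (phi s) \<le> 1" if "s \<in> box_configs n" for s using that by (simp add: power_le_one_iff abs_square_le_1)
      thus ?thesis by (auto simp: K_def phi'_def)
    qed
    moreover have "energy J h n phi' = energy J h n phi"
    proof -
      have "ising_H J h n phi' s = ising_H J h n phi s" if s: "s \<in> box_configs n" for s
      proof -
        have "phi' (flip i (flip (i + 1) s)) = phi (flip i (flip (i + 1) s))" if "i \<in> {- int n..<int n}" for i
          using that s by (auto simp: phi'_def box_def intro!: flip_box_configs)
        thus ?thesis using s by (simp add: ising_H_def phi'_def)
      qed
      thus ?thesis unfolding energy_def by (intro arg_cong[where f=Re] sum.cong) (auto simp: phi'_def)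
    qed
    ultimately show ?thesis using psi(3)[of phi'] by simp
  qed
  thus ?thesis using psi(2) by (auto simp: ground_state_def)
qed

section \<open>Cylinder probabilities as determinants\<close>

definition prob_mat :: "(int \<Rightarrow> int \<Rightarrow> real) \<Rightarrow> int list \<Rightarrow> (int \<Rightarrow> int) \<Rightarrow> real mat" where
  "prob_mat G xs x = mat (length xs) (length xs)
     (\<lambda>(a, b). ((if a = b then 1 else 0) + G (xs ! a) (xs ! b) * of_int (x (xs ! b))) / 2)"

lemma finite_subset_box: "finite F \<Longrightarrow> \<forall>\<^sub>F n in sequentially. F \<subseteq> box n"
proof (induction F rule: finite_induct)
  case (insert i F)
  have "\<forall>\<^sub>F n in sequentially. i \<in> box n"
    using eventually_ge_at_top[of "nat \<bar>i\<bar>"] by eventually_elim (auto simp: box_def)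
  thus ?case using insert.IH by eventually_elim auto
qed simp

lemma box_prob_pmat:
  assumes h: "h > 0" and l: "\<bar>J / h\<bar> \<le> 1/100" and g: "ground_state J h n psi"
    and xs: "distinct xs" "set xs \<subseteq> box n" and x: "\<And>i. i \<in> set xs \<Longrightarrow> x i \<in> {-1, 1}"
  shows "box_prob n psi (set xs) x = det (prob_mat (entry (polar (J / h) (box n))) xs x)"
  unfolding prob_mat_def
\<comment> \<open>\<open>hopping\<close> is h times \<open>hop\<close>, so P is h times
  \<open>modulus\<close> and the margin p is h, while G does not depend on the scale.\<close>
proof (rule box_prob_det[where p=h and P="\<lambda>i j. h * entry (modulus (J / h) (box n)) i j", OF g])
  let ?l = "J / h" and ?F = "box n"
  have hopping: "hopping J h i j = h * entry (hop ?l ?F) i j" "hopping J h i j = h * entry (hop_t ?l ?F) j i" if "i \<in> ?F" "j \<in> ?F" for i j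
    using h that by (auto simp: hopping_def hop_def hop_t_def up_def down_def entry_def)
  have fl: "preserves_support ?F (polar ?l ?F)" "preserves_support ?F (hop_t ?l ?F)"
    using transposes_polar_ops(5)[OF l finite_box] transposes_polar_ops(2)[OF l finite_box] by (auto simp: transposes_def)
  fix k j assume kj: "k \<in> ?F" "j \<in> ?F"
  show "(\<Sum>i\<in>?F. h * entry (modulus ?l ?F) k i * entry (polar ?l ?F) i j) = hopping J h k j"
  proof -
    have "(\<Sum>i\<in>?F. h * entry (modulus ?l ?F) k i * entry (polar ?l ?F) i j) = h * entry (modulus ?l ?F * polar ?l ?F) k j"
      by (simp add: entry_mult[OF finite_box fl(1) kj(2)] sum_distrib_left mult_ac)
    thus ?thesis using hopping(1)[OF kj] by (simp add: modulus_mult_polar[OF l])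
  qed
  show "(\<Sum>i\<in>?F. entry (polar ?l ?F) k i * hopping J h j i) = h * entry (modulus ?l ?F) k j"
  proof -
    have "(\<Sum>i\<in>?F. entry (polar ?l ?F) k i * hopping J h j i) = (\<Sum>i\<in>?F. h * (entry (polar ?l ?F) k i * entry (hop_t ?l ?F) i j))"
      by (intro sum.cong refl) (simp add: hopping(2) kj)
    also have "\<dots> = h * entry (polar ?l ?F * hop_t ?l ?F) k j"
      by (simp add: entry_mult[OF finite_box fl(2) kj(2)] sum_distrib_left)
    finally show ?thesis by (simp add: polar_mult_hop_t[OF l])
  qed
  show "h * entry (modulus ?l ?F) k j = h * entry (modulus ?l ?F) j k"
    using transposes_polar_ops(6)[OF l finite_box, of n] kj unfolding transposes_def by metis
next
  fix k assume "k \<in> box n"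
  have "(\<Sum>i\<in>box n. \<bar>h * entry (modulus (J / h) (box n)) k i - (if k = i then h else 0)\<bar>)
     = h * (\<Sum>i\<in>box n. \<bar>entry (modulus (J / h) (box n) - 1) k i\<bar>)"
    unfolding sum_distrib_left
  proof (intro sum.cong refl)
    fix i
    have "h * entry (modulus (J / h) (box n)) k i - (if k = i then h else 0) = h * entry (modulus (J / h) (box n) - 1) k i"
      by (simp add: algebra_simps)
    thus "\<bar>h * entry (modulus (J / h) (box n)) k i - (if k = i then h else 0)\<bar> = h * \<bar>entry (modulus (J / h) (box n) - 1) k i\<bar>"
      using h by (simp only: abs_mult abs_of_pos)
  qed
  also have "\<dots> \<le> h * (1/2)"
    by (intro mult_left_mono order_trans[OF sum_abs_entry_le norm_modulus_diff_one[OF l]]) (use h in auto)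
  finally show "(\<Sum>i\<in>box n. \<bar>h * entry (modulus (J / h) (box n)) k i - (if k = i then h else 0)\<bar>) \<le> h / 2" by simp
qed (use assms in auto)

lemma box_prob_lim:
  assumes h: "h > 0" and l: "\<bar>J / h\<bar> \<le> 1/100" and g: "\<And>n. ground_state J h n (psis n)"
    and xs: "distinct xs" and x: "\<And>i. i \<in> set xs \<Longrightarrow> x i \<in> {-1, 1}"
  shows "(\<lambda>n. box_prob n (psis n) (set xs) x) \<longlonglongrightarrow> det (prob_mat (entry (polar (J / h) UNIV)) xs x)"
proof -
  have "(\<lambda>n. det (prob_mat (entry (polar (J / h) (box n))) xs x)) \<longlonglongrightarrow> det (prob_mat (entry (polar (J / h) UNIV)) xs x)"
    unfolding prob_mat_def by (intro det_tendsto tendsto_intros row_tendsto_entry[OF row_tendsto_polar[OF l]]) auto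
  moreover have "\<forall>\<^sub>F n in sequentially. box_prob n (psis n) (set xs) x = det (prob_mat (entry (polar (J / h) (box n))) xs x)"
    using finite_subset_box[OF finite_set, of xs]
  proof eventually_elim
    case (elim n)
    show ?case by (rule box_prob_pmat[OF h l g xs elim x])
  qed
  ultimately show ?thesis by (simp add: tendsto_cong)
qed

lemma box_prob_cong: "(\<And>i. i \<in> L \<Longrightarrow> x i = y i) \<Longrightarrow> box_prob n psi L x = box_prob n psi L y"
  unfolding box_prob_def by (intro sum.cong) auto

lemma box_prob_nonneg: "0 \<le> box_prob n psi L x"
  unfolding box_prob_def by (intro sum_nonneg) auto

lemma box_prob_mono: "L \<subseteq> L' \<Longrightarrow> box_prob n psi L' x \<le> box_prob n psi L x"
  unfolding box_prob_def using finite_box_configs[of n] by (intro sum_mono2) auto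

lemma box_prob_split:
  assumes "i \<in> L" "i \<in> box n" "x i \<in> {-1, 1}"
  shows "box_prob n psi (L - {i}) x = box_prob n psi L x + box_prob n psi L (flip i x)"
proof -
  have "(\<forall>j\<in>L - {i}. s j = x j) \<longleftrightarrow> (\<forall>j\<in>L. s j = x j) \<or> (\<forall>j\<in>L. s j = flip i x j)" if s: "s \<in> box_configs n" for s
  proof -
    have "s i = x i \<or> s i = - x i" using s assms(2,3) by (auto simp: box_configs_def)
    moreover have "(\<forall>j\<in>L. P j) \<longleftrightarrow> P i \<and> (\<forall>j\<in>L - {i}. P j)" for P using assms(1) by blast
    ultimately show ?thesis by (auto simp: flip_def)
  qed
  hence "{s \<in> box_configs n. \<forall>j\<in>L - {i}. s j = x j} =
    {s \<in> box_configs n. \<forall>j\<in>L. s j = x j} \<union> {s \<in> box_configs n. \<forall>j\<in>L. s j = flip i x j}"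
    by blast
  moreover have "{s \<in> box_configs n. \<forall>j\<in>L. s j = x j} \<inter> {s \<in> box_configs n. \<forall>j\<in>L. s j = flip i x j} = {}"
    using assms by (auto simp: flip_def)
  ultimately show ?thesis unfolding box_prob_def using finite_box_configs[of n] by (simp add: sum.union_disjoint)
qed

lemma box_prob_invalid: "i \<in> L \<Longrightarrow> x i \<notin> {-1, 1} \<Longrightarrow> box_prob n psi L x = 0"
proof -
  assume "i \<in> L" "x i \<notin> {-1, 1}"
  hence "{s \<in> box_configs n. \<forall>j\<in>L. s j = x j} = {}" by (auto simp: box_configs_def) metis
  thus ?thesis by (simp only: box_prob_def sum.empty)
qed

section \<open>Ratios to the all-plus configuration\<close>

context
  fixes l :: real
  assumes l: "\<bar>l\<bar> \<le> 1/100"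
begin

lemma entry_2 [simp]: "entry 2 i j = (if i = j then 2 else 0)"
proof -
  have "(2 :: op) = 1 + 1" by simp
  thus ?thesis by (simp only: entry_simps) simp
qed

text \<open>On the box the matrix is half of \<open>2 + trunc l M\<close>, which is invertible by
  its Neumann series.\<close>

lemma det_plus_nonzero:
  assumes xs: "distinct xs" "set xs = box M"
  shows "det (prob_mat (entry (polar l UNIV)) xs (spin {})) \<noteq> 0"
proof -
  let ?X = "trunc l M"
  have nX: "norm ?X < 1" using norm_trunc[OF l, of M] by linarith
  have mem: "xs ! a \<in> box M" if "a < length xs" for a using nth_mem[OF that] xs(2) by simp
  have "prob_mat (entry (polar l UNIV)) xs (spin {}) = minor_mat (\<lambda>i j. entry (2 + ?X) i j / 2) xs"
    unfolding prob_mat_def minor_mat_def using xs(1)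
    by (intro eq_matI) (auto simp: entry_trunc[OF l] mem spin_def nth_eq_iff_index_eq)
  moreover have "nonsingular_on (\<lambda>i j. entry (2 + ?X) i j / 2) (set xs)" unfolding nonsingular_on_def
  proof (intro allI impI ballI)
    fix x j assume x: "\<forall>i\<in>set xs. (\<Sum>j\<in>set xs. entry (2 + ?X) i j / 2 * x j) = 0" and j: "j \<in> set xs"
    define v where "v = (\<Sum>k\<in>set xs. x k *\<^sub>R basis_seq k)"
    have v: "apply_bcontfun v k = (if k \<in> set xs then x k else 0)" for k
      by (auto simp: v_def apply_bcontfun_sum if_distrib sum.delta cong: if_cong)
    have "preserves_support (box M) (1 + 1 + ?X)" by (intro preserves_support_intros preserves_support_trunc[OF l])
    hence fl: "preserves_support (set xs) (2 + ?X)" using xs by simp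
    have "app (2 + ?X) v = 0"
    proof (rule bcontfun_eqI)
      fix i
      show "apply_bcontfun (app (2 + ?X) v) i = apply_bcontfun 0 i"
      proof (cases "i \<in> set xs")
        case True
        have "app (2 + ?X) v i = (\<Sum>j\<in>set xs. entry (2 + ?X) i j * v j)" by (rule app_finite_support) (auto simp: v)
        also have "\<dots> = 2 * (\<Sum>j\<in>set xs. entry (2 + ?X) i j / 2 * x j)" by (simp add: sum_distrib_left v)
        finally show ?thesis using x True by simp
      next
        case False
        thus ?thesis using fl by (simp add: preserves_support_def v)
      qed
    qed
    hence "app ((1/2) *\<^sub>R power_sum (\<lambda>k. (-(1/2)) ^ k) ?X * (2 + ?X)) v = 0" by simp
    hence "v = 0" unfolding cayley_inverse(2)[OF nX] by simp
    thus "x j = 0" using v[of j] j by simp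
  qed
  ultimately show ?thesis using nonsingular_on_det[OF xs(1)] by simp
qed

text \<open>Let G_M = 1 + \<open>trunc l M\<close> with Cayley transform A_M. Making
  \<open>ss\<close> minus replaces the columns of (1 + G_M)/2 at \<open>ss\<close> by those of (1 -
  G_M)/2 = (1 + G_M)/2 A_M. So the new matrix is the old one times D, with columns of A_M at
  \<open>ss\<close> and unit columns elsewhere.\<close>

lemma det_ratio:
  assumes xs: "distinct (ss @ rs)" "set (ss @ rs) = box M"
  shows "det (prob_mat (entry (polar l UNIV)) (ss @ rs) (spin (set ss))) =
    det (prob_mat (entry (polar l UNIV)) (ss @ rs) (spin {})) * det (minor_mat (entry (cayley (trunc l M))) ss)"
proof -
  let ?X = "trunc l M" and ?xs = "ss @ rs"
  let ?A = "cayley ?X" and ?n = "length ss" and ?m = "length rs"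
  let ?G = "prob_mat (entry (polar l UNIV)) ?xs (spin {})"
  have nX: "norm ?X < 1" using norm_trunc[OF l, of M] by linarith
  have mem: "?xs ! a \<in> box M" if "a < ?n + ?m" for a
    using nth_mem[of a ?xs] that unfolding xs(2) by simp
  have eqi: "?xs ! a = ?xs ! b \<longleftrightarrow> a = b" if "a < ?n + ?m" "b < ?n + ?m" for a b
    using nth_eq_iff_index_eq[OF xs(1)] that by simp
  define D where "D = mat (?n + ?m) (?n + ?m) (\<lambda>(a, b). if b < ?n then entry ?A (?xs ! a) (?xs ! b) else if a = b then 1 else 0)"
  have G: "?G \<in> carrier_mat (?n + ?m) (?n + ?m)" by (simp add: prob_mat_def)
  have D: "D \<in> carrier_mat (?n + ?m) (?n + ?m)" by (simp add: D_def)
  have Gab: "?G $$ (a, b) = entry (2 + ?X) (?xs ! a) (?xs ! b) / 2" if "a < ?n + ?m" "b < ?n + ?m" for a b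
    using that by (simp add: prob_mat_def entry_trunc[OF l] mem eqi spin_def)
  have "?G * D = prob_mat (entry (polar l UNIV)) ?xs (spin (set ss))"
  proof (rule eq_matI)
    fix a b assume "a < dim_row (prob_mat (entry (polar l UNIV)) ?xs (spin (set ss)))" "b < dim_col (prob_mat (entry (polar l UNIV)) ?xs (spin (set ss)))"
    hence ab: "a < ?n + ?m" "b < ?n + ?m" by (auto simp: prob_mat_def)
    have GD: "(?G * D) $$ (a, b) = (\<Sum>c<?n + ?m. ?G $$ (a, c) * D $$ (c, b))"
      using ab G D by (simp add: scalar_prod_def atLeast0LessThan)
    show "(?G * D) $$ (a, b) = prob_mat (entry (polar l UNIV)) ?xs (spin (set ss)) $$ (a, b)"
    proof (cases "b < ?n")
      case True
      have "(?G * D) $$ (a, b) = (\<Sum>c<?n + ?m. entry (2 + ?X) (?xs ! a) (?xs ! c) / 2 * entry ?A (?xs ! c) (?xs ! b))"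
        unfolding GD using ab True by (intro sum.cong refl) (simp add: Gab D_def)
      also have "\<dots> = (\<Sum>k\<in>set ?xs. entry (2 + ?X) (?xs ! a) k / 2 * entry ?A k (?xs ! b))"
        using sum_set_nth[OF xs(1), of "\<lambda>k. entry (2 + ?X) (?xs ! a) k / 2 * entry ?A k (?xs ! b)"] by simp
      also have "\<dots> = entry ((2 + ?X) * ?A) (?xs ! a) (?xs ! b) / 2"
        unfolding xs(2) entry_mult[OF finite_box preserves_support_cayley[OF nX preserves_support_trunc[OF l]] mem[OF ab(2)]]
        by (simp add: sum_divide_distrib)
      also have "\<dots> = - entry ?X (?xs ! a) (?xs ! b) / 2" by (simp add: cayley_eq(1)[OF nX])
      also have "\<dots> = prob_mat (entry (polar l UNIV)) ?xs (spin (set ss)) $$ (a, b)"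
      proof -
        have "?xs ! b \<in> set ss" using True by (simp add: nth_append)
        thus ?thesis using ab by (simp add: prob_mat_def entry_trunc[OF l] mem eqi spin_def)
      qed
      finally show ?thesis .
    next
      case False
      have "(?G * D) $$ (a, b) = (\<Sum>c<?n + ?m. if c = b then ?G $$ (a, c) else 0)"
        unfolding GD using ab False by (intro sum.cong refl) (simp add: D_def)
      also have "\<dots> = ?G $$ (a, b)" using ab by simp
      also have "\<dots> = prob_mat (entry (polar l UNIV)) ?xs (spin (set ss)) $$ (a, b)"
      proof -
        have "?xs ! b \<in> set rs" using False ab by (simp add: nth_append)
        hence "?xs ! b \<notin> set ss" using xs(1) by auto
        thus ?thesis using ab by (simp add: prob_mat_def spin_def)
      qed
      finally show ?thesis .
    qed
  qed (simp_all add: prob_mat_def D_def)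
  moreover have "det D = det (minor_mat (entry ?A) ss)"
  proof -
    \<comment> \<open>Listing \<open>ss\<close> first makes D block lower triangular.\<close>
    have "D = four_block_mat (minor_mat (entry ?A) ss) (0\<^sub>m ?n ?m) (mat ?m ?n (\<lambda>(a, b). entry ?A (rs ! a) (ss ! b))) (1\<^sub>m ?m)"
      by (intro eq_matI) (auto simp: D_def minor_mat_def nth_append)
    also have "det \<dots> = det (minor_mat (entry ?A) ss) * det (1\<^sub>m ?m :: real mat)"
      by (rule det_four_block_mat_upper_right_zero[OF minor_mat_carrier]) auto
    finally show ?thesis by simp
  qed
  ultimately show ?thesis using det_mult[OF G D] by simp
qed

end

section \<open>The infinite-volume measure\<close>

text \<open>\<open>is_ground_zrestriction\<close> ranges over every integer-valued \<open>x\<close>;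
  a value other than -1 or 1 on \<open>L\<close> makes the event empty, where the determinant
  formula would be wrong.\<close>

definition z_measure :: "real \<Rightarrow> int set \<Rightarrow> (int \<Rightarrow> int) \<Rightarrow> real" where
  "z_measure l L x = (if \<forall>i\<in>L. x i \<in> {-1, 1} then det (prob_mat (entry (polar l UNIV)) (sorted_list_of_set L) x) else 0)"

lemma spin_pm: "spin S i \<in> {-1, 1}"
  by (simp add: spin_def)

context
  fixes J h :: real
  assumes h: "h > 0" and J0: "J \<noteq> 0" and l: "\<bar>J / h\<bar> \<le> 1/100"
begin

abbreviation "gs_mu \<equiv> z_measure (J / h)"

section \<open>The limit measure and its consistency\<close>

lemma mu_lim:
  assumes "finite L" "\<And>n. ground_state J h n (psis n)"
  shows "(\<lambda>n. box_prob n (psis n) L x) \<longlonglongrightarrow> gs_mu L x"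
proof (cases "\<forall>i\<in>L. x i \<in> {-1, 1}")
  case True
  thus ?thesis using box_prob_lim[OF h l assms(2), of "sorted_list_of_set L" x] assms(1) by (simp add: z_measure_def)
next
  case False
  then obtain i where "i \<in> L" "x i \<notin> {-1, 1}" by blast
  hence "box_prob n (psis n) L x = 0" for n by (rule box_prob_invalid)
  moreover have "gs_mu L x = 0" unfolding z_measure_def if_not_P[OF False] ..
  ultimately show ?thesis by simp
qed

lemma ground_zrestriction: "is_ground_zrestriction J h gs_mu"
  unfolding is_ground_zrestriction_def using mu_lim by blast

lemma obtain_ground_states: obtains psis where "\<And>n. ground_state J h n (psis n)"
  using ground_state_exists by metis

text \<open>Independence of the order of the sites comes from uniqueness of the limit:
  \<open>box_prob\<close> sees only the set.\<close>

lemma mu_list: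
  assumes "distinct xs" "\<And>i. i \<in> set xs \<Longrightarrow> x i \<in> {-1, 1}"
  shows "gs_mu (set xs) x = det (prob_mat (entry (polar (J / h) UNIV)) xs x)"
proof -
  obtain psis where g: "\<And>n. ground_state J h n (psis n)" using obtain_ground_states by blast
  show ?thesis by (rule LIMSEQ_unique[OF mu_lim[OF finite_set g] box_prob_lim[OF h l g assms]])
qed

lemma mu_nonneg: "finite L \<Longrightarrow> 0 \<le> gs_mu L x"
proof -
  assume L: "finite L"
  obtain psis where g: "\<And>n. ground_state J h n (psis n)" using obtain_ground_states by blast
  show ?thesis by (rule LIMSEQ_le_const[OF mu_lim[OF L g]]) (auto intro: box_prob_nonneg)
qed

lemma mu_mono:
  assumes "L \<subseteq> L'" "finite L'" shows "gs_mu L' x \<le> gs_mu L x"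
proof -
  obtain psis where g: "\<And>n. ground_state J h n (psis n)" using obtain_ground_states by blast
  show ?thesis by (rule LIMSEQ_le[OF mu_lim[OF assms(2) g] mu_lim[OF finite_subset[OF assms] g]])
     (use box_prob_mono[OF assms(1)] in blast)
qed

lemma mu_cong:
  assumes "finite L" "\<And>i. i \<in> L \<Longrightarrow> x i = y i" shows "gs_mu L x = gs_mu L y"
proof -
  obtain psis where g: "\<And>n. ground_state J h n (psis n)" using obtain_ground_states by blast
  have "box_prob n (psis n) L x = box_prob n (psis n) L y" for n by (rule box_prob_cong[OF assms(2)])
  thus ?thesis using LIMSEQ_unique[OF mu_lim[OF assms(1) g, of x]] mu_lim[OF assms(1) g, of y] by simp
qed

lemma mu_split:
  assumes "finite L" "i \<in> L" "x i \<in> {-1, 1}" shows "gs_mu (L - {i}) x = gs_mu L x + gs_mu L (flip i x)"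
proof -
  obtain psis where g: "\<And>n. ground_state J h n (psis n)" using obtain_ground_states by blast
  have "(\<lambda>n. box_prob n (psis n) L x + box_prob n (psis n) L (flip i x)) \<longlonglongrightarrow> gs_mu L x + gs_mu L (flip i x)"
    by (intro tendsto_add mu_lim assms g)
  moreover have "\<forall>\<^sub>F n in sequentially. box_prob n (psis n) (L - {i}) x = box_prob n (psis n) L x + box_prob n (psis n) L (flip i x)"
    using finite_subset_box[OF finite.insertI[OF finite.emptyI], of i] by eventually_elim (auto intro!: box_prob_split assms)
  ultimately have "(\<lambda>n. box_prob n (psis n) (L - {i}) x) \<longlonglongrightarrow> gs_mu L x + gs_mu L (flip i x)"
    by (simp add: tendsto_cong)
  moreover have "(\<lambda>n. box_prob n (psis n) (L - {i}) x) \<longlonglongrightarrow> gs_mu (L - {i}) x" by (intro mu_lim g) (use assms in auto)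
  ultimately show ?thesis using LIMSEQ_unique by blast
qed

section \<open>Ratios in large windows\<close>

abbreviation "pairing \<equiv> entry (cayley (polar (J / h) UNIV - 1))"

lemma mu_ratio:
  assumes "distinct ss" "set ss \<subseteq> box M"
  shows "gs_mu (box M) (spin (set ss)) = gs_mu (box M) (spin {}) * det (minor_mat (entry (cayley (trunc (J / h) M))) ss)"
proof -
  obtain rs where rs: "distinct rs" "set rs = box M - set ss" using finite_distinct_list[of "box M - set ss"] by auto
  have xs: "distinct (ss @ rs)" "set (ss @ rs) = box M" using assms rs by auto
  have "gs_mu (box M) (spin S) = det (prob_mat (entry (polar (J / h) UNIV)) (ss @ rs) (spin S))" for S
    using mu_list[OF xs(1), of "spin S"] spin_pm xs(2) by simp
  thus ?thesis using det_ratio[OF l xs] by simp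
qed

lemma mu_plus_pos: "gs_mu (box M) (spin {}) > 0"
proof -
  obtain xs where xs: "distinct xs" "set xs = box M" using finite_distinct_list[of "box M"] by auto
  have "gs_mu (box M) (spin {}) \<noteq> 0" using det_plus_nonzero[OF l xs] mu_list[OF xs(1), of "spin {}"] spin_pm xs(2) by simp
  thus ?thesis using mu_nonneg[of "box M" "spin {}"] by simp
qed

lemma ratio_lim:
  assumes "distinct ss"
  shows "(\<lambda>M. gs_mu (box M) (spin (set ss)) / gs_mu (box M) (spin {})) \<longlonglongrightarrow> det (minor_mat pairing ss)"
proof -
  have "(\<lambda>M. det (minor_mat (entry (cayley (trunc (J / h) M))) ss)) \<longlonglongrightarrow> det (minor_mat pairing ss)"
    unfolding minor_mat_def by (intro det_tendsto cayley_trunc_lim[OF l])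
  moreover have "\<forall>\<^sub>F M in sequentially. gs_mu (box M) (spin (set ss)) / gs_mu (box M) (spin {}) = det (minor_mat (entry (cayley (trunc (J / h) M))) ss)"
    using finite_subset_box[OF finite_set, of ss]
  proof eventually_elim
    case (elim M)
    show ?case using mu_ratio[OF assms elim] mu_plus_pos[of M] by simp
  qed
  ultimately show ?thesis by (simp add: tendsto_cong)
qed

text \<open>Evenness is automatic, as odd minors of \<open>pairing\<close> vanish.\<close>

lemma nonsingular_on_extend_pairing:
  assumes "finite T" "finite Fb" "T \<inter> Fb = {}"
  obtains ss where "distinct ss" "T \<subseteq> set ss" "set ss \<inter> Fb = {}" "det (minor_mat pairing ss) \<noteq> 0" "even (length ss)"
proof -
  have l0: "J / h \<noteq> 0" using J0 h by simp
  have "\<exists>B. finite B \<and> T \<subseteq> B \<and> B \<inter> Fb = {} \<and> nonsingular_on pairing B"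
  proof (rule nonsingular_on_extend[OF _ _ assms])
    show "pairing i j = - pairing j i" for i j by (rule cayley_inf_antisym[OF l])
    show "x j = 0" if "finite U" "finite Fb" "\<And>i. i \<notin> Fb \<Longrightarrow> (\<Sum>j\<in>U. pairing i j * x j) = 0" "j \<in> U" for U x Fb j
      by (rule finite_support_cayley[OF l l0 that])
  qed
  then obtain B where B: "finite B" "T \<subseteq> B" "B \<inter> Fb = {}" "nonsingular_on pairing B" by blast
  obtain ss where ss: "distinct ss" "set ss = B" using finite_distinct_list[OF B(1)] by blast
  have d: "det (minor_mat pairing ss) \<noteq> 0" using nonsingular_on_det[OF ss(1)] B ss by simp
  have "even (length ss)"
  proof (rule ccontr)
    assume "odd (length ss)"
    hence "det (minor_mat pairing ss) = 0" by (rule det_antisym_odd[OF cayley_inf_antisym[OF l]])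
    thus False using d by simp
  qed
  thus thesis using that[of ss] ss B d by blast
qed

text \<open>Extend the minus sites of \<open>L\<close> to a set with nonzero minor that avoids its
  plus sites. Some large box gives the extension positive probability, and the marginal on
  \<open>L\<close> is at least as large.\<close>

lemma mu_non_null: "non_null gs_mu"
  unfolding non_null_def
proof (intro allI impI)
  fix L :: "int set" and x assume L: "finite L" and x: "x \<in> spin_configs"
  obtain ss where ss: "distinct ss" "{i \<in> L. x i = -1} \<subseteq> set ss" "set ss \<inter> {i \<in> L. x i = 1} = {}" "det (minor_mat pairing ss) \<noteq> 0"
    by (rule nonsingular_on_extend_pairing[of "{i \<in> L. x i = -1}" "{i \<in> L. x i = 1}"]) (use L in auto)
  have "\<forall>\<^sub>F M in sequentially. gs_mu (box M) (spin (set ss)) / gs_mu (box M) (spin {}) \<noteq> 0"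
    by (rule tendsto_imp_eventually_ne[OF ratio_lim[OF ss(1)] ss(4)])
  with finite_subset_box[OF L]
  have "\<forall>\<^sub>F M in sequentially. L \<subseteq> box M \<and> gs_mu (box M) (spin (set ss)) \<noteq> 0"
    by eventually_elim auto
  then obtain M where M: "L \<subseteq> box M" "gs_mu (box M) (spin (set ss)) \<noteq> 0"
    using eventually_happens'[OF sequentially_bot] by blast
  have "0 < gs_mu (box M) (spin (set ss))" using mu_nonneg[of "box M" "spin (set ss)"] M(2) by simp
  also have "\<dots> \<le> gs_mu L (spin (set ss))" by (rule mu_mono[OF M(1)]) simp
  also have "\<dots> = gs_mu L x"
  proof (rule mu_cong[OF L])
    fix i assume i: "i \<in> L"
    have "x i = -1 \<or> x i = 1" using x by (auto simp: spin_configs_def)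
    thus "spin (set ss) i = x i" using i ss(2,3) by (auto simp: spin_def)
  qed
  finally show "0 < gs_mu L x" .
qed

text \<open>Relative to all plus, the configuration with minus at \<open>i\<close> has limit d' and
  the one with plus at \<open>i\<close> has limit d; the conditional probability is that of the
  minus.\<close>

lemma cond_prob_lim:
  assumes ss: "distinct ss" and i: "i \<notin> set ss"
  defines "d \<equiv> det (minor_mat pairing ss)" and "d' \<equiv> det (minor_mat pairing (i # ss))"
  assumes "d + d' \<noteq> 0"
  shows "(\<lambda>M. cond_prob gs_mu i (box M) (spin (insert i (set ss)))) \<longlonglongrightarrow> d' / (d + d')"
proof -
  define r where "r = (\<lambda>S M. gs_mu (box M) (spin S) / gs_mu (box M) (spin {}))"
  have r1: "r (set ss) \<longlonglongrightarrow> d" using ratio_lim[OF ss] by (simp add: r_def d_def)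
  have r2: "r (insert i (set ss)) \<longlonglongrightarrow> d'" using ratio_lim[of "i # ss"] ss i by (simp add: r_def d'_def)
  have "(\<lambda>M. r (insert i (set ss)) M / (r (set ss) M + r (insert i (set ss)) M)) \<longlonglongrightarrow> d' / (d + d')"
    by (intro tendsto_divide tendsto_add r1 r2 assms)
  moreover have "\<forall>\<^sub>F M in sequentially. cond_prob gs_mu i (box M) (spin (insert i (set ss)))
      = r (insert i (set ss)) M / (r (set ss) M + r (insert i (set ss)) M)"
    using finite_subset_box[OF finite.insertI[OF finite.emptyI], of i]
  proof eventually_elim
    case (elim M)
    have "flip i (spin (insert i (set ss))) = spin (set ss)" using i by (auto simp: flip_spin toggle_def)
    hence "gs_mu (box M - {i}) (spin (insert i (set ss))) = gs_mu (box M) (spin (insert i (set ss))) + gs_mu (box M) (spin (set ss))"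
      using mu_split[OF finite_box, of i M "spin (insert i (set ss))"] elim spin_pm by auto
    thus ?case using mu_plus_pos[of M] by (simp add: cond_prob_def r_def add_divide_distrib[symmetric] add.commute)
  qed
  ultimately show ?thesis by (simp add: tendsto_cong)
qed

text \<open>Both boundary conditions are plus off a finite set, but the number of minus sites other
  than 0 is odd for \<open>s1\<close> and even for \<open>s2\<close>. Since odd minors vanish, a
  minus at 0 has limiting probability 1 in the first case and 0 in the second.\<close>

lemma mu_bad: "bad_config gs_mu (\<lambda>_. -1)"
  unfolding bad_config_def
proof (rule exI[of _ "1/2"], intro conjI exI[of _ "0::int"] allI impI)
  fix L :: "int set" assume L: "finite L" "0 \<in> L"
  obtain s1 where s1: "distinct s1" "L \<subseteq> set s1" "det (minor_mat pairing s1) \<noteq> 0" "even (length s1)"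
    by (rule nonsingular_on_extend_pairing[of L "{}"]) (use L in auto)
  obtain s2 where s2: "distinct s2" "L - {0} \<subseteq> set s2" "0 \<notin> set s2" "det (minor_mat pairing s2) \<noteq> 0" "even (length s2)"
    by (rule nonsingular_on_extend_pairing[of "L - {0}" "{0}"]) (use L in auto)
  define t1 where "t1 = remove1 0 s1"
  have t1: "distinct t1" "0 \<notin> set t1" "insert 0 (set t1) = set s1" "length s1 = Suc (length t1)"
    using s1 L length_pos_if_in_set[of 0 s1] by (auto simp: t1_def length_remove1)
  have odd0: "det (minor_mat pairing xs) = 0" if "odd (length xs)" for xs by (rule det_antisym_odd[OF cayley_inf_antisym[OF l] that])
  have d1: "det (minor_mat pairing (0 # t1)) \<noteq> 0"
  proof -
    have "nonsingular_on pairing (set (0 # t1))" using nonsingular_on_det[OF s1(1)] s1(3) t1(3) by simp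
    thus ?thesis using nonsingular_on_det[of "0 # t1" pairing] t1 by simp
  qed
  have z1: "det (minor_mat pairing t1) = 0" using odd0[of t1] s1(4) t1(4) by simp
  have z2: "det (minor_mat pairing (0 # s2)) = 0" using odd0[of "0 # s2"] s2(5) by simp
  have "(\<lambda>M. cond_prob gs_mu 0 (box M) (spin (insert 0 (set t1)))) \<longlonglongrightarrow> 1"
    using cond_prob_lim[OF t1(1,2)] d1 z1 by simp
  hence c1: "(\<lambda>M. cond_prob gs_mu 0 (box M) (spin (set s1))) \<longlonglongrightarrow> 1" by (simp add: t1(3))
  have c2: "(\<lambda>M. cond_prob gs_mu 0 (box M) (spin (insert 0 (set s2)))) \<longlonglongrightarrow> 0"
    using cond_prob_lim[OF s2(1,3)] s2(4) z2 by simp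
  \<comment> \<open>The thresholds 3/4 and 1/4 leave the gap 1/2 taken for \<epsilon>.\<close>
  have "\<forall>\<^sub>F M in sequentially. cond_prob gs_mu 0 (box M) (spin (set s1)) > 3/4" by (rule order_tendstoD(1)[OF c1]) simp
  moreover have "\<forall>\<^sub>F M in sequentially. cond_prob gs_mu 0 (box M) (spin (insert 0 (set s2))) < 1/4" by (rule order_tendstoD(2)[OF c2]) simp
  moreover note finite_subset_box[OF L(1)]
  ultimately have "\<forall>\<^sub>F M in sequentially. cond_prob gs_mu 0 (box M) (spin (set s1)) > 3/4 \<and>
      cond_prob gs_mu 0 (box M) (spin (insert 0 (set s2))) < 1/4 \<and> L \<subseteq> box M" by eventually_elim auto
  then obtain M where M: "cond_prob gs_mu 0 (box M) (spin (set s1)) > 3/4"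
      "cond_prob gs_mu 0 (box M) (spin (insert 0 (set s2))) < 1/4" "L \<subseteq> box M"
    using eventually_happens'[OF sequentially_bot] by blast
  have g1: "glue L (\<lambda>_. -1) (spin (set s1)) = spin (set s1)" using s1(2) by (intro ext) (auto simp: glue_def spin_def)
  \<comment> \<open>Gluing overwrites the plus at 0 by -1, the value whose conditional probability
    is asked for.\<close>
  have g2: "glue L (\<lambda>_. -1) (spin (set s2)) = spin (insert 0 (set s2))" using s2(2) L(2) by (intro ext) (auto simp: glue_def spin_def)
  have sp: "spin S \<in> spin_configs" for S by (auto simp: spin_configs_def spin_def)
  have pos: "gs_mu (box M - {0}) (spin S) > 0" for S
    by (rule mu_non_null[unfolded non_null_def, rule_format, OF _ sp]) simp
  show "\<exists>G y y'. finite G \<and> L \<subseteq> G \<and> y \<in> spin_configs \<and> y' \<in> spin_configs \<and>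
      0 < gs_mu (G - {0}) (glue L (\<lambda>_. -1) y) \<and> 0 < gs_mu (G - {0}) (glue L (\<lambda>_. -1) y') \<and>
      1/2 < \<bar>cond_prob gs_mu 0 G (glue L (\<lambda>_. -1) y) - cond_prob gs_mu 0 G (glue L (\<lambda>_. -1) y')\<bar>"
    by (rule exI[of _ "box M"], rule exI[of _ "spin (set s1)"], rule exI[of _ "spin (set s2)"])
      (unfold g1 g2, use M sp pos in auto)
qed simp

end

theorem theorem3:
  fixes h :: real
  assumes "h > 0"
  shows "\<exists>\<delta> > 0. \<forall>J :: real. J \<noteq> 0 \<and> \<bar>J / h\<bar> < \<delta> \<longrightarrow>
           (\<exists>mu. is_ground_zrestriction J h mu \<and> non_null mu \<and>
                 bad_config mu (\<lambda>_. -1))"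
\<comment> \<open>The bound assumed in the norm estimates; it is uniform in h because only J/h
  enters them.\<close>
proof (rule exI[of _ "1/100"], intro conjI allI impI)
  fix J :: real assume J: "J \<noteq> 0 \<and> \<bar>J / h\<bar> < 1/100"
  have l: "\<bar>J / h\<bar> \<le> 1/100" and J0: "J \<noteq> 0" using J by auto
  note f = assms J0 l
  show "\<exists>mu. is_ground_zrestriction J h mu \<and> non_null mu \<and> bad_config mu (\<lambda>_. -1)"
    using ground_zrestriction[OF f] mu_non_null[OF f] mu_bad[OF f] by blast
qed simp

end
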